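(* Let $(\mathfrak{g},[\,,\,],\alpha)$ be a (multiplicative) Hom-Lie algebra. Then the ideal $\mathcal{J}^{\mathfrak{g}}$ is a Hom-Hopf ideal of the free Hom-associative algebra with generators in $\mathfrak{g}$, $(\mathbb{T}^{\mathfrak g}/\mathcal{I}^{\mathfrak g},\vee,\alpha,\mathbf{1},\Delta,\mathrm{id},\epsilon,S)$; that is, all the structural maps go to the quotient by $\mathcal{J}^{\mathfrak g}$.
   Context: $\mathbb{K}$ is a field, $\mathbb{N}=\{0,1,2,\dots\}$. A (multiplicative) Hom-Lie algebra $(\mathfrak g,[\,,\,],\alpha)$ is a vector space with a skew-symmetric bilinear bracket and a linear map $\alpha:\mathfrak g\to\mathfrak g$ with $\alpha([x,y])=[\alpha(x),\alpha(y)]$ and $[\alpha(x),[y,z]]+[\alpha(y),[z,x]]+[\alpha(z),[x,y]]=0$. Trees. For $n\ge 1$, $T_n$ is the set of planar binary rooted trees with $n$ leaves (labelled $1,\dots,n$ from left to right); $T_1=\{|\}$. Grafting $\varphi\vee\psi\in T_{p+q}$ of $\varphi\in T_p,\psi\in T_q$ joins the roots of $\varphi$ (left) and $\psi$ (right) to a new root. A leaf weighted $n$-tree is a pair $(\varphi,a)$ with $\varphi\in T_n$, $a\in\mathbb{N}^n$; $B_n$ is the set of these; $(\varphi,a)\vee(\psi,b)=(\varphi\vee\psi,(a,b))$. $B$ is the disjoint union of all $B_n$ and one further element $\mathbf{1}$; $\mathbb{T}$ is the vector space with basis $B$. On $\mathbb{T}$: $\alpha$ is linear with $\alpha(\mathbf{1})=\mathbf{1}$,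 $\alpha(\varphi,a_1,\dots,a_n)=(\varphi,a_1+1,\dots,a_n+1)$; $\vee$ is bilinear, equal to grafting on leaf weighted trees, with $\varphi\vee\mathbf{1}=\mathbf{1}\vee\varphi=\alpha(\varphi)$, $\mathbf{1}\vee\mathbf{1}=\mathbf{1}$. For $\varphi\in B_n$, $I\subset\{1,\dots,n\}$, $\varphi_I\in B$ is obtained by replacing the leaves not in $I$ by $\mathbf{1}$ and evaluating $\vee$; it is a tree with $|I|$ leaves ($\varphi_\emptyset=\mathbf{1}$). $S$ is the linear map on $\mathbb{T}$ with $S(\mathbf{1})=\mathbf{1}$, $S(|,a)=-(|,a)$, $S(\varphi\vee\psi)=S(\psi)\vee S(\varphi)$. $\mathcal{I}\subset\mathbb{T}$ is the two-sided ideal for $\vee$ generated by all $(\phi\vee\psi)\vee\alpha(\chi)-\alpha(\phi)\vee(\psi\vee\chi)$, $\phi,\psi,\chi\in B$. Free Hom-associative algebra with generators in $\mathfrak g$. Writing $B_n$ also for the linear span of $B_n$, put $\mathbb{T}^{\mathfrak g}=\mathbb{K}\mathbf{1}\oplus\bigoplus_{n\ge1}B_n\otimes\mathfrak g^{\otimes n}$ (an element $\varphi\otimes x_1\otimes\cdots\otimes x_n$ is a weighted tree with $x_i$ placed on leaf $i$). The operations extend naturally: $(\varphi\otimes x)\vee(\psi\otimes y)=(\varphi\vee\psi)\otimes(x\otimes y)$; $\alpha(\varphi\otimes x)=\alpha(\varphi)\otimes x$; $\mathbf{1}\vee(\varphi\otimes x)=(\varphi\otimes x)\vee\mathbf{1}=\alpha(\varphi\otimes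 x)$, $\mathbf 1\vee\mathbf 1=\mathbf 1$, $\alpha(\mathbf 1)=\mathbf 1$; $\Delta(\varphi\otimes x_1\otimes\cdots\otimes x_n)=\sum_{I\sqcup J=\{1,\dots,n\}}(\varphi_I\otimes x_I)\otimes(\varphi_J\otimes x_J)$, where $x_I$ is the tensor product of the $x_i$, $i\in I$, in increasing order, $\Delta(\mathbf 1)=\mathbf 1\otimes\mathbf 1$; $\epsilon(\mathbf 1)=1$ and $\epsilon=0$ on $B_n\otimes\mathfrak g^{\otimes n}$; $S(\varphi\otimes x_1\otimes\cdots\otimes x_n)=S(\varphi)\otimes x_n\otimes\cdots\otimes x_1$, $S(\mathbf 1)=\mathbf 1$. Let $\mathcal{I}^{\mathfrak g}=\bigoplus_{n\ge3}\mathcal{I}_n\otimes\mathfrak g^{\otimes n}$, with $\mathcal{I}_n=\mathcal{I}\cap B_n$ (span of $B_n$); it is an ideal for $\vee$ and a coideal, and $\mathbb{T}^{\mathfrak g}/\mathcal{I}^{\mathfrak g}$ with the induced operations is an $(\alpha,\mathrm{id})$-Hom-Hopf algebra, called the free Hom-associative algebra with generators in $\mathfrak g$. Here an $(\alpha,\mathrm{id})$-Hom-Hopf algebra $(A,\vee,\alpha,\mathbf 1,\Delta,\mathrm{id},\epsilon,S)$ means: $\alpha$ is multiplicative, $\alpha(x)\vee(y\vee z)=(x\vee y)\vee\alpha(z)$, $x\vee\mathbf 1=\mathbf 1\vee x=\alpha(x)$, $\alpha(\mathbf 1)=\mathbf 1$; $(A,\Delta,\epsilon)$ is a counital coassociative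 coalgebra; $\Delta$ and $\epsilon$ are multiplicative and unital and $\epsilon\circ\alpha=\epsilon$; $S$ is an anti-homomorphism for $\vee$ commuting with $\alpha$, with $S(\mathbf 1)=\mathbf 1$, $\epsilon\circ S=\epsilon$, such that for each $x$ there is $k\in\mathbb N$ with $\alpha^k\circ\vee\circ(S\otimes\mathrm{id})\circ\Delta(x)=\alpha^k\circ\vee\circ(\mathrm{id}\otimes S)\circ\Delta(x)=\epsilon(x)\mathbf 1$. The ideal $\mathcal{J}^{\mathfrak g}$. It is the two-sided ideal of $(\mathbb{T}^{\mathfrak g}/\mathcal{I}^{\mathfrak g},\vee,\mathbf 1)$ generated by (i) $(|,n)\otimes x-(|,0)\otimes\alpha^n(x)$ for $x\in\mathfrak g$, $n\in\mathbb N$, and (ii) $\big((|,0)\vee(|,0)\big)\otimes x\otimes y-\big((|,0)\vee(|,0)\big)\otimes y\otimes x-(|,0)\otimes[x,y]$ for $x,y\in\mathfrak g$. A Hom-Hopf ideal of such an $A$ is a two-sided ideal $\mathcal J$ for $\vee$ through which all structural maps go to the quotient: $\alpha(\mathcal J)\subset\mathcal J$, $\Delta(\mathcal J)\subset\mathcal J\otimes A+A\otimes\mathcal J$, $\epsilon(\mathcal J)=0$, $S(\mathcal J)\subset\mathcal J$. (The quotient of the free Hom-associative algebra with generators in $\mathfrak g$ by $\mathcal J^{\mathfrak g}$ is called the universal enveloping algebra $\mathcal U\mathfrak g$.) *)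

theory Defs
  imports "HOL-Algebra.Module" "HOL-Algebra.QuotRing"
begin

section \<open>Linear algebra over a field \<open>K\<close>\<close>

text \<open>
  Vector spaces are HOL-Algebra modules over a field. The record type of modules extends the one
  of rings, so it also has fields for a multiplication and a unit; \<^const>\<open>module\<close> ignores them, and
  they are left undefined in spaces that carry no product.
\<close>

definition lin_span :: "('k, 'r) ring_scheme \<Rightarrow> ('k, 'v, 'm) module_scheme \<Rightarrow> 'v set \<Rightarrow> 'v set" where
  "lin_span K M X = \<Inter> {H. submodule H K M \<and> X \<subseteq> H}"

definition free_module :: "('k, 'r) ring_scheme \<Rightarrow> 'b set \<Rightarrow> ('k, 'b \<Rightarrow> 'k) module" where
  "free_module K X =
    \<lparr>carrier = {f. (\<forall>b\<in>X. f b \<in> carrier K) \<and> (\<forall>b. b \<notin> X \<longrightarrow> f b = \<zero>\<^bsub>K\<^esub>) \<and> finite {b. f b \<noteq> \<zero>\<^bsub>K\<^esub>}},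
     monoid.mult = undefined, one = undefined,
     zero = (\<lambda>b. \<zero>\<^bsub>K\<^esub>), add = (\<lambda>f g b. f b \<oplus>\<^bsub>K\<^esub> g b),
     smult = (\<lambda>c f b. c \<otimes>\<^bsub>K\<^esub> f b)\<rparr>"

definition free_gen :: "('k, 'r) ring_scheme \<Rightarrow> 'b \<Rightarrow> 'b \<Rightarrow> 'k" where
  "free_gen K b = (\<lambda>b'. if b' = b then \<one>\<^bsub>K\<^esub> else \<zero>\<^bsub>K\<^esub>)"

text \<open>The linear map from a free module to \<open>M\<close> which sends the generator \<open>b\<close> to \<open>v b\<close>.\<close>

definition free_ext ::
  "('k, 'r) ring_scheme \<Rightarrow> ('k, 'v, 'm) module_scheme \<Rightarrow> ('b \<Rightarrow> 'v) \<Rightarrow> ('b \<Rightarrow> 'k) \<Rightarrow> 'v" where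
  "free_ext K M v f = (\<Oplus>\<^bsub>M\<^esub>b\<in>{b. f b \<noteq> \<zero>\<^bsub>K\<^esub>}. f b \<odot>\<^bsub>M\<^esub> v b)"

text \<open>
  Quotients consist of cosets, as for \<^const>\<open>FactRing\<close>; the product is the one induced on cosets,
  if \<open>M\<close> has a product and \<open>W\<close> is an ideal for it.
\<close>

definition quotient_module :: "('k, 'v, 'm) module_scheme \<Rightarrow> 'v set \<Rightarrow> ('k, 'v set) module" where
  "quotient_module M W =
    \<lparr>carrier = a_rcosets\<^bsub>M\<^esub> W,
     monoid.mult = rcoset_mult M W, one = W +>\<^bsub>M\<^esub> \<one>\<^bsub>M\<^esub>,
     zero = W, add = set_add M,
     smult = (\<lambda>c C. \<Union>x\<in>C. W +>\<^bsub>M\<^esub> (c \<odot>\<^bsub>M\<^esub> x))\<rparr>"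

text \<open>
  \<open>descend f\<close> is the map induced on cosets by a map \<open>f\<close> which is constant on each of them;
  \<open>quot_ext K M v\<close> is the linear map to \<open>M\<close>, defined on a quotient of a free module, which sends the
  class of the generator \<open>b\<close> to \<open>v b\<close>.
\<close>

definition descend :: "('v \<Rightarrow> 'w) \<Rightarrow> 'v set \<Rightarrow> 'w" where
  "descend f C = the_elem (f ` C)"

definition quot_ext ::
  "('k, 'r) ring_scheme \<Rightarrow> ('k, 'v, 'm) module_scheme \<Rightarrow> ('b \<Rightarrow> 'v) \<Rightarrow> ('b \<Rightarrow> 'k) set \<Rightarrow> 'v" where
  "quot_ext K M v = descend (free_ext K M v)"

definition bilinear_rels ::
  "('k, 'r) ring_scheme \<Rightarrow> ('k, 'v, 'm) module_scheme \<Rightarrow> ('k, 'w, 'n) module_scheme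
    \<Rightarrow> ('v \<times> 'w \<Rightarrow> 'k) set" where
  "bilinear_rels K V W = (let F = free_module K (carrier V \<times> carrier W); e = free_gen K in
     {e (x \<oplus>\<^bsub>V\<^esub> y, z) \<ominus>\<^bsub>F\<^esub> (e (x, z) \<oplus>\<^bsub>F\<^esub> e (y, z)) | x y z.
        x \<in> carrier V \<and> y \<in> carrier V \<and> z \<in> carrier W} \<union>
     {e (x, y \<oplus>\<^bsub>W\<^esub> z) \<ominus>\<^bsub>F\<^esub> (e (x, y) \<oplus>\<^bsub>F\<^esub> e (x, z)) | x y z.
        x \<in> carrier V \<and> y \<in> carrier W \<and> z \<in> carrier W} \<union>
     {e (c \<odot>\<^bsub>V\<^esub> x, y) \<ominus>\<^bsub>F\<^esub> c \<odot>\<^bsub>F\<^esub> e (x, y) | c x y.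
        c \<in> carrier K \<and> x \<in> carrier V \<and> y \<in> carrier W} \<union>
     {e (x, c \<odot>\<^bsub>W\<^esub> y) \<ominus>\<^bsub>F\<^esub> c \<odot>\<^bsub>F\<^esub> e (x, y) | c x y.
        c \<in> carrier K \<and> x \<in> carrier V \<and> y \<in> carrier W})"

definition bilinear_null ::
  "('k, 'r) ring_scheme \<Rightarrow> ('k, 'v, 'm) module_scheme \<Rightarrow> ('k, 'w, 'n) module_scheme
    \<Rightarrow> ('v \<times> 'w \<Rightarrow> 'k) set" where
  "bilinear_null K V W =
     lin_span K (free_module K (carrier V \<times> carrier W)) (bilinear_rels K V W)"

definition tensor_module ::
  "('k, 'r) ring_scheme \<Rightarrow> ('k, 'v, 'm) module_scheme \<Rightarrow> ('k, 'w, 'n) module_scheme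
    \<Rightarrow> ('k, ('v \<times> 'w \<Rightarrow> 'k) set) module" where
  "tensor_module K V W =
     quotient_module (free_module K (carrier V \<times> carrier W)) (bilinear_null K V W)"

definition tensor ::
  "('k, 'r) ring_scheme \<Rightarrow> ('k, 'v, 'm) module_scheme \<Rightarrow> ('k, 'w, 'n) module_scheme
    \<Rightarrow> 'v \<Rightarrow> 'w \<Rightarrow> ('v \<times> 'w \<Rightarrow> 'k) set" where
  "tensor K V W x y =
     bilinear_null K V W +>\<^bsub>free_module K (carrier V \<times> carrier W)\<^esub> free_gen K (x, y)"

text \<open>The linear map \<open>f \<otimes> g\<close> with values in \<open>V \<otimes> W\<close>.\<close>

definition tensor_map ::
  "('k, 'r) ring_scheme \<Rightarrow> ('k, 'v, 'm) module_scheme \<Rightarrow> ('k, 'w, 'n) module_scheme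
    \<Rightarrow> ('a \<Rightarrow> 'v) \<Rightarrow> ('b \<Rightarrow> 'w) \<Rightarrow> ('a \<times> 'b \<Rightarrow> 'k) set \<Rightarrow> ('v \<times> 'w \<Rightarrow> 'k) set" where
  "tensor_map K V W f g = quot_ext K (tensor_module K V W) (\<lambda>(x, y). tensor K V W (f x) (g y))"

definition base_module :: "('k, 'r) ring_scheme \<Rightarrow> ('k, 'k) module" where
  "base_module K =
    \<lparr>carrier = carrier K, monoid.mult = mult K, one = \<one>\<^bsub>K\<^esub>, zero = \<zero>\<^bsub>K\<^esub>, add = add K,
     smult = mult K\<rparr>"


section \<open>Hom-Lie algebras\<close>

locale hom_lie_algebra = field K + module K G
  for K :: "('k, 'r) ring_scheme" (structure) and G :: "('k, 'g, 'm) module_scheme" (structure) +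
  fixes bracket :: "'g \<Rightarrow> 'g \<Rightarrow> 'g" and \<alpha> :: "'g \<Rightarrow> 'g"
  assumes bracket_closed: "\<lbrakk>x \<in> carrier G; y \<in> carrier G\<rbrakk> \<Longrightarrow> bracket x y \<in> carrier G"
    and bracket_add_left: "\<lbrakk>x \<in> carrier G; y \<in> carrier G; z \<in> carrier G\<rbrakk> \<Longrightarrow>
      bracket (x \<oplus>\<^bsub>G\<^esub> y) z = bracket x z \<oplus>\<^bsub>G\<^esub> bracket y z"
    and bracket_add_right: "\<lbrakk>x \<in> carrier G; y \<in> carrier G; z \<in> carrier G\<rbrakk> \<Longrightarrow>
      bracket x (y \<oplus>\<^bsub>G\<^esub> z) = bracket x y \<oplus>\<^bsub>G\<^esub> bracket x z"
    and bracket_smult_left: "\<lbrakk>c \<in> carrier K; x \<in> carrier G; y \<in> carrier G\<rbrakk> \<Longrightarrow>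
      bracket (c \<odot>\<^bsub>G\<^esub> x) y = c \<odot>\<^bsub>G\<^esub> bracket x y"
    and bracket_smult_right: "\<lbrakk>c \<in> carrier K; x \<in> carrier G; y \<in> carrier G\<rbrakk> \<Longrightarrow>
      bracket x (c \<odot>\<^bsub>G\<^esub> y) = c \<odot>\<^bsub>G\<^esub> bracket x y"
    and bracket_skew: "\<lbrakk>x \<in> carrier G; y \<in> carrier G\<rbrakk> \<Longrightarrow> bracket x y = \<ominus>\<^bsub>G\<^esub> bracket y x"
    and hom_closed: "x \<in> carrier G \<Longrightarrow> \<alpha> x \<in> carrier G"
    and hom_add: "\<lbrakk>x \<in> carrier G; y \<in> carrier G\<rbrakk> \<Longrightarrow> \<alpha> (x \<oplus>\<^bsub>G\<^esub> y) = \<alpha> x \<oplus>\<^bsub>G\<^esub> \<alpha> y"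
    and hom_smult: "\<lbrakk>c \<in> carrier K; x \<in> carrier G\<rbrakk> \<Longrightarrow> \<alpha> (c \<odot>\<^bsub>G\<^esub> x) = c \<odot>\<^bsub>G\<^esub> \<alpha> x"
    and hom_bracket: "\<lbrakk>x \<in> carrier G; y \<in> carrier G\<rbrakk> \<Longrightarrow> \<alpha> (bracket x y) = bracket (\<alpha> x) (\<alpha> y)"
    and hom_jacobi: "\<lbrakk>x \<in> carrier G; y \<in> carrier G; z \<in> carrier G\<rbrakk> \<Longrightarrow>
      bracket (\<alpha> x) (bracket y z) \<oplus>\<^bsub>G\<^esub> bracket (\<alpha> y) (bracket z x) \<oplus>\<^bsub>G\<^esub> bracket (\<alpha> z) (bracket x y)
        = \<zero>\<^bsub>G\<^esub>"


section \<open>Two-sided ideals and Hom-Hopf data\<close>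

text \<open>
  In what follows the product \<open>\<or>\<close> and its unit \<open>\<one>\<close> are the record fields \<^const>\<open>mult\<close> and
  \<^const>\<open>one\<close>. The product is not associative, so the ring locales do not apply.
\<close>

definition two_sided_ideal ::
  "('k, 'r) ring_scheme \<Rightarrow> ('k, 'v, 'm) module_scheme \<Rightarrow> 'v set \<Rightarrow> bool" where
  "two_sided_ideal K A J \<longleftrightarrow> submodule J K A \<and>
     (\<forall>a\<in>carrier A. \<forall>j\<in>J. a \<otimes>\<^bsub>A\<^esub> j \<in> J \<and> j \<otimes>\<^bsub>A\<^esub> a \<in> J)"

definition generated_ideal ::
  "('k, 'r) ring_scheme \<Rightarrow> ('k, 'v, 'm) module_scheme \<Rightarrow> 'v set \<Rightarrow> 'v set" where
  "generated_ideal K A X = \<Inter> {J. two_sided_ideal K A J \<and> X \<subseteq> J}"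

record ('k, 'v) hom_hopf = "('k, 'v) module" +
  twist :: "'v \<Rightarrow> 'v"
  comult :: "'v \<Rightarrow> ('v \<times> 'v \<Rightarrow> 'k) set"
  counit :: "'v \<Rightarrow> 'k"
  antipode :: "'v \<Rightarrow> 'v"

definition hom_hopf_ideal ::
  "('k, 'r) ring_scheme \<Rightarrow> ('k, 'v, 'm) hom_hopf_scheme \<Rightarrow> 'v set \<Rightarrow> bool" where
  "hom_hopf_ideal K A J \<longleftrightarrow>
     two_sided_ideal K A J \<and>
     twist A ` J \<subseteq> J \<and>
     comult A ` J \<subseteq>
       lin_span K (tensor_module K A A) {tensor K A A j a | j a. j \<in> J \<and> a \<in> carrier A}
       <+>\<^bsub>tensor_module K A A\<^esub>
       lin_span K (tensor_module K A A) {tensor K A A a j | a j. a \<in> carrier A \<and> j \<in> J} \<and>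
     counit A ` J \<subseteq> {\<zero>\<^bsub>K\<^esub>} \<and>
     antipode A ` J \<subseteq> J"

text \<open>The structure induced on the quotient by an ideal and coideal \<open>I\<close>.\<close>

definition quotient_hom_hopf ::
  "('k, 'r) ring_scheme \<Rightarrow> ('k, 'v, 'm) hom_hopf_scheme \<Rightarrow> 'v set \<Rightarrow> ('k, 'v set) hom_hopf" where
  "quotient_hom_hopf K A I = (let Q = quotient_module A I; q = (\<lambda>x. I +>\<^bsub>A\<^esub> x) in
    \<lparr>carrier = carrier Q, monoid.mult = mult Q, one = \<one>\<^bsub>Q\<^esub>, zero = \<zero>\<^bsub>Q\<^esub>, add = add Q, smult = smult Q,
     twist = descend (\<lambda>x. q (twist A x)),
     comult = descend (\<lambda>x. tensor_map K Q Q q q (comult A x)),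
     counit = descend (counit A),
     antipode = descend (\<lambda>x. q (antipode A x))\<rparr>)"


section \<open>Leaf weighted trees\<close>

text \<open>
  A leaf weighted tree \<open>(\<phi>, a)\<close> is a planar binary tree whose leaves are labelled by the entries
  of \<open>a\<close>, from left to right. The set \<open>B\<close> is the type \<open>wtree option\<close>, where \<^const>\<open>None\<close> is
  the extra element \<open>\<one>\<close>, which has degree \<open>0\<close>.
\<close>

datatype wtree = Leaf nat | Graft wtree wtree

primrec leaves :: "wtree \<Rightarrow> nat" where
  "leaves (Leaf a) = 1"
| "leaves (Graft t u) = leaves t + leaves u"

primrec shift :: "wtree \<Rightarrow> wtree" where
  "shift (Leaf a) = Leaf (a + 1)"
| "shift (Graft t u) = Graft (shift t) (shift u)"

definition deg :: "wtree option \<Rightarrow> nat" where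
  "deg b = (case b of None \<Rightarrow> 0 | Some t \<Rightarrow> leaves t)"

definition basis_twist :: "wtree option \<Rightarrow> wtree option" where
  "basis_twist = map_option shift"

fun graft :: "wtree option \<Rightarrow> wtree option \<Rightarrow> wtree option" where
  "graft None b = basis_twist b"
| "graft b None = basis_twist b"
| "graft (Some t) (Some u) = Some (Graft t u)"

text \<open>\<open>\<phi>\<^sub>I\<close>, with the leaves numbered from \<open>0\<close>, as in \<^const>\<open>nths\<close>.\<close>

primrec tree_restrict :: "wtree \<Rightarrow> nat set \<Rightarrow> wtree option" where
  "tree_restrict (Leaf a) I = (if 0 \<in> I then Some (Leaf a) else None)"
| "tree_restrict (Graft t u) I =
     graft (tree_restrict t I) (tree_restrict u {i. i + leaves t \<in> I})"

definition basis_restrict :: "wtree option \<Rightarrow> nat set \<Rightarrow> wtree option" where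
  "basis_restrict b I = (case b of None \<Rightarrow> None | Some t \<Rightarrow> tree_restrict t I)"

definition tree_vee ::
  "('k, 'r) ring_scheme \<Rightarrow> (wtree option \<Rightarrow> 'k) \<Rightarrow> (wtree option \<Rightarrow> 'k) \<Rightarrow> (wtree option \<Rightarrow> 'k)" where
  "tree_vee K f g = (let F = free_module K UNIV in
     free_ext K F (\<lambda>b. free_ext K F (\<lambda>c. free_gen K (graft b c)) g) f)"

text \<open>The space \<open>\<T>\<close>, with product \<open>\<or>\<close>.\<close>

definition tree_space :: "('k, 'r) ring_scheme \<Rightarrow> ('k, wtree option \<Rightarrow> 'k) module" where
  "tree_space K = (free_module K UNIV)\<lparr>monoid.mult := tree_vee K, one := free_gen K None\<rparr>"

text \<open>The antipode of \<open>\<T>\<close> on basis elements.\<close>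

primrec tree_antipode :: "('k, 'r) ring_scheme \<Rightarrow> wtree \<Rightarrow> (wtree option \<Rightarrow> 'k)" where
  "tree_antipode K (Leaf a) = \<ominus>\<^bsub>tree_space K\<^esub> free_gen K (Some (Leaf a))"
| "tree_antipode K (Graft t u) = tree_antipode K u \<otimes>\<^bsub>tree_space K\<^esub> tree_antipode K t"

definition basis_antipode :: "('k, 'r) ring_scheme \<Rightarrow> wtree option \<Rightarrow> (wtree option \<Rightarrow> 'k)" where
  "basis_antipode K b = (case b of None \<Rightarrow> free_gen K None | Some t \<Rightarrow> tree_antipode K t)"

definition tree_ideal :: "('k, 'r) ring_scheme \<Rightarrow> (wtree option \<Rightarrow> 'k) set" where
  "tree_ideal K = generated_ideal K (tree_space K)
     {free_gen K (graft (graft b c) (basis_twist d)) \<ominus>\<^bsub>tree_space K\<^esub>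
      free_gen K (graft (basis_twist b) (graft c d)) | b c d. True}"

text \<open>\<open>\<I>\<^sub>n\<close>, the intersection of \<open>\<I>\<close> with the linear span of \<open>B\<^sub>n\<close>.\<close>

definition tree_ideal_deg :: "('k, 'r) ring_scheme \<Rightarrow> nat \<Rightarrow> (wtree option \<Rightarrow> 'k) set" where
  "tree_ideal_deg K n = tree_ideal K \<inter> lin_span K (tree_space K) {free_gen K b | b. deg b = n}"


section \<open>The free Hom-associative algebra with generators in \<open>\<gg>\<close>\<close>

text \<open>
  Since the trees with \<open>n\<close> leaves are a basis of the span of \<open>B\<^sub>n\<close>, the space
  \<open>K\<one> \<oplus> (\<Oplus>n\<ge>1. B\<^sub>n \<otimes> \<gg>\<^bsup>\<otimes>n\<^esup>)\<close> is generated by the symbols \<open>(b, [x\<^sub>1, \<dots>, x\<^sub>n])\<close> with \<open>n = deg b\<close>,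
  subject to linearity in each \<open>x\<^sub>i\<close>. The symbol \<open>(\<one>, [])\<close> accounts for the summand \<open>K\<one>\<close>.
\<close>

definition decorated :: "('k, 'g, 'm) module_scheme \<Rightarrow> (wtree option \<times> 'g list) set" where
  "decorated G = {(b, xs). length xs = deg b \<and> set xs \<subseteq> carrier G}"

definition multilinear_rels ::
  "('k, 'r) ring_scheme \<Rightarrow> ('k, 'g, 'm) module_scheme \<Rightarrow> (wtree option \<times> 'g list \<Rightarrow> 'k) set" where
  "multilinear_rels K G = (let F = free_module K (decorated G); e = free_gen K in
     {e (b, xs[i := x \<oplus>\<^bsub>G\<^esub> y]) \<ominus>\<^bsub>F\<^esub> (e (b, xs[i := x]) \<oplus>\<^bsub>F\<^esub> e (b, xs[i := y])) | b xs i x y.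
        (b, xs) \<in> decorated G \<and> i < length xs \<and> x \<in> carrier G \<and> y \<in> carrier G} \<union>
     {e (b, xs[i := c \<odot>\<^bsub>G\<^esub> x]) \<ominus>\<^bsub>F\<^esub> c \<odot>\<^bsub>F\<^esub> e (b, xs[i := x]) | b xs i c x.
        (b, xs) \<in> decorated G \<and> i < length xs \<and> c \<in> carrier K \<and> x \<in> carrier G})"

definition multilinear_null ::
  "('k, 'r) ring_scheme \<Rightarrow> ('k, 'g, 'm) module_scheme \<Rightarrow> (wtree option \<times> 'g list \<Rightarrow> 'k) set" where
  "multilinear_null K G = lin_span K (free_module K (decorated G)) (multilinear_rels K G)"

type_synonym ('k, 'g) dtree_class = "(wtree option \<times> 'g list \<Rightarrow> 'k) set"

definition dtree_module ::
  "('k, 'r) ring_scheme \<Rightarrow> ('k, 'g, 'm) module_scheme \<Rightarrow> ('k, ('k, 'g) dtree_class) module" where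
  "dtree_module K G = quotient_module (free_module K (decorated G)) (multilinear_null K G)"

text \<open>\<open>b \<otimes> x\<^sub>1 \<otimes> \<dots> \<otimes> x\<^sub>n\<close> for \<open>b\<close> in the basis \<open>B\<close>, and its linear extension in \<open>b\<close>.\<close>

definition dtree ::
  "('k, 'r) ring_scheme \<Rightarrow> ('k, 'g, 'm) module_scheme \<Rightarrow> wtree option \<Rightarrow> 'g list
    \<Rightarrow> ('k, 'g) dtree_class" where
  "dtree K G b xs = multilinear_null K G +>\<^bsub>free_module K (decorated G)\<^esub> free_gen K (b, xs)"

definition decorate ::
  "('k, 'r) ring_scheme \<Rightarrow> ('k, 'g, 'm) module_scheme \<Rightarrow> (wtree option \<Rightarrow> 'k) \<Rightarrow> 'g list
    \<Rightarrow> ('k, 'g) dtree_class" where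
  "decorate K G u xs = free_ext K (dtree_module K G) (\<lambda>b. dtree K G b xs) u"

definition dtree_hopf ::
  "('k, 'r) ring_scheme \<Rightarrow> ('k, 'g, 'm) module_scheme \<Rightarrow> ('k, ('k, 'g) dtree_class) hom_hopf" where
  "dtree_hopf K G = (let T = dtree_module K G; \<tau> = dtree K G in
    \<lparr>carrier = carrier T,
     monoid.mult = (\<lambda>u w. quot_ext K T (\<lambda>(b, xs). quot_ext K T (\<lambda>(c, ys). \<tau> (graft b c) (xs @ ys)) w) u),
     one = \<tau> None [], zero = \<zero>\<^bsub>T\<^esub>, add = add T, smult = smult T,
     twist = quot_ext K T (\<lambda>(b, xs). \<tau> (basis_twist b) xs),
     comult = quot_ext K (tensor_module K T T) (\<lambda>(b, xs).
       \<Oplus>\<^bsub>tensor_module K T T\<^esub>I\<in>Pow {..<deg b}.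
         tensor K T T (\<tau> (basis_restrict b I) (nths xs I))
           (\<tau> (basis_restrict b ({..<deg b} - I)) (nths xs ({..<deg b} - I)))),
     counit = quot_ext K (base_module K) (\<lambda>(b, xs). if b = None then \<one>\<^bsub>K\<^esub> else \<zero>\<^bsub>K\<^esub>),
     antipode = quot_ext K T (\<lambda>(b, xs). decorate K G (basis_antipode K b) (rev xs))\<rparr>)"

definition dtree_ideal ::
  "('k, 'r) ring_scheme \<Rightarrow> ('k, 'g, 'm) module_scheme \<Rightarrow> ('k, 'g) dtree_class set" where
  "dtree_ideal K G = lin_span K (dtree_module K G)
     {decorate K G u xs | u xs n.
        n \<ge> 3 \<and> u \<in> tree_ideal_deg K n \<and> length xs = n \<and> set xs \<subseteq> carrier G}"

definition free_hom_assoc ::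
  "('k, 'r) ring_scheme \<Rightarrow> ('k, 'g, 'm) module_scheme \<Rightarrow> ('k, ('k, 'g) dtree_class set) hom_hopf" where
  "free_hom_assoc K G = quotient_hom_hopf K (dtree_hopf K G) (dtree_ideal K G)"

definition fha_class ::
  "('k, 'r) ring_scheme \<Rightarrow> ('k, 'g, 'm) module_scheme \<Rightarrow> wtree option \<Rightarrow> 'g list
    \<Rightarrow> ('k, 'g) dtree_class set" where
  "fha_class K G b xs = dtree_ideal K G +>\<^bsub>dtree_hopf K G\<^esub> dtree K G b xs"

text \<open>The ideal \<open>\<J>\<close> defining the universal enveloping algebra.\<close>

definition enveloping_ideal ::
  "('k, 'r) ring_scheme \<Rightarrow> ('k, 'g, 'm) module_scheme \<Rightarrow> ('g \<Rightarrow> 'g \<Rightarrow> 'g) \<Rightarrow> ('g \<Rightarrow> 'g)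
    \<Rightarrow> ('k, 'g) dtree_class set set" where
  "enveloping_ideal K G bracket \<alpha> =
    (let A = free_hom_assoc K G; \<kappa> = fha_class K G; l = Some (Leaf 0) in
     generated_ideal K A
       ({\<kappa> (Some (Leaf n)) [x] \<ominus>\<^bsub>A\<^esub> \<kappa> l [(\<alpha> ^^ n) x] | n x. x \<in> carrier G} \<union>
        {\<kappa> (graft l l) [x, y] \<ominus>\<^bsub>A\<^esub> \<kappa> (graft l l) [y, x] \<ominus>\<^bsub>A\<^esub> \<kappa> l [bracket x y] | x y.
           x \<in> carrier G \<and> y \<in> carrier G}))"

end

theory Submission
  imports Defs
begin

text \<open>
  Every space in the statement is spanned by decorated trees \<open>b \<otimes> x\<^sub>1 \<otimes> \<dots> \<otimes> x\<^sub>n\<close>, and on these each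
  structure map is given by a formula. The ideal \<open>\<J>\<close> is generated by a set \<open>X\<close>, and stability under the
  structure maps can be read off from \<open>X\<close>, for the following reasons.

  The twist is left multiplication by the unit, so it preserves every two-sided ideal. The counit is
  multiplicative and the antipode reverses products, so the elements killed by the one and those sent
  into \<open>\<J>\<close> by the other form two-sided ideals. The comultiplication is multiplicative. This can be
  said without a product on \<open>A \<otimes> A\<close>: for a decorated tree \<open>a\<close>, the element \<open>\<Delta>(a \<or> x)\<close> is a sum of
  images of \<open>\<Delta>(x)\<close> under tensor products of left multiplications by parts of \<open>a\<close>, and each of these
  maps preserves \<open>\<J> \<otimes> A + A \<otimes> \<J>\<close>. So the elements which \<open>\<Delta>\<close> sends there form a two-sided ideal too.
  This is \<open>hom_hopf_ideal_generated\<close>: it suffices to look at the generators.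

  The generators are primitive: \<open>\<Delta>(g) = \<one> \<otimes> g + g \<otimes> \<one>\<close>. Decorated leaves are primitive. For a
  decorated tree with two leaves the failure of primitivity is \<open>x' \<otimes> y' + y' \<otimes> x'\<close>, where \<open>x'\<close> and
  \<open>y'\<close> are the leaves of weight \<open>1\<close> decorated with \<open>x\<close> and \<open>y\<close>. This is symmetric in \<open>x\<close> and \<open>y\<close>, so
  it disappears from the commutator. The counit kills trees, and the antipode sends a generator to its
  negative. This proves \<open>hom_hopf_ideal_enveloping\<close>.

  All this takes place in the quotient by the associativity ideal, where the formulas for the structure
  maps only make sense because that ideal is itself a Hom-Hopf ideal. The span of the trees modulo
  associativity is controlled by single applications \<open>b \<leadsto> c\<close> of the relation somewhere inside a
  tree. Restricting a tree to some of its leaves, or reflecting it, turns such a step into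
  another one, and the ideal is spanned by the differences of \<open>b\<close> and \<open>c\<close> with equal decorations
  (\<open>dtree_ideal_eq\<close>). The locale \<open>tree_hopf\<close> records that a space is spanned by decorated trees on which
  the structure maps have the expected values. It holds before taking the quotient, and it passes to the
  quotient by any Hom-Hopf ideal (\<open>tree_hopf_quotient\<close>), so that the arguments above apply on both levels.
\<close>

section \<open>Linear maps and linear spans\<close>

locale linear_map = M: module K M + N: module K N
  for K :: "('k, 'r) ring_scheme" (structure) and M :: "('k, 'v, 'm) module_scheme" (structure)
    and N :: "('k, 'w, 'n) module_scheme" (structure) +
  fixes f :: "'v \<Rightarrow> 'w"
  assumes map_closed: "x \<in> carrier M \<Longrightarrow> f x \<in> carrier N"
    and map_add: "\<lbrakk>x \<in> carrier M; y \<in> carrier M\<rbrakk> \<Longrightarrow> f (x \<oplus>\<^bsub>M\<^esub> y) = f x \<oplus>\<^bsub>N\<^esub> f y"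
    and map_smult: "\<lbrakk>c \<in> carrier K; x \<in> carrier M\<rbrakk> \<Longrightarrow> f (c \<odot>\<^bsub>M\<^esub> x) = c \<odot>\<^bsub>N\<^esub> f x"

lemma linear_mapI:
  assumes "module K M" and "module K N"
    and "\<And>x. x \<in> carrier M \<Longrightarrow> f x \<in> carrier N"
    and "\<And>x y. \<lbrakk>x \<in> carrier M; y \<in> carrier M\<rbrakk> \<Longrightarrow> f (x \<oplus>\<^bsub>M\<^esub> y) = f x \<oplus>\<^bsub>N\<^esub> f y"
    and "\<And>c x. \<lbrakk>c \<in> carrier K; x \<in> carrier M\<rbrakk> \<Longrightarrow> f (c \<odot>\<^bsub>M\<^esub> x) = c \<odot>\<^bsub>N\<^esub> f x"
  shows "linear_map K M N f"
  using assms by (simp add: linear_map_def linear_map_axioms_def)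

lemma (in module) minus_self_iff:
  assumes "x \<in> carrier M" "y \<in> carrier M"
  shows "x \<ominus>\<^bsub>M\<^esub> y = \<zero>\<^bsub>M\<^esub> \<longleftrightarrow> x = y"
proof
  assume "x \<ominus>\<^bsub>M\<^esub> y = \<zero>\<^bsub>M\<^esub>"
  then have "(x \<ominus>\<^bsub>M\<^esub> y) \<oplus>\<^bsub>M\<^esub> y = y"
    using assms by simp
  then show "x = y"
    using assms by (simp add: M.minus_eq M.a_assoc M.l_neg)
qed (use assms in \<open>simp add: M.minus_eq M.r_neg\<close>)

context linear_map
begin

lemma map_zero: "f \<zero>\<^bsub>M\<^esub> = \<zero>\<^bsub>N\<^esub>"
proof -
  have "f (\<zero>\<^bsub>K\<^esub> \<odot>\<^bsub>M\<^esub> \<zero>\<^bsub>M\<^esub>) = \<zero>\<^bsub>K\<^esub> \<odot>\<^bsub>N\<^esub> f \<zero>\<^bsub>M\<^esub>"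
    by (rule map_smult) auto
  then show ?thesis
    by (simp add: map_closed)
qed

lemma map_neg: "x \<in> carrier M \<Longrightarrow> f (\<ominus>\<^bsub>M\<^esub> x) = \<ominus>\<^bsub>N\<^esub> f x"
  using map_smult[of "\<ominus>\<^bsub>K\<^esub> \<one>\<^bsub>K\<^esub>" x] by (simp add: M.smult_l_minus N.smult_l_minus map_closed)

lemma map_minus:
  "\<lbrakk>x \<in> carrier M; y \<in> carrier M\<rbrakk> \<Longrightarrow> f (x \<ominus>\<^bsub>M\<^esub> y) = f x \<ominus>\<^bsub>N\<^esub> f y"
  by (simp add: M.minus_eq N.minus_eq map_add map_neg)

lemma map_finsum:
  "finite I \<Longrightarrow> g \<in> I \<rightarrow> carrier M \<Longrightarrow> f (finsum M g I) = finsum N (\<lambda>i. f (g i)) I"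
proof (induction I rule: finite_induct)
  case empty
  show ?case
    by (simp add: map_zero)
next
  case (insert i I)
  have *: "(\<lambda>i. f (g i)) \<in> I \<rightarrow> carrier N" "f (g i) \<in> carrier N" "g \<in> I \<rightarrow> carrier M"
      "g i \<in> carrier M"
    using insert.prems map_closed by (auto simp: Pi_iff)
  then show ?case
    using insert by (simp add: map_add)
qed

lemma vimage_submodule:
  assumes "submodule H K N"
  shows "submodule {x \<in> carrier M. f x \<in> H} K M"
proof (rule M.submoduleI)
  note H = N.submoduleE[OF assms]
  show "\<zero>\<^bsub>M\<^esub> \<in> {x \<in> carrier M. f x \<in> H}"
    using subgroup.one_closed[OF submodule.axioms(1)[OF assms]] by (simp add: map_zero)
qed (use N.submoduleE[OF assms] in \<open>auto simp: map_add map_neg map_smult\<close>)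

end

lemma linear_map_comp:
  "\<lbrakk>linear_map K M N f; linear_map K N L g\<rbrakk> \<Longrightarrow> linear_map K M L (\<lambda>x. g (f x))"
  by (simp add: linear_map_def linear_map_axioms_def)

lemma linear_map_cong:
  assumes "linear_map K M N f" and "\<And>x. x \<in> carrier M \<Longrightarrow> g x = f x"
  shows "linear_map K M N g"
proof -
  interpret linear_map K M N f by fact
  show ?thesis
    using assms(2) M.module_axioms N.module_axioms
    by (intro linear_mapI) (simp_all add: map_closed map_add map_smult)
qed

lemma linear_map_add:
  assumes "linear_map K M N f" "linear_map K M N g"
  shows "linear_map K M N (\<lambda>x. f x \<oplus>\<^bsub>N\<^esub> g x)"
proof -
  interpret F: linear_map K M N f by fact
  interpret G: linear_map K M N g by fact
  show ?thesis
    by (rule linear_mapI)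
      (simp_all add: F.M.module_axioms F.N.module_axioms F.map_closed G.map_closed F.map_add G.map_add
        F.map_smult G.map_smult F.N.smult_r_distr F.N.a_ac)
qed

lemma linear_map_smult:
  assumes "linear_map K M N f" "c \<in> carrier K"
  shows "linear_map K M N (\<lambda>x. c \<odot>\<^bsub>N\<^esub> f x)"
proof -
  interpret F: linear_map K M N f by fact
  show ?thesis
    using assms(2) by (intro linear_mapI)
      (simp_all add: F.M.module_axioms F.N.module_axioms F.map_closed F.map_add
        F.map_smult F.N.smult_r_distr F.N.smult_assoc1[symmetric] F.M.R.m_comm)
qed

lemma linear_map_minus:
  assumes f: "linear_map K M N f" and g: "linear_map K M N g"
  shows "linear_map K M N (\<lambda>x. f x \<ominus>\<^bsub>N\<^esub> g x)"
proof -
  interpret f: linear_map K M N f by fact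
  interpret g: linear_map K M N g by fact
  have "linear_map K M N (\<lambda>x. f x \<oplus>\<^bsub>N\<^esub> (\<ominus>\<^bsub>K\<^esub> \<one>\<^bsub>K\<^esub>) \<odot>\<^bsub>N\<^esub> g x)"
    using f g by (intro linear_map_add linear_map_smult) simp_all
  then show ?thesis
    by (rule linear_map_cong) (simp add: f.N.minus_eq f.N.smult_l_minus g.map_closed)
qed

lemma linear_map_zero:
  assumes "module K M" "module K N"
  shows "linear_map K M N (\<lambda>x. \<zero>\<^bsub>N\<^esub>)"
proof -
  interpret N: module K N by fact
  show ?thesis
    using assms by (intro linear_mapI) simp_all
qed

lemma linear_map_finsum:
  assumes "finite I" and "module K M" "module K N" and "\<And>i. i \<in> I \<Longrightarrow> linear_map K M N (f i)"
  shows "linear_map K M N (\<lambda>x. \<Oplus>\<^bsub>N\<^esub>i\<in>I. f i x)"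
  using assms(1,4)
proof (induction I rule: finite_induct)
  case empty
  interpret N: module K N by fact
  show ?case
    using linear_map_zero[OF assms(2,3)] by simp
next
  case (insert i I)
  interpret N: module K N by fact
  have "linear_map K M N (\<lambda>x. f i x \<oplus>\<^bsub>N\<^esub> (\<Oplus>\<^bsub>N\<^esub>i\<in>I. f i x))"
    using insert by (intro linear_map_add) auto
  moreover have "(\<Oplus>\<^bsub>N\<^esub>i\<in>insert i I. f i x) = f i x \<oplus>\<^bsub>N\<^esub> (\<Oplus>\<^bsub>N\<^esub>i\<in>I. f i x)"
    if "x \<in> carrier M" for x
    using insert.hyps insert.prems that linear_map.map_closed
    by (subst N.finsum_insert) (fastforce simp: Pi_iff)+
  ultimately show ?case
    by (rule linear_map_cong)
qed

lemma lin_span_least: "\<lbrakk>submodule H K M; X \<subseteq> H\<rbrakk> \<Longrightarrow> lin_span K M X \<subseteq> H"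
  by (auto simp: lin_span_def)

lemma lin_span_superset: "X \<subseteq> lin_span K M X"
  by (auto simp: lin_span_def)

lemma (in module) submodule_zero: "submodule H R M \<Longrightarrow> \<zero>\<^bsub>M\<^esub> \<in> H"
  using subgroup.one_closed[OF submodule.axioms(1)] by force

lemma (in module) submodule_minus:
  "\<lbrakk>submodule H R M; x \<in> H; y \<in> H\<rbrakk> \<Longrightarrow> x \<ominus>\<^bsub>M\<^esub> y \<in> H"
  by (simp add: M.minus_eq submoduleE)

lemma (in module) submodule_Inter:
  assumes "\<And>H. H \<in> \<H> \<Longrightarrow> submodule H R M" and "\<H> \<noteq> {}"
  shows "submodule (\<Inter> \<H>) R M"
proof (rule submoduleI)
  show "\<Inter> \<H> \<subseteq> carrier M"
    using assms submoduleE(1) by blast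
  show "\<zero>\<^bsub>M\<^esub> \<in> \<Inter> \<H>"
    using assms(1) submodule_zero by blast
qed (use assms(1) submoduleE(3-5) in blast)+

lemma (in module) lin_span_submodule: "X \<subseteq> carrier M \<Longrightarrow> submodule (lin_span R M X) R M"
  unfolding lin_span_def using carrier_is_submodule by (intro submodule_Inter) auto

lemma (in module) trivial_submodule: "submodule {\<zero>\<^bsub>M\<^esub>} R M"
  by (rule submoduleI) auto

lemma (in linear_map) map_lin_span:
  assumes "X \<subseteq> carrier M" "submodule H K N" "\<And>x. x \<in> X \<Longrightarrow> f x \<in> H" "x \<in> lin_span K M X"
  shows "f x \<in> H"
  using lin_span_least[OF vimage_submodule[OF assms(2)], of X] assms by blast

lemma linear_map_eqI:
  assumes f: "linear_map K M N f" and g: "linear_map K M N g" and span: "lin_span K M X = carrier M"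
    and eq: "\<And>x. x \<in> X \<Longrightarrow> f x = g x" and x: "x \<in> carrier M"
  shows "f x = g x"
proof -
  interpret F: linear_map K M N f by fact
  interpret G: linear_map K M N g by fact
  have X: "X \<subseteq> carrier M"
    using lin_span_superset[of X K M] span by simp
  have "submodule {x \<in> carrier M. f x = g x} K M"
    by (rule F.M.submoduleI)
      (auto simp: F.map_zero G.map_zero F.map_neg G.map_neg F.map_add G.map_add F.map_smult G.map_smult)
  from lin_span_least[OF this, of X] show ?thesis
    using X eq span x by auto
qed

definition bilinear_map ::
  "('k, 'r) ring_scheme \<Rightarrow> ('k, 'v, 'm) module_scheme \<Rightarrow> ('k, 'w, 'n) module_scheme
    \<Rightarrow> ('k, 'u, 'l) module_scheme \<Rightarrow> ('v \<Rightarrow> 'w \<Rightarrow> 'u) \<Rightarrow> bool" where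
  "bilinear_map K V W N f \<longleftrightarrow>
     (\<forall>y\<in>carrier W. linear_map K V N (\<lambda>x. f x y)) \<and> (\<forall>x\<in>carrier V. linear_map K W N (f x))"

lemma bilinear_map_eqI:
  assumes f: "bilinear_map K V W N f" and g: "bilinear_map K V W N g"
    and X: "lin_span K V X = carrier V" and Y: "lin_span K W Y = carrier W"
    and eq: "\<And>x y. \<lbrakk>x \<in> X; y \<in> Y\<rbrakk> \<Longrightarrow> f x y = g x y" and xy: "x \<in> carrier V" "y \<in> carrier W"
  shows "f x y = g x y"
proof -
  have "f x y = g x y" if x: "x \<in> X" for x
  proof (rule linear_map_eqI[OF _ _ Y _ xy(2)])
    have "x \<in> carrier V"
      using x X lin_span_superset[of X K V] by auto
    then show "linear_map K W N (f x)" "linear_map K W N (g x)"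
      using f g by (auto simp: bilinear_map_def)
  qed (rule eq[OF x])
  moreover have "linear_map K V N (\<lambda>x. f x y)" "linear_map K V N (\<lambda>x. g x y)"
    using f g xy by (auto simp: bilinear_map_def)
  ultimately show ?thesis
    using linear_map_eqI[OF _ _ X _ xy(1)] by blast
qed

text \<open>
  Once \<open>f\<close> is linear in the first argument, the first arguments for which it is linear in the second one
  form a submodule, so a spanning set of them is enough.
\<close>

lemma bilinear_map_from_span:
  assumes V: "module K V" and W: "module K W" and N: "module K N"
    and left: "\<And>y. y \<in> carrier W \<Longrightarrow> linear_map K V N (\<lambda>x. f x y)"
    and right: "\<And>x. x \<in> X \<Longrightarrow> linear_map K W N (f x)" and X: "lin_span K V X = carrier V"
  shows "bilinear_map K V W N f"
proof -
  interpret V: module K V by fact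
  interpret W: module K W by fact
  interpret N: module K N by fact
  have XV: "X \<subseteq> carrier V"
    using lin_span_superset[of X K V] X by simp
  let ?H = "{x \<in> carrier V. linear_map K W N (f x)}"
  have eq_add: "f (x \<oplus>\<^bsub>V\<^esub> x') y = f x y \<oplus>\<^bsub>N\<^esub> f x' y"
    if "x \<in> carrier V" "x' \<in> carrier V" "y \<in> carrier W" for x x' y
    using linear_map.map_add[OF left[OF that(3)]] that by simp
  have eq_smult: "f (c \<odot>\<^bsub>V\<^esub> x) y = c \<odot>\<^bsub>N\<^esub> f x y"
    if "x \<in> carrier V" "y \<in> carrier W" "c \<in> carrier K" for x y c
    using linear_map.map_smult[OF left[OF that(2)]] that by simp
  have smult: "c \<odot>\<^bsub>V\<^esub> x \<in> ?H" if "c \<in> carrier K" "x \<in> ?H" for c x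
    using that linear_map_cong[OF linear_map_smult[of K W N "f x" c], of "f (c \<odot>\<^bsub>V\<^esub> x)"]
    by (auto simp: eq_smult)
  have "submodule ?H K V"
  proof (rule V.submoduleI)
    show "\<zero>\<^bsub>V\<^esub> \<in> ?H"
      using linear_map_cong[OF linear_map_zero[OF W N], of "f \<zero>\<^bsub>V\<^esub>"] linear_map.map_zero[OF left]
      by simp
    show "x \<oplus>\<^bsub>V\<^esub> y \<in> ?H" if "x \<in> ?H" "y \<in> ?H" for x y
      using that linear_map_cong[OF linear_map_add[of K W N "f x" "f y"], of "f (x \<oplus>\<^bsub>V\<^esub> y)"]
      by (auto simp: eq_add)
    show "c \<odot>\<^bsub>V\<^esub> x \<in> ?H" if "c \<in> carrier K" "x \<in> ?H" for c x
      using smult that .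
    show "\<ominus>\<^bsub>V\<^esub> x \<in> ?H" if "x \<in> ?H" for x
      using smult[of "\<ominus>\<^bsub>K\<^esub> \<one>\<^bsub>K\<^esub>" x] that by (simp add: V.smult_l_minus)
  qed auto
  from lin_span_least[OF this, of X] show ?thesis
    using left right X XV unfolding bilinear_map_def by auto
qed

text \<open>This turns the sum of two spans, as it occurs in the definition of a coideal, into one span.\<close>

lemma (in module) lin_span_set_add:
  assumes "X \<subseteq> carrier M" "Y \<subseteq> carrier M"
  shows "lin_span R M X <+>\<^bsub>M\<^esub> lin_span R M Y = lin_span R M (X \<union> Y)" (is "?L = ?R")
proof
  let ?X = "lin_span R M X" and ?Y = "lin_span R M Y"
  note H = lin_span_submodule[OF assms(1)] lin_span_submodule[OF assms(2)]
  note E = submoduleE[OF H(1)] submoduleE[OF H(2)]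
  note R = lin_span_submodule[of "X \<union> Y"]
  have "?X \<subseteq> ?R" "?Y \<subseteq> ?R"
    using assms R lin_span_superset[of "X \<union> Y" R M] by (simp_all add: lin_span_least)
  then show "?L \<subseteq> ?R"
    using submoduleE(5)[OF R] assms by (auto simp: set_add_def')
  have mem: "z \<in> ?L \<longleftrightarrow> (\<exists>x\<in>?X. \<exists>y\<in>?Y. z = x \<oplus>\<^bsub>M\<^esub> y)" for z
    by (auto simp: set_add_def')
  have "submodule ?L R M"
  proof (rule submoduleI)
    show "?L \<subseteq> carrier M"
      using E(1,7) by (auto simp: mem intro!: M.a_closed)
    show "\<zero>\<^bsub>M\<^esub> \<in> ?L"
      using submodule_zero[OF H(1)] submodule_zero[OF H(2)] by (force simp: mem)
    show "\<ominus>\<^bsub>M\<^esub> a \<in> ?L" if a: "a \<in> ?L" for a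
    proof -
      obtain x y where "x \<in> ?X" "y \<in> ?Y" "a = x \<oplus>\<^bsub>M\<^esub> y"
        using a by (auto simp: mem)
      moreover from this have "\<ominus>\<^bsub>M\<^esub> a = \<ominus>\<^bsub>M\<^esub> x \<oplus>\<^bsub>M\<^esub> \<ominus>\<^bsub>M\<^esub> y"
        using E(1,7) by (simp add: subset_iff M.minus_add)
      moreover have "\<ominus>\<^bsub>M\<^esub> x \<in> ?X" "\<ominus>\<^bsub>M\<^esub> y \<in> ?Y"
        using \<open>x \<in> ?X\<close> \<open>y \<in> ?Y\<close> E by auto
      ultimately show ?thesis
        unfolding mem by blast
    qed
    show "a \<oplus>\<^bsub>M\<^esub> b \<in> ?L" if ab: "a \<in> ?L" "b \<in> ?L" for a b
    proof -
      obtain x y x' y' where *: "x \<in> ?X" "y \<in> ?Y" "a = x \<oplus>\<^bsub>M\<^esub> y" "x' \<in> ?X" "y' \<in> ?Y" "b = x' \<oplus>\<^bsub>M\<^esub> y'"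
        using ab by (auto simp: mem)
      have "x \<in> carrier M" "y \<in> carrier M" "x' \<in> carrier M" "y' \<in> carrier M"
        using * E(1,7) by auto
      then have "a \<oplus>\<^bsub>M\<^esub> b = (x \<oplus>\<^bsub>M\<^esub> x') \<oplus>\<^bsub>M\<^esub> (y \<oplus>\<^bsub>M\<^esub> y')"
        using * by (simp add: M.a_ac)
      moreover have "x \<oplus>\<^bsub>M\<^esub> x' \<in> ?X" "y \<oplus>\<^bsub>M\<^esub> y' \<in> ?Y"
        using * E by auto
      ultimately show ?thesis
        unfolding mem by blast
    qed
    show "c \<odot>\<^bsub>M\<^esub> a \<in> ?L" if a: "c \<in> carrier R" "a \<in> ?L" for c a
    proof -
      obtain x y where *: "x \<in> ?X" "y \<in> ?Y" "a = x \<oplus>\<^bsub>M\<^esub> y"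
        using a by (auto simp: mem)
      have "x \<in> carrier M" "y \<in> carrier M"
        using * E(1,7) by auto
      then have "c \<odot>\<^bsub>M\<^esub> a = c \<odot>\<^bsub>M\<^esub> x \<oplus>\<^bsub>M\<^esub> c \<odot>\<^bsub>M\<^esub> y"
        using * a by (simp add: smult_r_distr)
      moreover have "c \<odot>\<^bsub>M\<^esub> x \<in> ?X" "c \<odot>\<^bsub>M\<^esub> y \<in> ?Y"
        using * a E by auto
      ultimately show ?thesis
        unfolding mem by blast
    qed
  qed
  moreover have "X \<union> Y \<subseteq> ?L"
  proof
    fix z assume z: "z \<in> X \<union> Y"
    then have zM: "z \<in> carrier M"
      using assms by auto
    show "z \<in> ?L"
    proof (cases "z \<in> X")
      case True
      then have "z \<in> ?X" "z = z \<oplus>\<^bsub>M\<^esub> \<zero>\<^bsub>M\<^esub>"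
        using lin_span_superset[of X R M] zM by auto
      then show ?thesis
        using submodule_zero[OF H(2)] unfolding mem by blast
    next
      case False
      then have "z \<in> ?Y" "z = \<zero>\<^bsub>M\<^esub> \<oplus>\<^bsub>M\<^esub> z"
        using lin_span_superset[of Y R M] zM z by auto
      then show ?thesis
        using submodule_zero[OF H(1)] unfolding mem by blast
    qed
  qed
  ultimately show "?R \<subseteq> ?L"
    by (rule lin_span_least)
qed

lemma (in module) finsum_cartesian:
  assumes "finite A" "finite B" "\<And>a b. \<lbrakk>a \<in> A; b \<in> B\<rbrakk> \<Longrightarrow> f a b \<in> carrier M"
  shows "(\<Oplus>\<^bsub>M\<^esub>p\<in>A \<times> B. f (fst p) (snd p)) = (\<Oplus>\<^bsub>M\<^esub>a\<in>A. \<Oplus>\<^bsub>M\<^esub>b\<in>B. f a b)"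
  using assms(1,3)
proof (induction A rule: finite_induct)
  case empty
  show ?case
    by simp
next
  case (insert a A)
  have "(\<Oplus>\<^bsub>M\<^esub>p\<in>insert a A \<times> B. f (fst p) (snd p))
      = (\<Oplus>\<^bsub>M\<^esub>p\<in>Pair a ` B \<union> A \<times> B. f (fst p) (snd p))"
    by (rule arg_cong[where f = "finsum M _"]) auto
  also have "\<dots> = (\<Oplus>\<^bsub>M\<^esub>p\<in>Pair a ` B. f (fst p) (snd p)) \<oplus>\<^bsub>M\<^esub> (\<Oplus>\<^bsub>M\<^esub>p\<in>A \<times> B. f (fst p) (snd p))"
    using insert assms(2) by (intro M.finsum_Un_disjoint) auto
  also have "(\<Oplus>\<^bsub>M\<^esub>p\<in>Pair a ` B. f (fst p) (snd p)) = (\<Oplus>\<^bsub>M\<^esub>b\<in>B. f a b)"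
    using insert by (subst M.finsum_reindex) (auto simp: inj_on_def)
  finally show ?case
    using insert by (subst M.finsum_insert) (auto intro!: M.finsum_closed simp: Pi_iff)
qed

lemma (in module) finsum_swap:
  assumes "finite A" "finite B" "\<And>a b. \<lbrakk>a \<in> A; b \<in> B\<rbrakk> \<Longrightarrow> f a b \<in> carrier M"
  shows "(\<Oplus>\<^bsub>M\<^esub>b\<in>B. \<Oplus>\<^bsub>M\<^esub>a\<in>A. f a b) = (\<Oplus>\<^bsub>M\<^esub>a\<in>A. \<Oplus>\<^bsub>M\<^esub>b\<in>B. f a b)"
  using assms(1,3)
proof (induction A rule: finite_induct)
  case empty
  show ?case
    by simp
next
  case (insert a A)
  have "(\<Oplus>\<^bsub>M\<^esub>b\<in>B. \<Oplus>\<^bsub>M\<^esub>a\<in>insert a A. f a b) = (\<Oplus>\<^bsub>M\<^esub>b\<in>B. f a b \<oplus>\<^bsub>M\<^esub> (\<Oplus>\<^bsub>M\<^esub>a\<in>A. f a b))"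
    using insert by (intro M.finsum_cong') (auto intro!: M.finsum_closed M.finsum_insert)
  also have "\<dots> = (\<Oplus>\<^bsub>M\<^esub>b\<in>B. f a b) \<oplus>\<^bsub>M\<^esub> (\<Oplus>\<^bsub>M\<^esub>b\<in>B. \<Oplus>\<^bsub>M\<^esub>a\<in>A. f a b)"
    using insert by (intro M.finsum_addf) (auto intro!: M.finsum_closed)
  also have "(\<Oplus>\<^bsub>M\<^esub>b\<in>B. \<Oplus>\<^bsub>M\<^esub>a\<in>A. f a b) = (\<Oplus>\<^bsub>M\<^esub>a\<in>A. \<Oplus>\<^bsub>M\<^esub>b\<in>B. f a b)"
    using insert by simp
  finally show ?case
    using insert by (subst M.finsum_insert) (auto intro!: M.finsum_closed)
qed

section \<open>Free modules, quotients and modules with generators and relations\<close>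

lemma free_module_simps:
  "f \<in> carrier (free_module K X) \<longleftrightarrow>
     (\<forall>b\<in>X. f b \<in> carrier K) \<and> (\<forall>b. b \<notin> X \<longrightarrow> f b = \<zero>\<^bsub>K\<^esub>) \<and> finite {b. f b \<noteq> \<zero>\<^bsub>K\<^esub>}"
  "\<zero>\<^bsub>free_module K X\<^esub> = (\<lambda>b. \<zero>\<^bsub>K\<^esub>)"
  "f \<oplus>\<^bsub>free_module K X\<^esub> g = (\<lambda>b. f b \<oplus>\<^bsub>K\<^esub> g b)"
  "c \<odot>\<^bsub>free_module K X\<^esub> f = (\<lambda>b. c \<otimes>\<^bsub>K\<^esub> f b)"
  by (simp_all add: free_module_def)

context cring
begin

lemma free_module_value: "f \<in> carrier (free_module R X) \<Longrightarrow> f b \<in> carrier R"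
  by (cases "b \<in> X") (auto simp: free_module_simps)

lemma free_module_support:
  "f \<in> carrier (free_module R X) \<Longrightarrow> finite {b. f b \<noteq> \<zero>} \<and> {b. f b \<noteq> \<zero>} \<subseteq> X"
  by (auto simp: free_module_simps)

lemma free_module_add_closed:
  assumes f: "f \<in> carrier (free_module R X)" and g: "g \<in> carrier (free_module R X)"
  shows "(\<lambda>b. f b \<oplus> g b) \<in> carrier (free_module R X)"
proof -
  have "finite {b. f b \<oplus> g b \<noteq> \<zero>}"
    by (rule finite_subset[of _ "{b. f b \<noteq> \<zero>} \<union> {b. g b \<noteq> \<zero>}"])
      (use f g in \<open>auto simp: free_module_simps\<close>)
  moreover have "f b \<oplus> g b \<in> carrier R" "b \<notin> X \<Longrightarrow> f b \<oplus> g b = \<zero>" for b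
    using f g free_module_value[OF f] free_module_value[OF g] by (simp_all add: free_module_simps(1))
  ultimately show ?thesis
    unfolding free_module_simps(1) by blast
qed

lemma free_module_smult_closed:
  assumes c: "c \<in> carrier R" and f: "f \<in> carrier (free_module R X)"
  shows "(\<lambda>b. c \<otimes> f b) \<in> carrier (free_module R X)"
proof -
  have "finite {b. c \<otimes> f b \<noteq> \<zero>}"
    by (rule finite_subset[of _ "{b. f b \<noteq> \<zero>}"]) (use f c in \<open>auto simp: free_module_simps\<close>)
  moreover have "c \<otimes> f b \<in> carrier R" "b \<notin> X \<Longrightarrow> c \<otimes> f b = \<zero>" for b
    using f c free_module_value[OF f] by (simp_all add: free_module_simps(1))
  ultimately show ?thesis
    unfolding free_module_simps(1) by blast
qed

lemma module_free_module: "module R (free_module R X)"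
proof (rule moduleI)
  let ?F = "free_module R X"
  show "abelian_group ?F"
  proof (rule abelian_groupI)
    fix f assume f: "f \<in> carrier ?F"
    have "(\<lambda>b. \<ominus> \<one> \<otimes> f b) \<in> carrier ?F"
      using f by (intro free_module_smult_closed) simp_all
    moreover have "(\<lambda>b. \<ominus> \<one> \<otimes> f b) \<oplus>\<^bsub>?F\<^esub> f = \<zero>\<^bsub>?F\<^esub>"
      using free_module_value[OF f] by (simp add: free_module_simps l_minus l_neg)
    ultimately show "\<exists>g\<in>carrier ?F. g \<oplus>\<^bsub>?F\<^esub> f = \<zero>\<^bsub>?F\<^esub>"
      by blast
  qed (auto simp: free_module_simps(2-) free_module_add_closed free_module_value a_ac,
       simp add: free_module_simps)
qed (auto simp: free_module_simps(2-) free_module_smult_closed free_module_value m_assoc l_distr r_distr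
    intro: is_cring)

lemma free_gen_closed: "b \<in> X \<Longrightarrow> free_gen R b \<in> carrier (free_module R X)"
  by (auto simp: free_module_simps free_gen_def intro: finite_subset[of _ "{b}"])

lemma free_module_span: "lin_span R (free_module R X) (free_gen R ` X) = carrier (free_module R X)"
proof
  let ?F = "free_module R X"
  interpret F: module R ?F
    by (rule module_free_module)
  have E: "free_gen R ` X \<subseteq> carrier ?F"
    using free_gen_closed by auto
  note H = F.lin_span_submodule[OF E]
  show "lin_span R ?F (free_gen R ` X) \<subseteq> carrier ?F"
    using F.submoduleE(1)[OF H] .
  have *: "f \<in> lin_span R ?F (free_gen R ` X)"
    if "finite S" "S \<subseteq> X" "f \<in> carrier ?F" "\<And>b. b \<notin> S \<Longrightarrow> f b = \<zero>" for S f
    using that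
  proof (induction S arbitrary: f rule: finite_induct)
    case empty
    then have "f = \<zero>\<^bsub>?F\<^esub>"
      by (auto simp: free_module_simps)
    then show ?case
      using F.submodule_zero[OF H] by simp
  next
    case (insert b S)
    note fv = free_module_value[OF insert.prems(2)]
    let ?g = "f(b := \<zero>)"
    have "finite {a. ?g a \<noteq> \<zero>}"
      by (rule finite_subset[of _ "{a. f a \<noteq> \<zero>}"])
        (use insert.prems(2) in \<open>auto simp: free_module_simps\<close>)
    then have "?g \<in> carrier ?F"
      using insert.prems(2) by (auto simp: free_module_simps)
    then have "?g \<in> lin_span R ?F (free_gen R ` X)"
      using insert by auto
    moreover have "free_gen R b \<in> lin_span R ?F (free_gen R ` X)"
      using insert.prems(1) lin_span_superset[of "free_gen R ` X" R ?F] by auto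
    ultimately have "?g \<oplus>\<^bsub>?F\<^esub> f b \<odot>\<^bsub>?F\<^esub> free_gen R b \<in> lin_span R ?F (free_gen R ` X)"
      using fv F.submoduleE(4,5)[OF H] by simp
    moreover have "?g \<oplus>\<^bsub>?F\<^esub> f b \<odot>\<^bsub>?F\<^esub> free_gen R b = f"
      using fv by (auto simp: free_module_simps free_gen_def)
    ultimately show ?case
      by simp
  qed
  show "carrier ?F \<subseteq> lin_span R ?F (free_gen R ` X)"
  proof
    fix f assume f: "f \<in> carrier ?F"
    show "f \<in> lin_span R ?F (free_gen R ` X)"
      using free_module_support[OF f] f by (intro *[of "{b. f b \<noteq> \<zero>}"]) auto
  qed
qed

end

context module
begin

lemma free_ext_superset:
  assumes v: "v \<in> X \<rightarrow> carrier M" and f: "f \<in> carrier (free_module R X)"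
    and S: "finite S" "S \<subseteq> X" "{b. f b \<noteq> \<zero>} \<subseteq> S"
  shows "free_ext R M v f = (\<Oplus>\<^bsub>M\<^esub>b\<in>S. f b \<odot>\<^bsub>M\<^esub> v b)"
  unfolding free_ext_def
proof (rule M.add.finprod_mono_neutral_cong_left)
  show "f b \<odot>\<^bsub>M\<^esub> v b = \<zero>\<^bsub>M\<^esub>" if "b \<in> S - {b. f b \<noteq> \<zero>}" for b
    using that v S by (auto simp: Pi_iff)
qed (use assms R.free_module_value[OF f] in \<open>auto simp: Pi_iff\<close>)

lemma free_ext_linear:
  assumes v: "v \<in> X \<rightarrow> carrier M"
  shows "linear_map R (free_module R X) M (free_ext R M v)"
proof (rule linear_mapI)
  let ?F = "free_module R X"
  have closed: "free_ext R M v f \<in> carrier M" if "f \<in> carrier ?F" for f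
    using that v R.free_module_value[OF that] R.free_module_support[OF that] unfolding free_ext_def
    by (intro M.finsum_closed) (auto simp: Pi_iff)
  then show "\<And>f. f \<in> carrier ?F \<Longrightarrow> free_ext R M v f \<in> carrier M" .
  fix f assume f: "f \<in> carrier ?F"
  note fv = R.free_module_value[OF f] and fs = R.free_module_support[OF f]
  show "free_ext R M v (f \<oplus>\<^bsub>?F\<^esub> g) = free_ext R M v f \<oplus>\<^bsub>M\<^esub> free_ext R M v g" if g: "g \<in> carrier ?F" for g
  proof -
    note gv = R.free_module_value[OF g] and gs = R.free_module_support[OF g]
    let ?S = "{b. f b \<noteq> \<zero>} \<union> {b. g b \<noteq> \<zero>}"
    have S: "finite ?S" "?S \<subseteq> X"
      using fs gs by auto
    then have vS: "v b \<in> carrier M" if "b \<in> ?S" for b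
      using v that by auto
    have "free_ext R M v (f \<oplus>\<^bsub>?F\<^esub> g) = (\<Oplus>\<^bsub>M\<^esub>b\<in>?S. (f b \<oplus> g b) \<odot>\<^bsub>M\<^esub> v b)"
      using f g v S R.free_module_add_closed by (subst free_ext_superset[of v X _ ?S]) (auto simp: free_module_simps(3))
    also have "\<dots> = (\<Oplus>\<^bsub>M\<^esub>b\<in>?S. f b \<odot>\<^bsub>M\<^esub> v b \<oplus>\<^bsub>M\<^esub> g b \<odot>\<^bsub>M\<^esub> v b)"
      using fv gv vS by (intro M.finsum_cong') (auto simp: smult_l_distr)
    also have "\<dots> = (\<Oplus>\<^bsub>M\<^esub>b\<in>?S. f b \<odot>\<^bsub>M\<^esub> v b) \<oplus>\<^bsub>M\<^esub> (\<Oplus>\<^bsub>M\<^esub>b\<in>?S. g b \<odot>\<^bsub>M\<^esub> v b)"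
      using fv gv vS by (intro M.finsum_addf) auto
    also have "(\<Oplus>\<^bsub>M\<^esub>b\<in>?S. f b \<odot>\<^bsub>M\<^esub> v b) = free_ext R M v f"
      using v f S by (intro free_ext_superset[symmetric]) auto
    also have "(\<Oplus>\<^bsub>M\<^esub>b\<in>?S. g b \<odot>\<^bsub>M\<^esub> v b) = free_ext R M v g"
      using v g S by (intro free_ext_superset[symmetric]) auto
    finally show ?thesis .
  qed
  show "free_ext R M v (c \<odot>\<^bsub>?F\<^esub> f) = c \<odot>\<^bsub>M\<^esub> free_ext R M v f" if c: "c \<in> carrier R" for c
  proof -
    let ?S = "{b. f b \<noteq> \<zero>}"
    have S: "finite ?S" "?S \<subseteq> X"
      using fs by auto
    then have vS: "v b \<in> carrier M" if "b \<in> ?S" for b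
      using v that by auto
    have "free_ext R M v (c \<odot>\<^bsub>?F\<^esub> f) = (\<Oplus>\<^bsub>M\<^esub>b\<in>?S. (c \<otimes> f b) \<odot>\<^bsub>M\<^esub> v b)"
      using f v S c R.free_module_smult_closed
      by (subst free_ext_superset[of v X _ ?S]) (auto simp: free_module_simps(4))
    also have "\<dots> = (\<Oplus>\<^bsub>M\<^esub>b\<in>?S. c \<odot>\<^bsub>M\<^esub> (f b \<odot>\<^bsub>M\<^esub> v b))"
      using fv vS c by (intro M.finsum_cong') (auto simp: smult_assoc1)
    also have "\<dots> = c \<odot>\<^bsub>M\<^esub> free_ext R M v f"
      using fv vS c S unfolding free_ext_def by (intro finsum_smult_ldistr[symmetric]) auto
    finally show ?thesis .
  qed
qed (auto intro: R.module_free_module module_axioms)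

lemma free_ext_gen:
  assumes "v b \<in> carrier M"
  shows "free_ext R M v (free_gen R b) = v b"
proof -
  \<comment> \<open>Over the zero ring the generator vanishes, but so does every vector of \<open>M\<close>.\<close>
  have "{a. free_gen R b a \<noteq> \<zero>} = (if \<one> = \<zero> then {} else {b})"
    by (auto simp: free_gen_def)
  moreover have "v b = \<zero>\<^bsub>M\<^esub>" if "\<one> = \<zero>"
    using smult_one[OF assms] smult_l_null[OF assms] that by simp
  ultimately show ?thesis
    using assms by (simp add: free_ext_def free_gen_def)
qed

lemma coset_eq_iff:
  assumes W: "submodule W R M" and "x \<in> carrier M" "y \<in> carrier M"
  shows "W +>\<^bsub>M\<^esub> x = W +>\<^bsub>M\<^esub> y \<longleftrightarrow> x \<ominus>\<^bsub>M\<^esub> y \<in> W"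
proof
  note E = submoduleE[OF W]
  assume eq: "W +>\<^bsub>M\<^esub> x = W +>\<^bsub>M\<^esub> y"
  have "x \<in> W +>\<^bsub>M\<^esub> x"
    using submodule_zero[OF W] assms by (force simp: a_r_coset_def')
  then obtain w where "w \<in> W" "x = w \<oplus>\<^bsub>M\<^esub> y"
    using eq by (auto simp: a_r_coset_def')
  then show "x \<ominus>\<^bsub>M\<^esub> y \<in> W"
    using assms E(1) by (auto simp: M.minus_eq M.a_assoc M.r_neg subset_iff)
next
  note E = submoduleE[OF W]
  assume d: "x \<ominus>\<^bsub>M\<^esub> y \<in> W"
  have sub: "W +>\<^bsub>M\<^esub> x \<subseteq> W +>\<^bsub>M\<^esub> y"
    if "x \<ominus>\<^bsub>M\<^esub> y \<in> W" and xy: "x \<in> carrier M" "y \<in> carrier M" for x y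
  proof -
    have "w \<oplus>\<^bsub>M\<^esub> x \<in> W +>\<^bsub>M\<^esub> y" if w: "w \<in> W" for w
    proof -
      have "w \<oplus>\<^bsub>M\<^esub> x = (w \<oplus>\<^bsub>M\<^esub> (x \<ominus>\<^bsub>M\<^esub> y)) \<oplus>\<^bsub>M\<^esub> y"
        using w E(1) xy by (simp add: subset_iff M.minus_eq M.a_assoc M.l_neg)
      then show ?thesis
        using w \<open>x \<ominus>\<^bsub>M\<^esub> y \<in> W\<close> E(5) unfolding a_r_coset_def' by blast
    qed
    then show ?thesis
      unfolding a_r_coset_def' by blast
  qed
  have "\<ominus>\<^bsub>M\<^esub> (x \<ominus>\<^bsub>M\<^esub> y) = y \<ominus>\<^bsub>M\<^esub> x"
    using assms by (simp add: M.minus_eq M.minus_add M.a_comm)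
  then have "y \<ominus>\<^bsub>M\<^esub> x \<in> W"
    using E(3)[OF d] by simp
  then show "W +>\<^bsub>M\<^esub> x = W +>\<^bsub>M\<^esub> y"
    using sub[OF d assms(2,3)] sub[of y x] assms(2,3) by (intro subset_antisym) simp_all
qed

lemma quotient_module_carrier: "carrier (quotient_module M W) = (\<lambda>x. W +>\<^bsub>M\<^esub> x) ` carrier M"
  by (auto simp: quotient_module_def A_RCOSETS_def RCOSETS_def a_r_coset_def)

lemma coset_subset:
  assumes W: "submodule W R M" and "x \<in> carrier M" "y \<in> W +>\<^bsub>M\<^esub> x"
  shows "y \<in> carrier M" "W +>\<^bsub>M\<^esub> y = W +>\<^bsub>M\<^esub> x"
proof -
  note E = submoduleE[OF W]
  obtain w where w: "w \<in> W" "y = w \<oplus>\<^bsub>M\<^esub> x"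
    using assms by (auto simp: a_r_coset_def')
  then show y: "y \<in> carrier M"
    using assms E(1) by auto
  have "y \<ominus>\<^bsub>M\<^esub> x = w"
    using w assms E(1) by (auto simp: M.minus_eq M.a_assoc M.r_neg subset_iff)
  then show "W +>\<^bsub>M\<^esub> y = W +>\<^bsub>M\<^esub> x"
    using w y assms by (simp add: coset_eq_iff)
qed

lemma coset_self:
  assumes W: "submodule W R M" and "x \<in> carrier M"
  shows "x \<in> W +>\<^bsub>M\<^esub> x"
  using submodule_zero[OF W] assms by (force simp: a_r_coset_def')

text \<open>
  The operations on a quotient are unions over the representatives of a coset; they are computed on one
  representative if the others give the same set.
\<close>

lemma Union_coset:
  assumes W: "submodule W R M" and x: "x \<in> carrier M"
    and const: "\<And>y. y \<in> W +>\<^bsub>M\<^esub> x \<Longrightarrow> F y = F x"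
  shows "(\<Union>y\<in>W +>\<^bsub>M\<^esub> x. F y) = F x"
  using coset_self[OF W x] const by blast

lemma coset_add:
  assumes W: "submodule W R M" and "x \<in> carrier M" "y \<in> carrier M"
  shows "(W +>\<^bsub>M\<^esub> x) \<oplus>\<^bsub>quotient_module M W\<^esub> (W +>\<^bsub>M\<^esub> y) = W +>\<^bsub>M\<^esub> (x \<oplus>\<^bsub>M\<^esub> y)"
proof -
  interpret abelian_subgroup W M
    using submodule.axioms(1)[OF W] by (intro abelian_subgroupI3 additive_subgroupI M.abelian_group_axioms)
  show ?thesis
    using assms by (simp add: quotient_module_def a_rcos_sum)
qed

lemma coset_smult:
  assumes W: "submodule W R M" and c: "c \<in> carrier R" and x: "x \<in> carrier M"
  shows "c \<odot>\<^bsub>quotient_module M W\<^esub> (W +>\<^bsub>M\<^esub> x) = W +>\<^bsub>M\<^esub> (c \<odot>\<^bsub>M\<^esub> x)"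
proof -
  have const: "W +>\<^bsub>M\<^esub> (c \<odot>\<^bsub>M\<^esub> y) = W +>\<^bsub>M\<^esub> (c \<odot>\<^bsub>M\<^esub> x)" if y: "y \<in> W +>\<^bsub>M\<^esub> x" for y
  proof -
    note y = coset_subset[OF W x y]
    have "c \<odot>\<^bsub>M\<^esub> y \<ominus>\<^bsub>M\<^esub> c \<odot>\<^bsub>M\<^esub> x = c \<odot>\<^bsub>M\<^esub> (y \<ominus>\<^bsub>M\<^esub> x)"
      using x y c by (simp add: M.minus_eq smult_r_distr smult_r_minus)
    also have "\<dots> \<in> W"
      using y x c by (intro submoduleE(4)[OF W]) (simp_all add: coset_eq_iff[OF W, symmetric])
    finally show ?thesis
      using W c x y by (simp add: coset_eq_iff)
  qed
  have "c \<odot>\<^bsub>quotient_module M W\<^esub> (W +>\<^bsub>M\<^esub> x) = (\<Union>y\<in>W +>\<^bsub>M\<^esub> x. W +>\<^bsub>M\<^esub> (c \<odot>\<^bsub>M\<^esub> y))"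
    by (simp add: quotient_module_def)
  also have "\<dots> = W +>\<^bsub>M\<^esub> (c \<odot>\<^bsub>M\<^esub> x)"
    using const by (rule Union_coset[OF W x])
  finally show ?thesis .
qed

lemma coset_zero: "submodule W R M \<Longrightarrow> W +>\<^bsub>M\<^esub> \<zero>\<^bsub>M\<^esub> = W"
  using submoduleE(1) by (intro M.a_coset_add_zero) auto

lemma module_quotient:
  assumes W: "submodule W R M"
  shows "module R (quotient_module M W)"
proof (rule moduleI)
  let ?Q = "quotient_module M W" and ?q = "\<lambda>x. W +>\<^bsub>M\<^esub> x"
  note [simp] = coset_add[OF W] coset_smult[OF W] quotient_module_carrier
  have zero: "\<zero>\<^bsub>?Q\<^esub> = ?q \<zero>\<^bsub>M\<^esub>"
    using coset_zero[OF W] by (simp add: quotient_module_def)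
  show "abelian_group ?Q"
  proof (rule abelian_groupI)
    fix C assume "C \<in> carrier ?Q"
    then obtain x where x: "x \<in> carrier M" "C = ?q x"
      by auto
    then have "?q (\<ominus>\<^bsub>M\<^esub> x) \<oplus>\<^bsub>?Q\<^esub> C = \<zero>\<^bsub>?Q\<^esub>" "?q (\<ominus>\<^bsub>M\<^esub> x) \<in> carrier ?Q"
      by (auto simp: zero M.l_neg)
    then show "\<exists>D\<in>carrier ?Q. D \<oplus>\<^bsub>?Q\<^esub> C = \<zero>\<^bsub>?Q\<^esub>"
      by blast
  qed (auto simp: zero M.a_ac)
qed (auto simp: coset_add[OF W] coset_smult[OF W] quotient_module_carrier smult_l_distr smult_r_distr smult_assoc1 intro: R.is_cring)

lemma quotient_map_linear:
  assumes W: "submodule W R M"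
  shows "linear_map R M (quotient_module M W) (\<lambda>x. W +>\<^bsub>M\<^esub> x)"
  using assms module_quotient module_axioms
  by (intro linear_mapI) (auto simp: coset_add coset_smult quotient_module_carrier)

lemma quotient_map_eq_zero_iff:
  assumes W: "submodule W R M" and x: "x \<in> carrier M"
  shows "W +>\<^bsub>M\<^esub> x = \<zero>\<^bsub>quotient_module M W\<^esub> \<longleftrightarrow> x \<in> W"
proof -
  have "W +>\<^bsub>M\<^esub> x = \<zero>\<^bsub>quotient_module M W\<^esub> \<longleftrightarrow> W +>\<^bsub>M\<^esub> x = W +>\<^bsub>M\<^esub> \<zero>\<^bsub>M\<^esub>"
    using coset_zero[OF W] by (simp add: quotient_module_def)
  moreover have neg_zero: "\<ominus>\<^bsub>M\<^esub> \<zero>\<^bsub>M\<^esub> = \<zero>\<^bsub>M\<^esub>"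
    by (metis M.a_inv_closed M.l_zero M.r_neg M.zero_closed)
  ultimately show ?thesis
    using coset_eq_iff[OF W x, of "\<zero>\<^bsub>M\<^esub>"] x neg_zero by (simp add: M.minus_eq)
qed

lemma quotient_span:
  assumes W: "submodule W R M" and X: "lin_span R M X = carrier M"
  shows "lin_span R (quotient_module M W) ((\<lambda>x. W +>\<^bsub>M\<^esub> x) ` X) = carrier (quotient_module M W)" (is "?L = ?R")
proof
  let ?Q = "quotient_module M W" and ?q = "\<lambda>x. W +>\<^bsub>M\<^esub> x"
  interpret q: linear_map R M ?Q ?q
    by (rule quotient_map_linear[OF W])
  have XM: "X \<subseteq> carrier M"
    using X lin_span_superset[of X R M] by simp
  then have E: "?q ` X \<subseteq> carrier ?Q"
    by (auto simp: quotient_module_carrier)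
  note H = q.N.lin_span_submodule[OF E]
  show "?L \<subseteq> ?R"
    using q.N.submoduleE(1)[OF H] .
  have "?q x \<in> ?L" if "x \<in> carrier M" for x
    using q.map_lin_span[OF XM H] that X lin_span_superset[of "?q ` X" R ?Q] by auto
  then show "?R \<subseteq> ?L"
    by (auto simp: quotient_module_carrier)
qed

end

lemma (in linear_map) descend_coset:
  assumes W: "submodule W K M" and null: "\<And>w. w \<in> W \<Longrightarrow> f w = \<zero>\<^bsub>N\<^esub>" and x: "x \<in> carrier M"
  shows "descend f (W +>\<^bsub>M\<^esub> x) = f x"
proof -
  have "f y = f x" if "y \<in> W +>\<^bsub>M\<^esub> x" for y
  proof -
    note y = M.coset_subset[OF W x that]
    then have "f (y \<ominus>\<^bsub>M\<^esub> x) = \<zero>\<^bsub>N\<^esub>"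
      using x by (intro null) (simp add: M.coset_eq_iff[OF W])
    then show ?thesis
      using x y by (simp add: map_minus N.minus_self_iff map_closed)
  qed
  then have "f ` (W +>\<^bsub>M\<^esub> x) = {f x}"
    using M.coset_self[OF W x] by blast
  then show ?thesis
    by (simp add: descend_def)
qed

lemma (in linear_map) descend_linear:
  assumes W: "submodule W K M" and null: "\<And>w. w \<in> W \<Longrightarrow> f w = \<zero>\<^bsub>N\<^esub>"
  shows "linear_map K (quotient_module M W) N (descend f)"
  by (intro linear_mapI M.module_quotient[OF W] N.module_axioms)
    (auto simp: M.quotient_module_carrier descend_coset[OF assms] map_closed M.coset_add[OF W]
      M.coset_smult[OF W] map_add map_smult)

text \<open>
  The universal property of the module with generators \<open>X\<close> and relations \<open>rels\<close>. Tensor products and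
  the space of decorated trees are both of this kind.
\<close>

context module
begin

lemma
  assumes rels: "rels \<subseteq> carrier (free_module R X)" and v: "v \<in> X \<rightarrow> carrier M"
    and null: "\<And>r. r \<in> rels \<Longrightarrow> free_ext R M v r = \<zero>\<^bsub>M\<^esub>"
  shows quot_ext_linear:
      "linear_map R (quotient_module (free_module R X) (lin_span R (free_module R X) rels)) M (quot_ext R M v)"
    and quot_ext_gen:
      "b \<in> X \<Longrightarrow> quot_ext R M v (lin_span R (free_module R X) rels +>\<^bsub>free_module R X\<^esub> free_gen R b) = v b"
proof -
  interpret F: linear_map R "free_module R X" M "free_ext R M v"
    by (rule free_ext_linear[OF v])
  note W = F.M.lin_span_submodule[OF rels]
  have null': "free_ext R M v w = \<zero>\<^bsub>M\<^esub>" if "w \<in> lin_span R (free_module R X) rels" for w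
    using F.map_lin_span[OF rels trivial_submodule _ that] null by blast
  show "linear_map R (quotient_module (free_module R X) (lin_span R (free_module R X) rels)) M (quot_ext R M v)"
    unfolding quot_ext_def by (rule F.descend_linear[OF W null'])
  show "quot_ext R M v (lin_span R (free_module R X) rels +>\<^bsub>free_module R X\<^esub> free_gen R b) = v b" if "b \<in> X"
    using that v unfolding quot_ext_def
    by (subst F.descend_coset[OF W null']) (auto simp: R.free_gen_closed free_ext_gen Pi_iff)
qed

end

section \<open>Tensor products\<close>

text \<open>
  The same vector space occurs under several record types, for example with and without Hom-Hopf
  structure. Everything that belongs to linear algebra depends only on the fields compared here.
\<close>

definition same_space :: "('k, 'v, 'm) module_scheme \<Rightarrow> ('k, 'v, 'n) module_scheme \<Rightarrow> bool" where
  "same_space M N \<longleftrightarrow> carrier M = carrier N \<and> zero M = zero N \<and> add M = add N \<and> smult M = smult N"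

lemma same_space_sym: "same_space M N \<Longrightarrow> same_space N M"
  by (simp add: same_space_def)

lemma same_space_module_imp:
  assumes s: "same_space M N" and M: "module K M"
  shows "module K N"
proof -
  interpret M: module K M by fact
  have e: "carrier N = carrier M" "zero N = zero M" "add N = add M" "smult N = smult M"
    using s by (simp_all add: same_space_def)
  show ?thesis
  proof (rule moduleI)
    show "abelian_group N"
    proof (rule abelian_groupI)
      show "\<exists>y\<in>carrier N. y \<oplus>\<^bsub>N\<^esub> x = \<zero>\<^bsub>N\<^esub>" if "x \<in> carrier N" for x
        using that M.M.l_neg[of x] M.M.a_inv_closed[of x] unfolding e by blast
    qed (auto simp: e M.M.a_ac)
  qed (auto simp: e M.smult_l_distr M.smult_r_distr M.smult_assoc1 intro: M.R.is_cring)
qed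

lemma same_space_module: "same_space M N \<Longrightarrow> module K M \<longleftrightarrow> module K N"
  using same_space_module_imp same_space_sym by metis

lemma same_space_submodule: "same_space M N \<Longrightarrow> submodule H K M \<longleftrightarrow> submodule H K N"
  by (simp add: submodule_def submodule_axioms_def subgroup_def m_inv_def same_space_def)

lemma same_space_lin_span: "same_space M N \<Longrightarrow> lin_span K M X = lin_span K N X"
  by (simp add: lin_span_def same_space_submodule)

lemma same_space_linear_map:
  "\<lbrakk>same_space M M'; same_space N N'\<rbrakk> \<Longrightarrow> linear_map K M N f \<longleftrightarrow> linear_map K M' N' f"
  by (simp add: linear_map_def linear_map_axioms_def same_space_module[of M M'] same_space_module[of N N'])
    (simp add: same_space_def)

lemma same_space_bilinear_map:
  assumes "same_space V V'" "same_space W W'" "same_space N N'"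
  shows "bilinear_map K V W N f \<longleftrightarrow> bilinear_map K V' W' N' f"
proof -
  have "carrier V = carrier V'" "carrier W = carrier W'"
    using assms by (simp_all add: same_space_def)
  then show ?thesis
    by (simp add: bilinear_map_def same_space_linear_map[OF assms(1,3)] same_space_linear_map[OF assms(2,3)])
qed

lemma same_space_minus: "same_space M N \<Longrightarrow> x \<ominus>\<^bsub>M\<^esub> y = x \<ominus>\<^bsub>N\<^esub> y"
  by (simp add: a_minus_def a_inv_def m_inv_def same_space_def)

lemma same_space_bilinear_rels:
  "\<lbrakk>same_space V V'; same_space W W'\<rbrakk> \<Longrightarrow> bilinear_rels K V W = bilinear_rels K V' W'"
  by (simp add: bilinear_rels_def same_space_def)

lemma
  assumes "same_space V V'" "same_space W W'"
  shows same_space_tensor_module: "tensor_module K V W = tensor_module K V' W'"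
    and same_space_tensor: "tensor K V W = tensor K V' W'"
proof -
  have c: "carrier V = carrier V'" "carrier W = carrier W'"
    using assms by (simp_all add: same_space_def)
  show "tensor_module K V W = tensor_module K V' W'"
    by (simp add: tensor_module_def bilinear_null_def same_space_bilinear_rels[OF assms] c)
  show "tensor K V W = tensor K V' W'"
    by (intro ext) (simp add: tensor_def bilinear_null_def same_space_bilinear_rels[OF assms] c)
qed

locale two_modules = V: module K V + W: module K W
  for K :: "('k, 'r) ring_scheme" (structure) and V :: "('k, 'v, 'm) module_scheme" (structure)
    and W :: "('k, 'w, 'n) module_scheme" (structure)
begin

abbreviation pairs :: "('k, 'v \<times> 'w \<Rightarrow> 'k) module" where
  "pairs \<equiv> free_module K (carrier V \<times> carrier W)"

lemma bilinear_rels_closed: "bilinear_rels K V W \<subseteq> carrier pairs"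
proof -
  interpret F: module K pairs
    by (rule V.R.module_free_module)
  show ?thesis
    unfolding bilinear_rels_def Let_def
    by (auto intro!: F.M.minus_closed F.M.a_closed F.smult_closed V.R.free_gen_closed)
qed

lemma bilinear_null_submodule: "submodule (bilinear_null K V W) K pairs"
  unfolding bilinear_null_def
  by (rule module.lin_span_submodule[OF V.R.module_free_module bilinear_rels_closed])

lemma module_tensor: "module K (tensor_module K V W)"
  unfolding tensor_module_def
  by (rule module.module_quotient[OF V.R.module_free_module bilinear_null_submodule])

lemma
  assumes f: "bilinear_map K V W N f" and N: "module K N"
  shows tensor_ext_linear: "linear_map K (tensor_module K V W) N (quot_ext K N (\<lambda>(x, y). f x y))"
    and tensor_ext_tensor:
      "\<lbrakk>x \<in> carrier V; y \<in> carrier W\<rbrakk> \<Longrightarrow> quot_ext K N (\<lambda>(x, y). f x y) (tensor K V W x y) = f x y"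
proof -
  interpret N: module K N by fact
  let ?v = "\<lambda>(x, y). f x y"
  have l: "linear_map K V N (\<lambda>x. f x y)" if "y \<in> carrier W" for y
    using f that by (simp add: bilinear_map_def)
  have r: "linear_map K W N (f x)" if "x \<in> carrier V" for x
    using f that by (simp add: bilinear_map_def)
  have v: "?v \<in> carrier V \<times> carrier W \<rightarrow> carrier N"
    using linear_map.map_closed[OF l] by auto
  interpret E: linear_map K pairs N "free_ext K N ?v"
    by (rule N.free_ext_linear[OF v])
  have gen: "free_ext K N ?v (free_gen K (x, y)) = f x y" if "x \<in> carrier V" "y \<in> carrier W" for x y
    using N.free_ext_gen[of ?v "(x, y)"] linear_map.map_closed[OF r] that by simp
  have null: "free_ext K N ?v r = \<zero>\<^bsub>N\<^esub>" if r_mem: "r \<in> bilinear_rels K V W" for r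
    using r_mem linear_map.map_add[OF l] linear_map.map_smult[OF l]
      linear_map.map_add[OF r] linear_map.map_smult[OF r] linear_map.map_closed[OF r]
    unfolding bilinear_rels_def Let_def
    by (auto simp: E.map_minus E.map_add E.map_smult gen V.R.free_gen_closed N.minus_self_iff)
  show "linear_map K (tensor_module K V W) N (quot_ext K N ?v)"
    unfolding tensor_module_def bilinear_null_def
    by (rule N.quot_ext_linear[OF bilinear_rels_closed v null])
  show "quot_ext K N ?v (tensor K V W x y) = f x y" if "x \<in> carrier V" "y \<in> carrier W"
    unfolding tensor_def bilinear_null_def
    using that by (subst N.quot_ext_gen[OF bilinear_rels_closed v null]) auto
qed

lemma bilinear_tensor: "bilinear_map K V W (tensor_module K V W) (tensor K V W)"
proof -
  interpret F: module K pairs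
    by (rule V.R.module_free_module)
  interpret q: linear_map K pairs "tensor_module K V W"
      "\<lambda>u. bilinear_null K V W +>\<^bsub>pairs\<^esub> u"
    unfolding tensor_module_def by (rule F.quotient_map_linear[OF bilinear_null_submodule])
  have rel: "bilinear_null K V W +>\<^bsub>pairs\<^esub> u = bilinear_null K V W +>\<^bsub>pairs\<^esub> w"
    if "u \<ominus>\<^bsub>pairs\<^esub> w \<in> bilinear_rels K V W" "u \<in> carrier pairs" "w \<in> carrier pairs" for u w
    using that(1) lin_span_superset[of "bilinear_rels K V W" K pairs]
    by (subst F.coset_eq_iff[OF bilinear_null_submodule that(2,3)]) (auto simp: bilinear_null_def)
  have rels:
    "\<lbrakk>x \<in> carrier V; y \<in> carrier V; z \<in> carrier W\<rbrakk> \<Longrightarrow>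
      free_gen K (x \<oplus>\<^bsub>V\<^esub> y, z) \<ominus>\<^bsub>pairs\<^esub> (free_gen K (x, z) \<oplus>\<^bsub>pairs\<^esub> free_gen K (y, z)) \<in> bilinear_rels K V W"
    "\<lbrakk>x \<in> carrier V; y' \<in> carrier W; z \<in> carrier W\<rbrakk> \<Longrightarrow>
      free_gen K (x, y' \<oplus>\<^bsub>W\<^esub> z) \<ominus>\<^bsub>pairs\<^esub> (free_gen K (x, y') \<oplus>\<^bsub>pairs\<^esub> free_gen K (x, z)) \<in> bilinear_rels K V W"
    "\<lbrakk>c \<in> carrier K; x \<in> carrier V; z \<in> carrier W\<rbrakk> \<Longrightarrow>
      free_gen K (c \<odot>\<^bsub>V\<^esub> x, z) \<ominus>\<^bsub>pairs\<^esub> c \<odot>\<^bsub>pairs\<^esub> free_gen K (x, z) \<in> bilinear_rels K V W"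
    "\<lbrakk>c \<in> carrier K; x \<in> carrier V; z \<in> carrier W\<rbrakk> \<Longrightarrow>
      free_gen K (x, c \<odot>\<^bsub>W\<^esub> z) \<ominus>\<^bsub>pairs\<^esub> c \<odot>\<^bsub>pairs\<^esub> free_gen K (x, z) \<in> bilinear_rels K V W"
    for x y z y' c
    unfolding bilinear_rels_def Let_def by blast+
  note [simp] = V.R.free_gen_closed
  let ?T = "tensor_module K V W" and ?t = "tensor K V W"
  have closed: "?t x y \<in> carrier ?T" if "x \<in> carrier V" "y \<in> carrier W" for x y
    using that by (auto simp: tensor_def intro!: q.map_closed)
  have 1: "?t (x \<oplus>\<^bsub>V\<^esub> y) z = ?t x z \<oplus>\<^bsub>?T\<^esub> ?t y z" if "x \<in> carrier V" "y \<in> carrier V" "z \<in> carrier W" for x y z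
  proof -
    have "?t (x \<oplus>\<^bsub>V\<^esub> y) z
        = bilinear_null K V W +>\<^bsub>pairs\<^esub> (free_gen K (x, z) \<oplus>\<^bsub>pairs\<^esub> free_gen K (y, z))"
      unfolding tensor_def using that by (intro rel rels) simp_all
    then show ?thesis
      using that by (simp add: tensor_def q.map_add)
  qed
  have 2: "?t x (y \<oplus>\<^bsub>W\<^esub> z) = ?t x y \<oplus>\<^bsub>?T\<^esub> ?t x z" if "x \<in> carrier V" "y \<in> carrier W" "z \<in> carrier W" for x y z
  proof -
    have "?t x (y \<oplus>\<^bsub>W\<^esub> z)
        = bilinear_null K V W +>\<^bsub>pairs\<^esub> (free_gen K (x, y) \<oplus>\<^bsub>pairs\<^esub> free_gen K (x, z))"
      unfolding tensor_def using that by (intro rel rels) simp_all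
    then show ?thesis
      using that by (simp add: tensor_def q.map_add)
  qed
  have 3: "?t (c \<odot>\<^bsub>V\<^esub> x) y = c \<odot>\<^bsub>?T\<^esub> ?t x y" if "c \<in> carrier K" "x \<in> carrier V" "y \<in> carrier W" for c x y
  proof -
    have "?t (c \<odot>\<^bsub>V\<^esub> x) y = bilinear_null K V W +>\<^bsub>pairs\<^esub> (c \<odot>\<^bsub>pairs\<^esub> free_gen K (x, y))"
      unfolding tensor_def using that by (intro rel rels) simp_all
    then show ?thesis
      using that by (simp add: tensor_def q.map_smult)
  qed
  have 4: "?t x (c \<odot>\<^bsub>W\<^esub> y) = c \<odot>\<^bsub>?T\<^esub> ?t x y" if "c \<in> carrier K" "x \<in> carrier V" "y \<in> carrier W" for c x y
  proof -
    have "?t x (c \<odot>\<^bsub>W\<^esub> y) = bilinear_null K V W +>\<^bsub>pairs\<^esub> (c \<odot>\<^bsub>pairs\<^esub> free_gen K (x, y))"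
      unfolding tensor_def using that by (intro rel rels) simp_all
    then show ?thesis
      using that by (simp add: tensor_def q.map_smult)
  qed
  show ?thesis
    unfolding bilinear_map_def
    by (intro conjI ballI linear_mapI V.module_axioms W.module_axioms module_tensor closed 1 2 3 4)
qed

lemma tensor_closed:
  "\<lbrakk>x \<in> carrier V; y \<in> carrier W\<rbrakk> \<Longrightarrow> tensor K V W x y \<in> carrier (tensor_module K V W)"
  using bilinear_tensor linear_map.map_closed by (fastforce simp: bilinear_map_def)

lemma tensor_linear_left: "y \<in> carrier W \<Longrightarrow> linear_map K V (tensor_module K V W) (\<lambda>x. tensor K V W x y)"
  and tensor_linear_right: "x \<in> carrier V \<Longrightarrow> linear_map K W (tensor_module K V W) (tensor K V W x)"
  using bilinear_tensor by (simp_all add: bilinear_map_def)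

end

lemma
  assumes f: "linear_map K V V' f" and g: "linear_map K W W' g"
  shows tensor_map_linear:
      "linear_map K (tensor_module K V W) (tensor_module K V' W') (tensor_map K V' W' f g)"
    and tensor_map_tensor:
      "\<lbrakk>x \<in> carrier V; y \<in> carrier W\<rbrakk> \<Longrightarrow>
        tensor_map K V' W' f g (tensor K V W x y) = tensor K V' W' (f x) (g y)"
proof -
  interpret f: linear_map K V V' f by fact
  interpret g: linear_map K W W' g by fact
  interpret VW: two_modules K V W ..
  interpret VW': two_modules K V' W' ..
  have b: "bilinear_map K V W (tensor_module K V' W') (\<lambda>x y. tensor K V' W' (f x) (g y))"
    unfolding bilinear_map_def
    using linear_map_comp[OF f VW'.tensor_linear_left] linear_map_comp[OF g VW'.tensor_linear_right]
      f.map_closed g.map_closed by blast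
  show "linear_map K (tensor_module K V W) (tensor_module K V' W') (tensor_map K V' W' f g)"
    unfolding tensor_map_def by (rule VW.tensor_ext_linear[OF b VW'.module_tensor])
  show "tensor_map K V' W' f g (tensor K V W x y) = tensor K V' W' (f x) (g y)"
    if "x \<in> carrier V" "y \<in> carrier W"
    unfolding tensor_map_def by (rule VW.tensor_ext_tensor[OF b VW'.module_tensor that])
qed

section \<open>Two-sided ideals\<close>

text \<open>Multiplication by a fixed element of \<open>H\<close> is linear, so it may be tested on a spanning set.\<close>

lemma two_sided_ideal_from_span:
  assumes A: "module K A" and mult: "bilinear_map K A A A (mult A)" and X: "lin_span K A X = carrier A"
    and H: "submodule H K A"
    and closed: "\<And>x j. \<lbrakk>x \<in> X; j \<in> H\<rbrakk> \<Longrightarrow> x \<otimes>\<^bsub>A\<^esub> j \<in> H \<and> j \<otimes>\<^bsub>A\<^esub> x \<in> H"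
  shows "two_sided_ideal K A H"
  unfolding two_sided_ideal_def
proof (intro conjI ballI H)
  interpret A: module K A by fact
  fix a j assume a: "a \<in> carrier A" and j: "j \<in> H"
  have jA: "j \<in> carrier A"
    using A.submoduleE(1)[OF H] j by auto
  have XA: "X \<subseteq> carrier A"
    using X lin_span_superset[of X K A] by simp
  have l: "linear_map K A A (\<lambda>x. x \<otimes>\<^bsub>A\<^esub> j)" and r: "linear_map K A A (\<lambda>x. j \<otimes>\<^bsub>A\<^esub> x)"
    using mult jA by (auto simp: bilinear_map_def)
  show "a \<otimes>\<^bsub>A\<^esub> j \<in> H"
    using linear_map.map_lin_span[OF l XA H] closed j a X by blast
  show "j \<otimes>\<^bsub>A\<^esub> a \<in> H"
    using linear_map.map_lin_span[OF r XA H] closed j a X by blast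
qed

lemma two_sided_ideal_lin_span:
  assumes A: "module K A" and mult: "bilinear_map K A A A (mult A)" and X: "lin_span K A X = carrier A"
    and E: "E \<subseteq> carrier A"
    and closed: "\<And>x e. \<lbrakk>x \<in> X; e \<in> E\<rbrakk> \<Longrightarrow> x \<otimes>\<^bsub>A\<^esub> e \<in> lin_span K A E \<and> e \<otimes>\<^bsub>A\<^esub> x \<in> lin_span K A E"
  shows "two_sided_ideal K A (lin_span K A E)"
proof (rule two_sided_ideal_from_span[OF A mult X])
  interpret A: module K A by fact
  show H: "submodule (lin_span K A E) K A"
    by (rule A.lin_span_submodule[OF E])
  fix x j assume x: "x \<in> X" and j: "j \<in> lin_span K A E"
  have "x \<in> carrier A"
    using X lin_span_superset[of X K A] x by auto
  then have l: "linear_map K A A (\<lambda>y. y \<otimes>\<^bsub>A\<^esub> x)" and r: "linear_map K A A (\<lambda>y. x \<otimes>\<^bsub>A\<^esub> y)"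
    using mult by (auto simp: bilinear_map_def)
  show "x \<otimes>\<^bsub>A\<^esub> j \<in> lin_span K A E \<and> j \<otimes>\<^bsub>A\<^esub> x \<in> lin_span K A E"
    using linear_map.map_lin_span[OF l E H _ j] linear_map.map_lin_span[OF r E H _ j] closed x by blast
qed

lemma generated_ideal_least:
  "\<lbrakk>two_sided_ideal K A J; X \<subseteq> J\<rbrakk> \<Longrightarrow> generated_ideal K A X \<subseteq> J"
  by (auto simp: generated_ideal_def)

lemma generated_ideal_superset: "X \<subseteq> generated_ideal K A X"
  by (auto simp: generated_ideal_def)

lemma bilinear_mult_closed:
  "\<lbrakk>bilinear_map K A A A (mult A); a \<in> carrier A; b \<in> carrier A\<rbrakk> \<Longrightarrow> a \<otimes>\<^bsub>A\<^esub> b \<in> carrier A"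
  using linear_map.map_closed by (fastforce simp: bilinear_map_def)

lemma two_sided_ideal_generated:
  assumes A: "module K A" and mult: "bilinear_map K A A A (mult A)" and X: "X \<subseteq> carrier A"
  shows "two_sided_ideal K A (generated_ideal K A X)"
proof -
  interpret A: module K A by fact
  have top: "two_sided_ideal K A (carrier A)"
    using A.carrier_is_submodule bilinear_mult_closed[OF mult] by (simp add: two_sided_ideal_def)
  have "submodule (generated_ideal K A X) K A"
    unfolding generated_ideal_def
    by (rule A.submodule_Inter) (use X top in \<open>auto simp: two_sided_ideal_def\<close>)
  then show ?thesis
    unfolding two_sided_ideal_def generated_ideal_def by blast
qed

lemma rcoset_mult_cosets:
  assumes A: "module K A" and mult: "bilinear_map K A A A (mult A)" and I: "two_sided_ideal K A I"
    and xy: "x \<in> carrier A" "y \<in> carrier A"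
  shows "rcoset_mult A I (I +>\<^bsub>A\<^esub> x) (I +>\<^bsub>A\<^esub> y) = I +>\<^bsub>A\<^esub> (x \<otimes>\<^bsub>A\<^esub> y)"
proof -
  interpret A: module K A by fact
  have W: "submodule I K A"
    using I by (simp add: two_sided_ideal_def)
  have l: "linear_map K A A (\<lambda>x. x \<otimes>\<^bsub>A\<^esub> y)" if "y \<in> carrier A" for y
    using mult that by (simp add: bilinear_map_def)
  have r: "linear_map K A A (\<lambda>y. x \<otimes>\<^bsub>A\<^esub> y)" if "x \<in> carrier A" for x
    using mult that by (simp add: bilinear_map_def)
  have const: "I +>\<^bsub>A\<^esub> (a \<otimes>\<^bsub>A\<^esub> b) = I +>\<^bsub>A\<^esub> (x \<otimes>\<^bsub>A\<^esub> y)" if "a \<in> I +>\<^bsub>A\<^esub> x" "b \<in> I +>\<^bsub>A\<^esub> y" for a b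
  proof -
    note a = A.coset_subset[OF W xy(1) that(1)] and b = A.coset_subset[OF W xy(2) that(2)]
    have "(a \<ominus>\<^bsub>A\<^esub> x) \<otimes>\<^bsub>A\<^esub> b \<in> I" "x \<otimes>\<^bsub>A\<^esub> (b \<ominus>\<^bsub>A\<^esub> y) \<in> I"
      using a b xy I A.coset_eq_iff[OF W] unfolding two_sided_ideal_def by blast+
    then have "a \<otimes>\<^bsub>A\<^esub> b \<ominus>\<^bsub>A\<^esub> x \<otimes>\<^bsub>A\<^esub> b \<in> I" "x \<otimes>\<^bsub>A\<^esub> b \<ominus>\<^bsub>A\<^esub> x \<otimes>\<^bsub>A\<^esub> y \<in> I"
      using a b xy linear_map.map_minus[OF l] linear_map.map_minus[OF r] by simp_all
    then show ?thesis
      using a b xy bilinear_mult_closed[OF mult] A.coset_eq_iff[OF W] by metis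
  qed
  then have "(\<Union>a\<in>I +>\<^bsub>A\<^esub> x. \<Union>b\<in>I +>\<^bsub>A\<^esub> y. I +>\<^bsub>A\<^esub> (a \<otimes>\<^bsub>A\<^esub> b)) = (\<Union>a\<in>I +>\<^bsub>A\<^esub> x. \<Union>b\<in>I +>\<^bsub>A\<^esub> y. I +>\<^bsub>A\<^esub> (x \<otimes>\<^bsub>A\<^esub> y))"
    by (intro SUP_cong refl)
  also have "\<dots> = I +>\<^bsub>A\<^esub> (x \<otimes>\<^bsub>A\<^esub> y)"
    using A.coset_self[OF W xy(1)] A.coset_self[OF W xy(2)] by blast
  finally show ?thesis
    by (simp add: rcoset_mult_def)
qed

section \<open>Associativity steps between leaf weighted trees\<close>

lemma deg_simps [simp]: "deg None = 0" "deg (Some t) = leaves t"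
  by (simp_all add: deg_def)

lemma leaves_pos [simp]: "0 < leaves t"
  by (induction t) auto

lemma deg_eq_0_iff: "deg b = 0 \<longleftrightarrow> b = None"
proof (cases b)
  case (Some t)
  then show ?thesis
    using leaves_pos[of t] by (simp del: leaves_pos)
qed simp

lemma leaves_shift [simp]: "leaves (shift t) = leaves t"
  by (induction t) auto

lemma deg_basis_twist [simp]: "deg (basis_twist b) = deg b"
  by (cases b) (auto simp: basis_twist_def)

lemma basis_twist_simps [simp]: "basis_twist None = None" "basis_twist (Some t) = Some (shift t)"
  by (simp_all add: basis_twist_def)

lemma graft_None_right [simp]: "graft b None = basis_twist b"
  by (cases b) auto

lemma deg_graft [simp]: "deg (graft b c) = deg b + deg c"
  by (cases b; cases c) auto

lemma basis_twist_graft: "basis_twist (graft b c) = graft (basis_twist b) (basis_twist c)"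
  by (cases b; cases c) auto

lemma graft_eq_None_iff: "graft b c = None \<longleftrightarrow> b = None \<and> c = None"
  by (cases b; cases c) auto

text \<open>
  The relation is deliberately neither symmetric nor transitive: only the span of the differences of its
  two sides is used, and spans take care of both.
\<close>

inductive assoc_step :: "wtree option \<Rightarrow> wtree option \<Rightarrow> bool" where
  assoc: "assoc_step (graft (graft b c) (basis_twist d)) (graft (basis_twist b) (graft c d))"
| graft_left: "assoc_step b c \<Longrightarrow> assoc_step (graft a b) (graft a c)"
| graft_right: "assoc_step b c \<Longrightarrow> assoc_step (graft b a) (graft c a)"

lemma assoc_step_deg: "assoc_step b c \<Longrightarrow> deg b = deg c"
  by (induction rule: assoc_step.induct) auto

text \<open>
  If one of the three factors is \<open>\<one>\<close>, both sides of the associativity relation reduce to the same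
  tree. This is why the ideal of associativity relations starts in degree \<open>3\<close>.
\<close>

lemma assoc_step_deg_ge_3: "assoc_step b c \<Longrightarrow> b = c \<or> 3 \<le> deg b"
proof (induction rule: assoc_step.induct)
  case (assoc b c d)
  show ?case
  proof (cases "b = None \<or> c = None \<or> d = None")
    case True
    then show ?thesis
      by (auto simp: basis_twist_graft)
  next
    case False
    then obtain t u v where "b = Some t" "c = Some u" "d = Some v"
      by auto
    then show ?thesis
      using leaves_pos[of t] leaves_pos[of u] leaves_pos[of v] by (auto simp del: leaves_pos)
  qed
qed auto

lemma basis_restrict_simps [simp]:
  "basis_restrict None I = None" "basis_restrict (Some t) I = tree_restrict t I"
  by (simp_all add: basis_restrict_def)

lemma tree_restrict_shift: "tree_restrict (shift t) I = basis_twist (tree_restrict t I)"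
  by (induction t arbitrary: I) (auto simp: basis_twist_graft)

lemma basis_restrict_twist: "basis_restrict (basis_twist b) I = basis_twist (basis_restrict b I)"
  by (cases b) (auto simp: tree_restrict_shift)

lemma basis_restrict_graft:
  "basis_restrict (graft b c) I = graft (basis_restrict b I) (basis_restrict c {i. i + deg b \<in> I})"
  by (cases b; cases c) (auto simp: tree_restrict_shift)

text \<open>
  Restriction commutes with grafting and with the twist, so it turns an instance of the relation into
  another one, possibly between equal trees.
\<close>

lemma assoc_step_restrict: "assoc_step b c \<Longrightarrow> assoc_step (basis_restrict b I) (basis_restrict c I)"
proof (induction arbitrary: I rule: assoc_step.induct)
  case (assoc b c d)
  show ?case
    by (simp add: basis_restrict_graft basis_restrict_twist add.assoc add.commute[of "deg c"] assoc_step.assoc)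
next
  case (graft_left b c a)
  then show ?case
    by (simp add: basis_restrict_graft assoc_step.graft_left)
next
  case (graft_right b c a)
  then show ?case
    by (simp add: basis_restrict_graft assoc_step_deg[of b c] assoc_step.graft_right)
qed

lemma card_shifted_interval:
  fixes m n :: nat
  shows "card {i. i < m + n \<and> i \<in> I} = card {i. i < m \<and> i \<in> I} + card {i. i < n \<and> i + m \<in> I}"
proof -
  have "{i. i < m + n \<and> i \<in> I} = {i. i < m \<and> i \<in> I} \<union> (\<lambda>i. i + m) ` {i. i < n \<and> i + m \<in> I}"
  proof (intro equalityI subsetI)
    fix i assume i: "i \<in> {i. i < m + n \<and> i \<in> I}"
    show "i \<in> {i. i < m \<and> i \<in> I} \<union> (\<lambda>i. i + m) ` {i. i < n \<and> i + m \<in> I}"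
    proof (cases "i < m")
      case False
      then show ?thesis
        using i by (intro UnI2 image_eqI[of _ _ "i - m"]) auto
    qed (use i in auto)
  qed auto
  moreover have "card ((\<lambda>i. i + m) ` {i. i < n \<and> i + m \<in> I}) = card {i. i < n \<and> i + m \<in> I}"
    by (intro card_image) (auto simp: inj_on_def)
  moreover have "card ({i. i < m \<and> i \<in> I} \<union> (\<lambda>i. i + m) ` {i. i < n \<and> i + m \<in> I})
      = card {i. i < m \<and> i \<in> I} + card ((\<lambda>i. i + m) ` {i. i < n \<and> i + m \<in> I})"
    by (intro card_Un_disjoint) auto
  ultimately show ?thesis
    by simp
qed

lemma deg_basis_restrict: "deg (basis_restrict b I) = card {i. i < deg b \<and> i \<in> I}"
proof (cases b)
  case (Some t)
  have "deg (tree_restrict t I) = card {i. i < leaves t \<and> i \<in> I}"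
  proof (induction t arbitrary: I)
    case (Leaf a)
    have "{i. i < leaves (Leaf a) \<and> i \<in> I} = (if 0 \<in> I then {0} else {})"
      by auto
    then show ?case
      by simp
  qed (simp add: card_shifted_interval)
  then show ?thesis
    using Some by simp
qed simp

lemma basis_restrict_cong:
  assumes "I \<inter> {..<deg b} = I' \<inter> {..<deg b}"
  shows "basis_restrict b I = basis_restrict b I'"
proof -
  have "tree_restrict t I = tree_restrict t I'" if "I \<inter> {..<leaves t} = I' \<inter> {..<leaves t}" for t
    using that
  proof (induction t arbitrary: I I')
    case (Graft t u)
    have "i \<in> I \<longleftrightarrow> i \<in> I'" if "i < leaves t + leaves u" for i
      using Graft.prems that by auto
    then show ?case
      by (auto intro!: arg_cong2[where f = graft] Graft.IH)
  qed auto
  then show ?thesis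
    using assms by (cases b) auto
qed

lemma nths_cong:
  assumes "I \<inter> {..<length xs} = I' \<inter> {..<length xs}"
  shows "nths xs I = nths xs I'"
proof -
  have "i \<in> I \<longleftrightarrow> i \<in> I'" if "i < length xs" for i
    using assms that by auto
  then show ?thesis
    unfolding nths_def by (intro arg_cong[where f = "map fst"] filter_cong) (auto simp: set_zip)
qed

text \<open>Up to sign, the antipode reflects a tree and reverses its decorations.\<close>

primrec tree_mirror :: "wtree \<Rightarrow> wtree" where
  "tree_mirror (Leaf a) = Leaf a"
| "tree_mirror (Graft t u) = Graft (tree_mirror u) (tree_mirror t)"

definition basis_mirror :: "wtree option \<Rightarrow> wtree option" where
  "basis_mirror = map_option tree_mirror"

lemma basis_mirror_simps [simp]: "basis_mirror None = None" "basis_mirror (Some t) = Some (tree_mirror t)"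
  by (simp_all add: basis_mirror_def)

lemma tree_mirror_shift: "tree_mirror (shift t) = shift (tree_mirror t)"
  by (induction t) auto

lemma basis_mirror_twist: "basis_mirror (basis_twist b) = basis_twist (basis_mirror b)"
  by (cases b) (auto simp: tree_mirror_shift)

lemma basis_mirror_graft: "basis_mirror (graft b c) = graft (basis_mirror c) (basis_mirror b)"
  by (cases b; cases c) (auto simp: tree_mirror_shift)

lemma deg_basis_mirror [simp]: "deg (basis_mirror b) = deg b"
proof -
  have "leaves (tree_mirror t) = leaves t" for t
    by (induction t) auto
  then show ?thesis
    by (cases b) auto
qed

text \<open>Reflection exchanges the two ways of bracketing, hence the two sides of the step.\<close>

lemma assoc_step_mirror: "assoc_step b c \<Longrightarrow> assoc_step (basis_mirror c) (basis_mirror b)"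
  by (induction rule: assoc_step.induct)
    (auto simp: basis_mirror_graft basis_mirror_twist intro: assoc_step.intros)

section \<open>The ideal of associativity relations between trees\<close>

context cring
begin

lemma tree_space_simps [simp]:
  "carrier (tree_space R) = carrier (free_module R UNIV)" "\<zero>\<^bsub>tree_space R\<^esub> = \<zero>\<^bsub>free_module R UNIV\<^esub>"
  "add (tree_space R) = add (free_module R UNIV)" "smult (tree_space R) = smult (free_module R UNIV)"
  "mult (tree_space R) = tree_vee R"
  by (simp_all add: tree_space_def)

lemma same_space_tree_space: "same_space (tree_space R) (free_module R UNIV)"
  by (simp add: same_space_def)

lemma module_tree_space: "module R (tree_space R)"
  using same_space_module[OF same_space_tree_space] module_free_module by blast

lemma tree_space_gen: "free_gen R b \<in> carrier (tree_space R)"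
  by (simp add: free_gen_closed)

lemma tree_space_span: "lin_span R (tree_space R) (range (free_gen R)) = carrier (tree_space R)"
  by (simp add: same_space_lin_span[OF same_space_tree_space] free_module_span)

lemma
  shows bilinear_tree_vee: "bilinear_map R (tree_space R) (tree_space R) (tree_space R) (tree_vee R)"
    and tree_vee_gen: "tree_vee R (free_gen R b) (free_gen R c) = free_gen R (graft b c)"
proof -
  let ?F = "free_module R (UNIV :: wtree option set)"
  interpret F: module R ?F
    by (rule module_free_module)
  have row: "linear_map R ?F ?F (free_ext R ?F (\<lambda>c. free_gen R (graft b c)))" for b
    by (rule F.free_ext_linear) (simp add: free_gen_closed)
  have rows: "(\<lambda>b. free_ext R ?F (\<lambda>c. free_gen R (graft b c)) g) \<in> UNIV \<rightarrow> carrier ?F"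
    if "g \<in> carrier ?F" for g
    using linear_map.map_closed[OF row that] by auto
  have gen: "tree_vee R (free_gen R b) g = free_ext R ?F (\<lambda>c. free_gen R (graft b c)) g"
    if "g \<in> carrier ?F" for b g
    unfolding tree_vee_def Let_def using linear_map.map_closed[OF row that] by (subst F.free_ext_gen) auto
  show "tree_vee R (free_gen R b) (free_gen R c) = free_gen R (graft b c)"
    by (simp add: gen free_gen_closed F.free_ext_gen)
  have "bilinear_map R ?F ?F ?F (tree_vee R)"
  proof (rule bilinear_map_from_span[OF _ _ _ _ _ free_module_span])
    show "linear_map R ?F ?F (\<lambda>x. tree_vee R x y)" if "y \<in> carrier ?F" for y
      unfolding tree_vee_def Let_def by (rule F.free_ext_linear[OF rows[OF that]])
    show "linear_map R ?F ?F (tree_vee R x)" if x: "x \<in> free_gen R ` UNIV" for x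
    proof -
      obtain b where "x = free_gen R b"
        using x by auto
      then show ?thesis
        using linear_map_cong[OF row[of b]] gen by simp
    qed
  qed (rule module_free_module)+
  then show "bilinear_map R (tree_space R) (tree_space R) (tree_space R) (tree_vee R)"
    using same_space_bilinear_map[OF same_space_tree_space same_space_tree_space same_space_tree_space]
    by blast
qed

text \<open>
  Grafting a basis tree onto the difference along a step gives the difference along another step, since
  steps are closed under grafting. So these differences already span an ideal.
\<close>

lemma tree_ideal_eq:
  "tree_ideal R = lin_span R (tree_space R)
     {free_gen R b \<ominus>\<^bsub>tree_space R\<^esub> free_gen R c | b c. assoc_step b c}" (is "_ = lin_span R ?T ?E")
proof
  interpret T: module R ?T
    by (rule module_tree_space)
  note gen = tree_space_gen
  have mult: "bilinear_map R ?T ?T ?T (mult ?T)"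
    using bilinear_tree_vee by simp
  have sub: "free_gen R a \<otimes>\<^bsub>?T\<^esub> (free_gen R b \<ominus>\<^bsub>?T\<^esub> free_gen R c)
        = free_gen R (graft a b) \<ominus>\<^bsub>?T\<^esub> free_gen R (graft a c)"
      "(free_gen R b \<ominus>\<^bsub>?T\<^esub> free_gen R c) \<otimes>\<^bsub>?T\<^esub> free_gen R a
        = free_gen R (graft b a) \<ominus>\<^bsub>?T\<^esub> free_gen R (graft c a)" for a b c
  proof -
    have l: "linear_map R ?T ?T (tree_vee R (free_gen R a))"
      and r: "linear_map R ?T ?T (\<lambda>x. tree_vee R x (free_gen R a))"
      using bilinear_tree_vee gen by (auto simp: bilinear_map_def simp del: tree_space_simps)
    show "free_gen R a \<otimes>\<^bsub>?T\<^esub> (free_gen R b \<ominus>\<^bsub>?T\<^esub> free_gen R c)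
        = free_gen R (graft a b) \<ominus>\<^bsub>?T\<^esub> free_gen R (graft a c)"
      using linear_map.map_minus[OF l gen gen] by (simp add: tree_vee_gen)
    show "(free_gen R b \<ominus>\<^bsub>?T\<^esub> free_gen R c) \<otimes>\<^bsub>?T\<^esub> free_gen R a
        = free_gen R (graft b a) \<ominus>\<^bsub>?T\<^esub> free_gen R (graft c a)"
      using linear_map.map_minus[OF r gen gen] by (simp add: tree_vee_gen)
  qed
  have E: "?E \<subseteq> carrier ?T"
    using gen by (auto simp del: tree_space_simps)
  have ideal_E: "two_sided_ideal R ?T (lin_span R ?T ?E)"
  proof (rule two_sided_ideal_lin_span[OF module_tree_space mult tree_space_span E])
    fix x e :: "wtree option \<Rightarrow> 'a"
    assume "x \<in> range (free_gen R)" "e \<in> ?E"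
    then obtain a b c where *: "x = free_gen R a" "e = free_gen R b \<ominus>\<^bsub>?T\<^esub> free_gen R c" "assoc_step b c"
      by auto
    have "x \<otimes>\<^bsub>?T\<^esub> e \<in> ?E" "e \<otimes>\<^bsub>?T\<^esub> x \<in> ?E"
      unfolding *(1,2) sub using assoc_step.graft_left[OF *(3)] assoc_step.graft_right[OF *(3)] by blast+
    then show "x \<otimes>\<^bsub>?T\<^esub> e \<in> lin_span R ?T ?E \<and> e \<otimes>\<^bsub>?T\<^esub> x \<in> lin_span R ?T ?E"
      using lin_span_superset[of ?E R ?T] by blast
  qed
  have rels_E: "{free_gen R (graft (graft b c) (basis_twist d)) \<ominus>\<^bsub>?T\<^esub>
      free_gen R (graft (basis_twist b) (graft c d)) | b c d. True} \<subseteq> ?E"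
    using assoc_step.assoc by blast
  show "tree_ideal R \<subseteq> lin_span R ?T ?E"
    unfolding tree_ideal_def
    by (rule generated_ideal_least[OF ideal_E order_trans[OF rels_E lin_span_superset]])
  have ideal: "two_sided_ideal R ?T (tree_ideal R)"
    unfolding tree_ideal_def
    by (rule two_sided_ideal_generated[OF module_tree_space mult])
      (use gen in \<open>auto simp del: tree_space_simps\<close>)
  have "free_gen R b \<ominus>\<^bsub>?T\<^esub> free_gen R c \<in> tree_ideal R" if "assoc_step b c" for b c
    using that
  proof (induction rule: assoc_step.induct)
    case (assoc b c d)
    show ?case
      unfolding tree_ideal_def by (rule subsetD[OF generated_ideal_superset]) blast
  next
    case (graft_left b c a)
    then show ?case
      using ideal gen[of a] unfolding sub(1)[symmetric] two_sided_ideal_def by blast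
  next
    case (graft_right b c a)
    then show ?case
      using ideal gen[of a] unfolding sub(2)[symmetric] two_sided_ideal_def by blast
  qed
  then show "lin_span R ?T ?E \<subseteq> tree_ideal R"
    using ideal unfolding two_sided_ideal_def by (intro lin_span_least) auto
qed

lemma tree_span_deg_support:
  assumes "u \<in> lin_span R (tree_space R) {free_gen R b | b. deg b = n}"
  shows "u \<in> carrier (free_module R UNIV) \<and> (\<forall>b. deg b \<noteq> n \<longrightarrow> u b = \<zero>)"
proof -
  let ?F = "free_module R (UNIV :: wtree option set)"
  interpret F: module R ?F
    by (rule module_free_module)
  have "submodule {u \<in> carrier ?F. \<forall>b. deg b \<noteq> n \<longrightarrow> u b = \<zero>} R ?F" (is "submodule ?H _ _")
  proof (rule F.submoduleI)
    show smult: "c \<odot>\<^bsub>?F\<^esub> u \<in> ?H" if "c \<in> carrier R" "u \<in> ?H" for c u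
      using that F.smult_closed[of c u] by (auto simp: free_module_simps(2-))
    show "\<ominus>\<^bsub>?F\<^esub> u \<in> ?H" if "u \<in> ?H" for u
      using smult[OF _ that, of "\<ominus> \<one>"] that by (simp add: F.smult_l_minus)
    show "u \<oplus>\<^bsub>?F\<^esub> w \<in> ?H" if "u \<in> ?H" "w \<in> ?H" for u w
      using that F.M.a_closed[of u w] by (auto simp: free_module_simps(2-))
    show "\<zero>\<^bsub>?F\<^esub> \<in> ?H"
      using F.M.zero_closed by (auto simp: free_module_simps(2-))
  qed auto
  moreover have "{free_gen R b | b. deg b = n} \<subseteq> ?H"
    using free_gen_closed[of _ "UNIV :: wtree option set"] by (auto simp: free_gen_def)
  ultimately show ?thesis
    using assms lin_span_least[of ?H R ?F] unfolding same_space_lin_span[OF same_space_tree_space] by blast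
qed

end

section \<open>Decorated trees and their universal property\<close>

lemma bilinear_map_smult:
  assumes f: "bilinear_map K V W N f" and "c \<in> carrier K" "d \<in> carrier K" "x \<in> carrier V" "y \<in> carrier W"
  shows "f (c \<odot>\<^bsub>V\<^esub> x) (d \<odot>\<^bsub>W\<^esub> y) = (c \<otimes>\<^bsub>K\<^esub> d) \<odot>\<^bsub>N\<^esub> f x y"
proof -
  interpret r: linear_map K W N "f x"
    using assms by (simp add: bilinear_map_def)
  have l: "linear_map K V N (\<lambda>x. f x (d \<odot>\<^bsub>W\<^esub> y))"
    using assms by (simp add: bilinear_map_def)
  have "f (c \<odot>\<^bsub>V\<^esub> x) (d \<odot>\<^bsub>W\<^esub> y) = c \<odot>\<^bsub>N\<^esub> f x (d \<odot>\<^bsub>W\<^esub> y)"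
    using linear_map.map_smult[OF l] assms by simp
  then show ?thesis
    using assms by (simp add: r.map_smult r.N.smult_assoc1 r.map_closed)
qed

definition tree_sign :: "('k, 'r) ring_scheme \<Rightarrow> wtree option \<Rightarrow> 'k" where
  "tree_sign K b = (\<ominus>\<^bsub>K\<^esub> \<one>\<^bsub>K\<^esub>) [^]\<^bsub>K\<^esub> deg b"

context cring
begin

lemma tree_sign_closed [simp]: "tree_sign R b \<in> carrier R"
  by (simp add: tree_sign_def)

lemma tree_sign_graft: "tree_sign R (graft b c) = tree_sign R b \<otimes> tree_sign R c"
  by (simp add: tree_sign_def nat_pow_mult)

lemma basis_antipode_eq:
  "basis_antipode R b = tree_sign R b \<odot>\<^bsub>tree_space R\<^esub> free_gen R (basis_mirror b)"
proof -
  interpret T: module R "tree_space R"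
    by (rule module_tree_space)
  note gen [simp] = tree_space_gen[unfolded tree_space_simps(1)]
  have "tree_antipode R t = tree_sign R (Some t) \<odot>\<^bsub>tree_space R\<^esub> free_gen R (Some (tree_mirror t))" for t
  proof (induction t)
    case (Leaf a)
    have "free_gen R (Some (Leaf a)) \<in> carrier (tree_space R)"
      by (rule tree_space_gen)
    then show ?case
      by (simp add: tree_sign_def T.smult_l_minus del: tree_space_simps)
  next
    case (Graft t u)
    have "tree_antipode R (Graft t u)
        = (tree_sign R (Some u) \<otimes> tree_sign R (Some t)) \<odot>\<^bsub>tree_space R\<^esub>
          tree_vee R (free_gen R (Some (tree_mirror u))) (free_gen R (Some (tree_mirror t)))"
      unfolding tree_antipode.simps Graft.IH tree_space_simps(5)
      by (rule bilinear_map_smult[OF bilinear_tree_vee]) (simp_all add: tree_space_gen del: tree_space_simps)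
    also have "tree_sign R (Some u) \<otimes> tree_sign R (Some t) = tree_sign R (Some (Graft t u))"
      using tree_sign_graft[of "Some t" "Some u"] by (simp add: m_comm)
    finally show ?case
      by (simp add: tree_vee_gen)
  qed
  moreover have "free_gen R None = \<one> \<odot>\<^bsub>tree_space R\<^esub> free_gen R None"
    using T.smult_one[OF tree_space_gen] by metis
  ultimately show ?thesis
    by (cases b) (auto simp: basis_antipode_def tree_sign_def simp del: tree_space_simps)
qed

lemma module_base_module: "module R (base_module R)"
proof (rule moduleI)
  show "abelian_group (base_module R)"
  proof (rule abelian_groupI)
    show "\<exists>y\<in>carrier (base_module R). y \<oplus>\<^bsub>base_module R\<^esub> x = \<zero>\<^bsub>base_module R\<^esub>"
      if "x \<in> carrier (base_module R)" for x
      using that l_neg[of x] a_inv_closed[of x] unfolding base_module_def by auto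
  qed (auto simp: base_module_def a_ac)
qed (auto simp: base_module_def l_distr r_distr m_assoc intro: is_cring)

end

text \<open>
  The entry that varies is singled out as \<open>as @ x # bs\<close> rather than as a list update, because this form
  is preserved when lists are concatenated, reversed or restricted to a set of positions.
\<close>

definition multilinear_map ::
  "('k, 'r) ring_scheme \<Rightarrow> ('k, 'g, 'm) module_scheme \<Rightarrow> ('k, 'w, 'n) module_scheme
    \<Rightarrow> (wtree option \<Rightarrow> 'g list \<Rightarrow> 'w) \<Rightarrow> bool" where
  "multilinear_map K G N v \<longleftrightarrow>
     (\<forall>b xs. (b, xs) \<in> decorated G \<longrightarrow> v b xs \<in> carrier N) \<and>
     (\<forall>b as bs. length as + Suc (length bs) = deg b \<longrightarrow> set as \<subseteq> carrier G \<longrightarrow> set bs \<subseteq> carrier G \<longrightarrow>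
        linear_map K G N (\<lambda>x. v b (as @ x # bs)))"

lemma multilinear_map_closed:
  "\<lbrakk>multilinear_map K G N v; (b, xs) \<in> decorated G\<rbrakk> \<Longrightarrow> v b xs \<in> carrier N"
  by (simp add: multilinear_map_def)

lemma multilinear_map_slot:
  "\<lbrakk>multilinear_map K G N v; length as + Suc (length bs) = deg b; set as \<subseteq> carrier G; set bs \<subseteq> carrier G\<rbrakk>
    \<Longrightarrow> linear_map K G N (\<lambda>x. v b (as @ x # bs))"
  by (simp add: multilinear_map_def)

lemma decorated_iff: "(b, xs) \<in> decorated G \<longleftrightarrow> length xs = deg b \<and> set xs \<subseteq> carrier G"
  by (simp add: decorated_def)

lemma decorated_update:
  "\<lbrakk>(b, xs) \<in> decorated G; x \<in> carrier G\<rbrakk> \<Longrightarrow> (b, xs[i := x]) \<in> decorated G"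
  by (simp add: decorated_iff set_update_subsetI)

lemma decorated_graft:
  "\<lbrakk>(b, xs) \<in> decorated G; (c, ys) \<in> decorated G\<rbrakk> \<Longrightarrow> (graft b c, xs @ ys) \<in> decorated G"
  by (simp add: decorated_iff)

lemma decorated_twist: "(b, xs) \<in> decorated G \<Longrightarrow> (basis_twist b, xs) \<in> decorated G"
  by (simp add: decorated_iff)

lemma decorated_mirror: "(b, xs) \<in> decorated G \<Longrightarrow> (basis_mirror b, rev xs) \<in> decorated G"
  by (simp add: decorated_iff)

lemma decorated_restrict:
  "(b, xs) \<in> decorated G \<Longrightarrow> (basis_restrict b I, nths xs I) \<in> decorated G"
  using set_nths_subset[of xs I] by (auto simp: decorated_iff length_nths deg_basis_restrict)

lemma decorated_None: "(None, []) \<in> decorated G"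
  by (simp add: decorated_iff)

lemma multilinear_map_update:
  assumes v: "multilinear_map K G N v" and xs: "(b, xs) \<in> decorated G" and i: "i < length xs"
  shows "linear_map K G N (\<lambda>x. v b (xs[i := x]))"
proof -
  have "linear_map K G N (\<lambda>x. v b (take i xs @ x # drop (Suc i) xs))"
    using xs i set_take_subset[of i xs] set_drop_subset[of "Suc i" xs]
    by (intro multilinear_map_slot[OF v]) (auto simp: decorated_iff)
  then show ?thesis
    using i by (simp add: upd_conv_take_nth_drop)
qed

locale decorated_trees = G: module K G
  for K :: "('k, 'r) ring_scheme" (structure) and G :: "('k, 'g, 'm) module_scheme" (structure)
begin

abbreviation T :: "('k, ('k, 'g) dtree_class) module" where "T \<equiv> dtree_module K G"
abbreviation \<tau> :: "wtree option \<Rightarrow> 'g list \<Rightarrow> ('k, 'g) dtree_class" where "\<tau> \<equiv> dtree K G"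
abbreviation symbols :: "('k, wtree option \<times> 'g list \<Rightarrow> 'k) module" where
  "symbols \<equiv> free_module K (decorated G)"

sublocale F: module K symbols
  by (rule G.R.module_free_module)

lemma multilinear_rels_closed: "multilinear_rels K G \<subseteq> carrier symbols"
  unfolding multilinear_rels_def Let_def
  by (auto intro!: F.M.minus_closed F.M.a_closed F.smult_closed G.R.free_gen_closed decorated_update)

lemma multilinear_null_submodule: "submodule (multilinear_null K G) K symbols"
  unfolding multilinear_null_def by (rule F.lin_span_submodule[OF multilinear_rels_closed])

lemma module_dtree_module: "module K T"
  unfolding dtree_module_def by (rule F.module_quotient[OF multilinear_null_submodule])

sublocale T: module K T
  by (rule module_dtree_module)

lemma
  assumes v: "multilinear_map K G N v" and N: "module K N"
  shows dtree_ext_linear: "linear_map K T N (quot_ext K N (\<lambda>(b, xs). v b xs))"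
    and dtree_ext_dtree: "(b, xs) \<in> decorated G \<Longrightarrow> quot_ext K N (\<lambda>(b, xs). v b xs) (\<tau> b xs) = v b xs"
proof -
  interpret N: module K N by fact
  let ?v = "\<lambda>(b, xs). v b xs"
  have vX: "?v \<in> decorated G \<rightarrow> carrier N"
    using multilinear_map_closed[OF v] by auto
  interpret E: linear_map K symbols N "free_ext K N ?v"
    by (rule N.free_ext_linear[OF vX])
  have gen: "free_ext K N ?v (free_gen K (b, xs)) = v b xs" if "(b, xs) \<in> decorated G" for b xs
    using N.free_ext_gen[of ?v "(b, xs)"] multilinear_map_closed[OF v that] by simp
  note slot = multilinear_map_update[OF v]
  have null: "free_ext K N ?v r = \<zero>\<^bsub>N\<^esub>" if r: "r \<in> multilinear_rels K G" for r
    using r linear_map.map_add[OF slot] linear_map.map_smult[OF slot] linear_map.map_closed[OF slot]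
    unfolding multilinear_rels_def Let_def
    by (auto simp: E.map_minus E.map_add E.map_smult gen G.R.free_gen_closed N.minus_self_iff
        decorated_update)
  show "linear_map K T N (quot_ext K N ?v)"
    unfolding dtree_module_def multilinear_null_def
    by (rule N.quot_ext_linear[OF multilinear_rels_closed vX null])
  show "quot_ext K N ?v (\<tau> b xs) = v b xs" if "(b, xs) \<in> decorated G"
    unfolding dtree_def multilinear_null_def
    using that by (subst N.quot_ext_gen[OF multilinear_rels_closed vX null]) auto
qed

lemma dtree_span: "lin_span K T {\<tau> b xs | b xs. (b, xs) \<in> decorated G} = carrier T"
proof -
  have "{\<tau> b xs | b xs. (b, xs) \<in> decorated G}
      = (\<lambda>u. multilinear_null K G +>\<^bsub>symbols\<^esub> u) ` free_gen K ` decorated G"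
    by (auto simp: dtree_def image_image)
  then show ?thesis
    using F.quotient_span[OF multilinear_null_submodule G.R.free_module_span]
    by (simp add: dtree_module_def)
qed

lemma dtree_closed: "(b, xs) \<in> decorated G \<Longrightarrow> \<tau> b xs \<in> carrier T"
  using lin_span_superset[of "{\<tau> b xs | b xs. (b, xs) \<in> decorated G}" K T] unfolding dtree_span by blast

lemma dtree_slot:
  assumes "length as + Suc (length bs) = deg b" "set as \<subseteq> carrier G" "set bs \<subseteq> carrier G"
  shows "linear_map K G T (\<lambda>x. \<tau> b (as @ x # bs))"
proof -
  interpret q: linear_map K symbols T "\<lambda>u. multilinear_null K G +>\<^bsub>symbols\<^esub> u"
    unfolding dtree_module_def by (rule F.quotient_map_linear[OF multilinear_null_submodule])
  have dec: "(b, as @ x # bs) \<in> decorated G" if "x \<in> carrier G" for x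
    using assms that by (simp add: decorated_iff)
  note [simp] = G.R.free_gen_closed[OF dec]
  have rel: "multilinear_null K G +>\<^bsub>symbols\<^esub> u = multilinear_null K G +>\<^bsub>symbols\<^esub> w"
    if "u \<ominus>\<^bsub>symbols\<^esub> w \<in> multilinear_rels K G" "u \<in> carrier symbols" "w \<in> carrier symbols" for u w
    using that(1) lin_span_superset[of "multilinear_rels K G" K symbols]
    by (subst F.coset_eq_iff[OF multilinear_null_submodule that(2,3)]) (auto simp: multilinear_null_def)
  have upd: "as @ y # bs = (as @ \<zero>\<^bsub>G\<^esub> # bs)[length as := y]" for y
    by simp
  have rels:
    "\<lbrakk>x \<in> carrier G; y \<in> carrier G\<rbrakk> \<Longrightarrow>
      free_gen K (b, as @ (x \<oplus>\<^bsub>G\<^esub> y) # bs) \<ominus>\<^bsub>symbols\<^esub>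
      (free_gen K (b, as @ x # bs) \<oplus>\<^bsub>symbols\<^esub> free_gen K (b, as @ y # bs)) \<in> multilinear_rels K G"
    "\<lbrakk>c \<in> carrier K; x \<in> carrier G\<rbrakk> \<Longrightarrow>
      free_gen K (b, as @ (c \<odot>\<^bsub>G\<^esub> x) # bs) \<ominus>\<^bsub>symbols\<^esub> c \<odot>\<^bsub>symbols\<^esub> free_gen K (b, as @ x # bs)
        \<in> multilinear_rels K G" for x y c
  proof -
    have i: "length as < length (as @ \<zero>\<^bsub>G\<^esub> # bs)"
      by simp
    show "free_gen K (b, as @ (x \<oplus>\<^bsub>G\<^esub> y) # bs) \<ominus>\<^bsub>symbols\<^esub>
      (free_gen K (b, as @ x # bs) \<oplus>\<^bsub>symbols\<^esub> free_gen K (b, as @ y # bs)) \<in> multilinear_rels K G"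
      if "x \<in> carrier G" "y \<in> carrier G"
      using dec[OF G.M.zero_closed] i that
      unfolding multilinear_rels_def Let_def upd[of x] upd[of y] upd[of "x \<oplus>\<^bsub>G\<^esub> y"] by blast
    show "free_gen K (b, as @ (c \<odot>\<^bsub>G\<^esub> x) # bs) \<ominus>\<^bsub>symbols\<^esub> c \<odot>\<^bsub>symbols\<^esub> free_gen K (b, as @ x # bs)
        \<in> multilinear_rels K G" if "c \<in> carrier K" "x \<in> carrier G"
      using dec[OF G.M.zero_closed] i that
      unfolding multilinear_rels_def Let_def upd[of x] upd[of "c \<odot>\<^bsub>G\<^esub> x"] by blast
  qed
  show ?thesis
  proof (rule linear_mapI[OF G.module_axioms module_dtree_module])
    fix x assume x: "x \<in> carrier G"
    show "\<tau> b (as @ x # bs) \<in> carrier T"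
      using dtree_closed dec x by blast
    show "\<tau> b (as @ (x \<oplus>\<^bsub>G\<^esub> y) # bs) = \<tau> b (as @ x # bs) \<oplus>\<^bsub>T\<^esub> \<tau> b (as @ y # bs)" if y: "y \<in> carrier G" for y
    proof -
      have "\<tau> b (as @ (x \<oplus>\<^bsub>G\<^esub> y) # bs) = multilinear_null K G +>\<^bsub>symbols\<^esub>
          (free_gen K (b, as @ x # bs) \<oplus>\<^bsub>symbols\<^esub> free_gen K (b, as @ y # bs))"
        unfolding dtree_def using x y by (intro rel rels) simp_all
      then show ?thesis
        using x y by (simp add: dtree_def q.map_add)
    qed
    show "\<tau> b (as @ (c \<odot>\<^bsub>G\<^esub> x) # bs) = c \<odot>\<^bsub>T\<^esub> \<tau> b (as @ x # bs)" if c: "c \<in> carrier K" for c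
    proof -
      have "\<tau> b (as @ (c \<odot>\<^bsub>G\<^esub> x) # bs)
          = multilinear_null K G +>\<^bsub>symbols\<^esub> (c \<odot>\<^bsub>symbols\<^esub> free_gen K (b, as @ x # bs))"
        unfolding dtree_def using x c by (intro rel rels) simp_all
      then show ?thesis
        using x c by (simp add: dtree_def q.map_smult)
    qed
  qed
qed

text \<open>
  At a tree whose number of leaves differs from the length of \<open>xs\<close>, the value of \<^const>\<open>dtree\<close> is the
  coset of something that is not a symbol, so \<^const>\<open>decorate\<close> is not meaningful on all of \<open>\<T>\<close>. On the
  span of the trees of the right degree it agrees with the linear map that kills all other trees.
\<close>

lemma decorate_homogeneous:
  assumes xs: "length xs = n" "set xs \<subseteq> carrier G"
    and u: "u \<in> lin_span K (tree_space K) {free_gen K b | b. deg b = n}"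
  shows "decorate K G u xs = free_ext K T (\<lambda>b. if deg b = n then \<tau> b xs else \<zero>\<^bsub>T\<^esub>) u"
proof -
  have supp: "u \<in> carrier (free_module K UNIV)" "\<And>b. deg b \<noteq> n \<Longrightarrow> u b = \<zero>\<^bsub>K\<^esub>"
    using G.R.tree_span_deg_support[OF u] by auto
  have "u b \<in> carrier K" for b
    using G.R.free_module_value[OF supp(1)] .
  moreover have "(if deg b = n then \<tau> b xs else \<zero>\<^bsub>T\<^esub>) \<in> carrier T" for b
    using xs by (simp add: dtree_closed decorated_iff)
  ultimately show ?thesis
    unfolding decorate_def free_ext_def using supp(2) by (intro T.M.finsum_cong') auto
qed

lemma
  assumes xs: "length xs = n" "set xs \<subseteq> carrier G"
  shows homogeneous_ext_linear:
      "linear_map K (tree_space K) T (free_ext K T (\<lambda>b. if deg b = n then \<tau> b xs else \<zero>\<^bsub>T\<^esub>))"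
    and homogeneous_ext_gen:
      "free_ext K T (\<lambda>b. if deg b = n then \<tau> b xs else \<zero>\<^bsub>T\<^esub>) (free_gen K b)
        = (if deg b = n then \<tau> b xs else \<zero>\<^bsub>T\<^esub>)"
proof -
  have c: "(if deg b = n then \<tau> b xs else \<zero>\<^bsub>T\<^esub>) \<in> carrier T" for b
    using xs by (simp add: dtree_closed decorated_iff)
  have "linear_map K (free_module K UNIV) T (free_ext K T (\<lambda>b. if deg b = n then \<tau> b xs else \<zero>\<^bsub>T\<^esub>))"
    using c by (intro T.free_ext_linear) blast
  then show "linear_map K (tree_space K) T (free_ext K T (\<lambda>b. if deg b = n then \<tau> b xs else \<zero>\<^bsub>T\<^esub>))"
    by (subst same_space_linear_map[OF G.R.same_space_tree_space, of T T]) (simp_all add: same_space_def)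
  show "free_ext K T (\<lambda>b. if deg b = n then \<tau> b xs else \<zero>\<^bsub>T\<^esub>) (free_gen K b)
        = (if deg b = n then \<tau> b xs else \<zero>\<^bsub>T\<^esub>)"
    using T.free_ext_gen[of "\<lambda>b. if deg b = n then \<tau> b xs else \<zero>\<^bsub>T\<^esub>" b] c by simp
qed

lemma tree_span_submodule: "submodule (lin_span K (tree_space K) {free_gen K b | b. deg b = n}) K (tree_space K)"
  by (rule module.lin_span_submodule[OF G.R.module_tree_space])
    (use G.R.tree_space_gen in \<open>auto simp del: G.R.tree_space_simps\<close>)

lemma decorate_basis_antipode:
  assumes xs: "(b, xs) \<in> decorated G"
  shows "decorate K G (basis_antipode K b) xs = tree_sign K b \<odot>\<^bsub>T\<^esub> \<tau> (basis_mirror b) xs"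
proof -
  interpret S: module K "tree_space K"
    by (rule G.R.module_tree_space)
  have xs': "length xs = deg b" "set xs \<subseteq> carrier G"
    using xs by (auto simp: decorated_iff)
  interpret P: linear_map K "tree_space K" T
      "free_ext K T (\<lambda>c. if deg c = deg b then \<tau> c xs else \<zero>\<^bsub>T\<^esub>)"
    by (rule homogeneous_ext_linear[OF xs'])
  have "free_gen K (basis_mirror b) \<in> lin_span K (tree_space K) {free_gen K c | c. deg c = deg b}"
    by (rule subsetD[OF lin_span_superset]) auto
  then have "basis_antipode K b \<in> lin_span K (tree_space K) {free_gen K c | c. deg c = deg b}"
    unfolding G.R.basis_antipode_eq by (rule S.submoduleE(4)[OF tree_span_submodule, rotated]) simp
  from decorate_homogeneous[OF xs' this] show ?thesis
    unfolding G.R.basis_antipode_eq P.map_smult[OF G.R.tree_sign_closed G.R.tree_space_gen]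
    by (simp add: homogeneous_ext_gen[OF xs'])
qed

text \<open>
  A homogeneous element of the tree ideal is a combination of differences along steps of all degrees, and
  the linear map that kills the other degrees discards the superfluous ones. Conversely, a nontrivial
  step has degree at least \<open>3\<close>.
\<close>

lemma dtree_ideal_eq:
  "dtree_ideal K G = lin_span K T {\<tau> b xs \<ominus>\<^bsub>T\<^esub> \<tau> c xs | b c xs. assoc_step b c \<and> (b, xs) \<in> decorated G}"
  (is "_ = lin_span K T ?E")
proof
  let ?S = "tree_space K"
  let ?D = "{decorate K G u xs | u xs n.
        n \<ge> 3 \<and> u \<in> tree_ideal_deg K n \<and> length xs = n \<and> set xs \<subseteq> carrier G}"
  interpret S: module K "tree_space K"
    by (rule G.R.module_tree_space)
  have E: "?E \<subseteq> carrier T"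
    using dtree_closed assoc_step_deg by (fastforce simp: decorated_iff)
  note HE = T.lin_span_submodule[OF E]
  have gens: "{free_gen K b \<ominus>\<^bsub>?S\<^esub> free_gen K c | b c. assoc_step b c} \<subseteq> carrier ?S"
    using G.R.tree_space_gen by (auto simp del: G.R.tree_space_simps)
  have D: "decorate K G u xs \<in> lin_span K T ?E"
    if u: "u \<in> tree_ideal_deg K n" and xs: "length xs = n" "set xs \<subseteq> carrier G" for u xs n
  proof -
    interpret P: linear_map K ?S T "free_ext K T (\<lambda>b. if deg b = n then \<tau> b xs else \<zero>\<^bsub>T\<^esub>)"
      by (rule homogeneous_ext_linear[OF xs])
    have gen: "free_ext K T (\<lambda>b. if deg b = n then \<tau> b xs else \<zero>\<^bsub>T\<^esub>) e \<in> lin_span K T ?E"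
      if "e \<in> {free_gen K b \<ominus>\<^bsub>?S\<^esub> free_gen K c | b c. assoc_step b c}" for e
    proof -
      obtain b c where e: "e = free_gen K b \<ominus>\<^bsub>?S\<^esub> free_gen K c" and bc: "assoc_step b c"
        using \<open>e \<in> _\<close> by auto
      have "free_ext K T (\<lambda>b. if deg b = n then \<tau> b xs else \<zero>\<^bsub>T\<^esub>) e
          = (if deg b = n then \<tau> b xs \<ominus>\<^bsub>T\<^esub> \<tau> c xs else \<zero>\<^bsub>T\<^esub>)"
        unfolding e P.map_minus[OF G.R.tree_space_gen G.R.tree_space_gen] homogeneous_ext_gen[OF xs]
        using assoc_step_deg[OF bc] by (simp add: T.minus_self_iff)
      moreover have "\<tau> b xs \<ominus>\<^bsub>T\<^esub> \<tau> c xs \<in> ?E" if "deg b = n"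
      proof -
        have "(b, xs) \<in> decorated G"
          using xs that by (simp add: decorated_iff)
        then show ?thesis
          using bc by blast
      qed
      ultimately show ?thesis
        using lin_span_superset[of ?E K T] T.submodule_zero[OF HE] by auto
    qed
    have "u \<in> lin_span K ?S {free_gen K b \<ominus>\<^bsub>?S\<^esub> free_gen K c | b c. assoc_step b c}"
      using u unfolding tree_ideal_deg_def G.R.tree_ideal_eq by blast
    from P.map_lin_span[OF gens HE gen this] show ?thesis
      using u decorate_homogeneous[OF xs, of u] unfolding tree_ideal_deg_def by auto
  qed
  have DE: "?D \<subseteq> lin_span K T ?E"
    using D by blast
  then show "dtree_ideal K G \<subseteq> lin_span K T ?E"
    unfolding dtree_ideal_def by (rule lin_span_least[OF HE])
  have DT: "?D \<subseteq> carrier T"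
    using DE T.submoduleE(1)[OF HE] by blast
  have HD: "submodule (dtree_ideal K G) K T"
    unfolding dtree_ideal_def by (rule T.lin_span_submodule[OF DT])
  have "\<tau> b xs \<ominus>\<^bsub>T\<^esub> \<tau> c xs \<in> dtree_ideal K G" if bc: "assoc_step b c" and xs: "(b, xs) \<in> decorated G" for b c xs
  proof (cases "b = c")
    case True
    then show ?thesis
      using xs T.submodule_zero[OF HD] T.minus_self_iff[OF dtree_closed dtree_closed] by metis
  next
    case False
    let ?u = "free_gen K b \<ominus>\<^bsub>?S\<^esub> free_gen K c" and ?n = "deg b"
    have xs': "length xs = ?n" "set xs \<subseteq> carrier G"
      using xs by (auto simp: decorated_iff)
    interpret P: linear_map K ?S T "free_ext K T (\<lambda>b. if deg b = ?n then \<tau> b xs else \<zero>\<^bsub>T\<^esub>)"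
      by (rule homogeneous_ext_linear[OF xs'])
    have "free_gen K a \<in> lin_span K ?S {free_gen K b | b. deg b = ?n}" if "a = b \<or> a = c" for a
      by (rule subsetD[OF lin_span_superset]) (use that assoc_step_deg[OF bc] in auto)
    then have span: "?u \<in> lin_span K ?S {free_gen K b | b. deg b = ?n}"
      by (intro S.submodule_minus[OF tree_span_submodule]) auto
    have "?u \<in> tree_ideal K"
      unfolding G.R.tree_ideal_eq by (rule subsetD[OF lin_span_superset]) (use bc in blast)
    then have "?u \<in> tree_ideal_deg K ?n"
      using span by (simp add: tree_ideal_deg_def)
    moreover have "?n \<ge> 3"
      using assoc_step_deg_ge_3[OF bc] False by simp
    ultimately have "decorate K G ?u xs \<in> ?D"
      using xs' by blast
    then have "decorate K G ?u xs \<in> dtree_ideal K G"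
      unfolding dtree_ideal_def by (rule subsetD[OF lin_span_superset])
    moreover have "decorate K G ?u xs = \<tau> b xs \<ominus>\<^bsub>T\<^esub> \<tau> c xs"
      unfolding decorate_homogeneous[OF xs' span] P.map_minus[OF G.R.tree_space_gen G.R.tree_space_gen]
        homogeneous_ext_gen[OF xs']
      using assoc_step_deg[OF bc] by simp
    ultimately show ?thesis
      by simp
  qed
  then show "lin_span K T ?E \<subseteq> dtree_ideal K G"
    by (intro lin_span_least[OF HD]) blast
qed

end

section \<open>Hom-Hopf data spanned by decorated trees\<close>

text \<open>
  What is common to the space of decorated trees and to its quotients by Hom-Hopf ideals: \<open>\<kappa> b xs\<close> is
  the class of a decorated tree. The \<open>\<kappa> b xs\<close> may be linearly dependent, but as they span, a linear
  map is determined by its values on them.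
\<close>

locale tree_hopf = module K A
  for K :: "('k, 'r) ring_scheme" (structure) and A :: "('k, 'v, 'm) hom_hopf_scheme" (structure) +
  fixes G :: "('k, 'g, 'n) module_scheme" and \<kappa> :: "wtree option \<Rightarrow> 'g list \<Rightarrow> 'v"
  assumes kappa_closed: "(b, xs) \<in> decorated G \<Longrightarrow> \<kappa> b xs \<in> carrier A"
    and kappa_span: "lin_span K A {\<kappa> b xs | b xs. (b, xs) \<in> decorated G} = carrier A"
    and mult_bilinear: "bilinear_map K A A A (mult A)"
    and mult_kappa: "\<lbrakk>(b, xs) \<in> decorated G; (c, ys) \<in> decorated G\<rbrakk> \<Longrightarrow>
      \<kappa> b xs \<otimes>\<^bsub>A\<^esub> \<kappa> c ys = \<kappa> (graft b c) (xs @ ys)"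
    and one_kappa: "\<one>\<^bsub>A\<^esub> = \<kappa> None []"
    and twist_linear: "linear_map K A A (twist A)"
    and twist_kappa: "(b, xs) \<in> decorated G \<Longrightarrow> twist A (\<kappa> b xs) = \<kappa> (basis_twist b) xs"
    and comult_linear: "linear_map K A (tensor_module K A A) (comult A)"
    and comult_kappa: "(b, xs) \<in> decorated G \<Longrightarrow> comult A (\<kappa> b xs) =
      (\<Oplus>\<^bsub>tensor_module K A A\<^esub>I\<in>Pow {..<deg b}.
         tensor K A A (\<kappa> (basis_restrict b I) (nths xs I))
           (\<kappa> (basis_restrict b ({..<deg b} - I)) (nths xs ({..<deg b} - I))))"
    and counit_linear: "linear_map K A (base_module K) (counit A)"
    and counit_kappa: "(b, xs) \<in> decorated G \<Longrightarrow> counit A (\<kappa> b xs) = (if b = None then \<one>\<^bsub>K\<^esub> else \<zero>\<^bsub>K\<^esub>)"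
    and antipode_linear: "linear_map K A A (antipode A)"
    and antipode_kappa: "(b, xs) \<in> decorated G \<Longrightarrow>
      antipode A (\<kappa> b xs) = tree_sign K b \<odot>\<^bsub>A\<^esub> \<kappa> (basis_mirror b) (rev xs)"

context decorated_trees
begin

text \<open>The inner one of the two linear extensions that make up the product of decorated trees.\<close>

definition graft_on :: "wtree option \<Rightarrow> 'g list \<Rightarrow> ('k, 'g) dtree_class \<Rightarrow> ('k, 'g) dtree_class" where
  "graft_on b xs = quot_ext K T (\<lambda>(c, ys). \<tau> (graft b c) (xs @ ys))"

lemma
  assumes xs: "(b, xs) \<in> decorated G"
  shows graft_on_linear: "linear_map K T T (graft_on b xs)"
    and graft_on_dtree: "(c, ys) \<in> decorated G \<Longrightarrow> graft_on b xs (\<tau> c ys) = \<tau> (graft b c) (xs @ ys)"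
proof -
  have m: "multilinear_map K G T (\<lambda>c ys. \<tau> (graft b c) (xs @ ys))"
    unfolding multilinear_map_def
  proof (intro conjI allI impI)
    show "\<tau> (graft b c) (xs @ ys) \<in> carrier T" if "(c, ys) \<in> decorated G" for c ys
      using dtree_closed decorated_graft[OF xs that] .
    show "linear_map K G T (\<lambda>x. \<tau> (graft b c) (xs @ as @ x # bs))"
      if "length as + Suc (length bs) = deg c" "set as \<subseteq> carrier G" "set bs \<subseteq> carrier G" for c as bs
      using dtree_slot[of "xs @ as" bs "graft b c"] that xs by (simp add: decorated_iff)
  qed
  show "linear_map K T T (graft_on b xs)"
    unfolding graft_on_def by (rule dtree_ext_linear[OF m module_dtree_module])
  show "graft_on b xs (\<tau> c ys) = \<tau> (graft b c) (xs @ ys)" if "(c, ys) \<in> decorated G"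
    unfolding graft_on_def by (rule dtree_ext_dtree[OF m module_dtree_module that])
qed

lemma multilinear_graft_on:
  assumes w: "w \<in> carrier T"
  shows "multilinear_map K G T (\<lambda>b xs. graft_on b xs w)"
  unfolding multilinear_map_def
proof (intro conjI allI impI)
  show "graft_on b xs w \<in> carrier T" if "(b, xs) \<in> decorated G" for b xs
    using linear_map.map_closed[OF graft_on_linear[OF that] w] .
  fix b and as bs :: "'g list"
  assume as: "length as + Suc (length bs) = deg b" "set as \<subseteq> carrier G" "set bs \<subseteq> carrier G"
  have dec: "(b, as @ x # bs) \<in> decorated G" if "x \<in> carrier G" for x
    using as that by (simp add: decorated_iff)
  have "bilinear_map K T G T (\<lambda>w x. graft_on b (as @ x # bs) w)"
  proof (rule bilinear_map_from_span[OF module_dtree_module G.module_axioms module_dtree_module _ _ dtree_span])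
    show "linear_map K T T (graft_on b (as @ x # bs))" if "x \<in> carrier G" for x
      by (rule graft_on_linear[OF dec[OF that]])
    show "linear_map K G T (\<lambda>x. graft_on b (as @ x # bs) w)"
      if w: "w \<in> {\<tau> b xs | b xs. (b, xs) \<in> decorated G}" for w
    proof -
      obtain c ys where w: "w = \<tau> c ys" and ys: "(c, ys) \<in> decorated G"
        using w by auto
      have "linear_map K G T (\<lambda>x. \<tau> (graft b c) (as @ x # (bs @ ys)))"
        using as ys by (intro dtree_slot) (auto simp: decorated_iff)
      then show ?thesis
        by (rule linear_map_cong) (simp add: w graft_on_dtree[OF dec ys])
    qed
  qed
  then show "linear_map K G T (\<lambda>x. graft_on b (as @ x # bs) w)"
    using w by (simp add: bilinear_map_def)
qed

abbreviation H :: "('k, ('k, 'g) dtree_class) hom_hopf" where "H \<equiv> dtree_hopf K G"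

lemma mult_dtree_hopf: "mult H u w = quot_ext K T (\<lambda>(b, xs). graft_on b xs w) u"
  by (simp add: dtree_hopf_def Let_def graft_on_def)

lemma same_space_dtree_hopf: "same_space H T"
  by (simp add: same_space_def dtree_hopf_def Let_def)

lemma module_dtree_hopf: "module K H"
  using same_space_module[OF same_space_dtree_hopf] module_dtree_module by blast

lemma linear_dtree_hopf: "linear_map K T T f \<Longrightarrow> linear_map K H H f"
  using same_space_linear_map[OF same_space_dtree_hopf same_space_dtree_hopf] by blast

lemma mult_dtree_hopf_dtree:
  assumes xs: "(b, xs) \<in> decorated G" and w: "w \<in> carrier T"
  shows "\<tau> b xs \<otimes>\<^bsub>H\<^esub> w = graft_on b xs w"
  unfolding mult_dtree_hopf by (rule dtree_ext_dtree[OF multilinear_graft_on[OF w] module_dtree_module xs])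

lemma bilinear_dtree_hopf_mult: "bilinear_map K T T T (mult H)"
proof (rule bilinear_map_from_span[OF module_dtree_module module_dtree_module module_dtree_module _ _ dtree_span])
  show "linear_map K T T (\<lambda>u. u \<otimes>\<^bsub>H\<^esub> w)" if "w \<in> carrier T" for w
    unfolding mult_dtree_hopf by (rule dtree_ext_linear[OF multilinear_graft_on[OF that] module_dtree_module])
  show "linear_map K T T (mult H u)" if u: "u \<in> {\<tau> b xs | b xs. (b, xs) \<in> decorated G}" for u
  proof -
    obtain b xs where u: "u = \<tau> b xs" and xs: "(b, xs) \<in> decorated G"
      using u by auto
    show ?thesis
      unfolding u by (rule linear_map_cong[OF graft_on_linear[OF xs]]) (rule mult_dtree_hopf_dtree[OF xs])
  qed
qed

lemma multilinear_twist: "multilinear_map K G T (\<lambda>b xs. \<tau> (basis_twist b) xs)"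
  unfolding multilinear_map_def by (auto intro!: dtree_closed decorated_twist dtree_slot)

lemma multilinear_counit:
  "multilinear_map K G (base_module K) (\<lambda>b xs. if b = None then \<one>\<^bsub>K\<^esub> else \<zero>\<^bsub>K\<^esub>)"
  unfolding multilinear_map_def
proof (intro conjI allI impI)
  fix b and as bs :: "'g list"
  assume "length as + Suc (length bs) = deg b"
  then have "b \<noteq> None"
    by (cases b) auto
  then show "linear_map K G (base_module K) (\<lambda>x. if b = None then \<one>\<^bsub>K\<^esub> else \<zero>\<^bsub>K\<^esub>)"
    using linear_map_zero[OF G.module_axioms G.R.module_base_module] by (auto simp: base_module_def)
qed (simp add: base_module_def)

lemma multilinear_antipode: "multilinear_map K G T (\<lambda>b xs. decorate K G (basis_antipode K b) (rev xs))"
  unfolding multilinear_map_def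
proof (intro conjI allI impI)
  have eq: "decorate K G (basis_antipode K b) (rev xs) = tree_sign K b \<odot>\<^bsub>T\<^esub> \<tau> (basis_mirror b) (rev xs)"
    if "(b, xs) \<in> decorated G" for b xs
    using that by (intro decorate_basis_antipode) (simp add: decorated_iff)
  show "decorate K G (basis_antipode K b) (rev xs) \<in> carrier T" if xs: "(b, xs) \<in> decorated G" for b xs
    unfolding eq[OF xs] using dtree_closed[OF decorated_mirror[OF xs]] by simp
  fix b and as bs :: "'g list"
  assume as: "length as + Suc (length bs) = deg b" "set as \<subseteq> carrier G" "set bs \<subseteq> carrier G"
  have "linear_map K G T (\<lambda>x. tree_sign K b \<odot>\<^bsub>T\<^esub> \<tau> (basis_mirror b) (rev bs @ x # rev as))"
    using as by (intro linear_map_smult dtree_slot) auto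
  then show "linear_map K G T (\<lambda>x. decorate K G (basis_antipode K b) (rev (as @ x # bs)))"
    by (rule linear_map_cong) (subst eq, use as in \<open>simp_all add: decorated_iff\<close>)
qed

lemma nths_slot:
  "nths (as @ x # bs) I
     = nths as I @ (if length as \<in> I then [x] else []) @ nths bs {i. i + Suc (length as) \<in> I}"
  by (simp add: nths_append nths_Cons)

lemma restrict_slot_linear:
  assumes as: "length as + Suc (length bs) = deg b" "set as \<subseteq> carrier G" "set bs \<subseteq> carrier G"
    and I: "length as \<in> I"
  shows "linear_map K G T (\<lambda>x. \<tau> (basis_restrict b I) (nths (as @ x # bs) I))"
proof -
  let ?bs = "nths bs {i. i + Suc (length as) \<in> I}"
  have "length (nths (as @ \<zero>\<^bsub>G\<^esub> # bs) I) = deg (basis_restrict b I)"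
    using as by (simp add: length_nths deg_basis_restrict)
  then have "length (nths as I) + Suc (length ?bs) = deg (basis_restrict b I)"
    using I by (simp add: nths_slot)
  moreover have "set (nths as I) \<subseteq> carrier G" "set ?bs \<subseteq> carrier G"
    using as set_nths_subset by fast+
  ultimately show ?thesis
    using I by (simp add: nths_slot dtree_slot)
qed

lemma multilinear_comult:
  "multilinear_map K G (tensor_module K T T) (\<lambda>b xs.
     \<Oplus>\<^bsub>tensor_module K T T\<^esub>I\<in>Pow {..<deg b}.
       tensor K T T (\<tau> (basis_restrict b I) (nths xs I))
         (\<tau> (basis_restrict b ({..<deg b} - I)) (nths xs ({..<deg b} - I))))"
  unfolding multilinear_map_def
proof (intro conjI allI impI)
  interpret TT: two_modules K T T ..
  interpret TT: module K "tensor_module K T T"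
    by (rule TT.module_tensor)
  show "(\<Oplus>\<^bsub>tensor_module K T T\<^esub>I\<in>Pow {..<deg b}.
       tensor K T T (\<tau> (basis_restrict b I) (nths xs I))
         (\<tau> (basis_restrict b ({..<deg b} - I)) (nths xs ({..<deg b} - I)))) \<in> carrier (tensor_module K T T)"
    if xs: "(b, xs) \<in> decorated G" for b xs
    using TT.tensor_closed[OF dtree_closed[OF decorated_restrict[OF xs]] dtree_closed[OF decorated_restrict[OF xs]]]
    by (intro TT.M.finsum_closed) simp
  fix b and as bs :: "'g list"
  assume as: "length as + Suc (length bs) = deg b" "set as \<subseteq> carrier G" "set bs \<subseteq> carrier G"
  have dec: "(b, as @ x # bs) \<in> decorated G" if "x \<in> carrier G" for x
    using as that by (simp add: decorated_iff)
  show "linear_map K G (tensor_module K T T) (\<lambda>x. \<Oplus>\<^bsub>tensor_module K T T\<^esub>I\<in>Pow {..<deg b}.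
       tensor K T T (\<tau> (basis_restrict b I) (nths (as @ x # bs) I))
         (\<tau> (basis_restrict b ({..<deg b} - I)) (nths (as @ x # bs) ({..<deg b} - I))))"
  proof (rule linear_map_finsum[OF _ G.module_axioms TT.module_tensor])
    fix I assume "I \<in> Pow {..<deg b}"
    let ?J = "{..<deg b} - I" and ?r = "\<lambda>I x. \<tau> (basis_restrict b I) (nths (as @ x # bs) I)"
    have r: "?r I' x \<in> carrier T" if "x \<in> carrier G" for I' x
      by (rule dtree_closed[OF decorated_restrict[OF dec[OF that]]])
    \<comment> \<open>The entry \<open>x\<close> survives in exactly one of the two tensor factors; the other one does not see it.\<close>
    have const: "?r I' x = ?r I' \<zero>\<^bsub>G\<^esub>" if "length as \<notin> I'" for I' x
      using that by (simp add: nths_slot)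
    show "linear_map K G (tensor_module K T T) (\<lambda>x. tensor K T T (?r I x) (?r ?J x))"
    proof (cases "length as \<in> I")
      case True
      then have "linear_map K G (tensor_module K T T) (\<lambda>x. tensor K T T (?r I x) (?r ?J \<zero>\<^bsub>G\<^esub>))"
        by (intro linear_map_comp[OF restrict_slot_linear[OF as] TT.tensor_linear_left] r) auto
      then show ?thesis
        by (rule linear_map_cong) (rule arg_cong2[where f = "tensor K T T", OF refl const], use True in simp)
    next
      case False
      then have "linear_map K G (tensor_module K T T) (\<lambda>x. tensor K T T (?r I \<zero>\<^bsub>G\<^esub>) (?r ?J x))"
        using as by (intro linear_map_comp[OF restrict_slot_linear[OF as] TT.tensor_linear_right] r) auto
      then show ?thesis
        by (rule linear_map_cong) (rule arg_cong2[where f = "tensor K T T", OF const[OF False] refl])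
    qed
  qed simp
qed

theorem tree_hopf_dtree_hopf: "tree_hopf K H G \<tau>"
proof -
  note S = same_space_dtree_hopf
  have TT: "tensor_module K H H = tensor_module K T T" "tensor K H H = tensor K T T"
    by (rule same_space_tensor_module[OF S S], rule same_space_tensor[OF S S])
  have refl: "same_space N N" for N :: "('k, 'x, 'y) module_scheme"
    by (simp add: same_space_def)
  interpret TT: two_modules K T T ..
  have car: "carrier H = carrier T"
    using S by (simp add: same_space_def)
  note fields = dtree_hopf_def Let_def
  note into = same_space_linear_map[OF S refl]
  show ?thesis
  proof (intro tree_hopf.intro tree_hopf_axioms.intro module_dtree_hopf, goal_cases)
    case (1 b xs)
    then show ?case
      by (simp add: car dtree_closed)
  next
    case 2
    then show ?case
      by (simp add: same_space_lin_span[OF S] dtree_span car)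
  next
    case 3
    then show ?case
      using same_space_bilinear_map[OF S S S] bilinear_dtree_hopf_mult by blast
  next
    case (4 b xs c ys)
    then show ?case
      by (simp add: mult_dtree_hopf_dtree graft_on_dtree dtree_closed)
  next
    case 5
    then show ?case
      by (simp add: fields)
  next
    case 6
    have "linear_map K T T (twist H)"
      using dtree_ext_linear[OF multilinear_twist module_dtree_module] by (simp add: fields)
    then show ?case
      by (rule linear_dtree_hopf)
  next
    case (7 b xs)
    then show ?case
      using dtree_ext_dtree[OF multilinear_twist module_dtree_module] by (simp add: fields)
  next
    case 8
    have "linear_map K T (tensor_module K T T) (comult H)"
      using dtree_ext_linear[OF multilinear_comult TT.module_tensor] by (simp add: fields)
    then show ?case
      unfolding TT into .
  next
    case (9 b xs)
    then show ?case
      unfolding TT using dtree_ext_dtree[OF multilinear_comult TT.module_tensor] by (simp add: fields)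
  next
    case 10
    have "linear_map K T (base_module K) (counit H)"
      using dtree_ext_linear[OF multilinear_counit G.R.module_base_module] by (simp add: fields)
    then show ?case
      unfolding into .
  next
    case (11 b xs)
    then show ?case
      using dtree_ext_dtree[OF multilinear_counit G.R.module_base_module] by (simp add: fields)
  next
    case 12
    have "linear_map K T T (antipode H)"
      using dtree_ext_linear[OF multilinear_antipode module_dtree_module] by (simp add: fields)
    then show ?case
      by (rule linear_dtree_hopf)
  next
    case (13 b xs)
    have "decorate K G (basis_antipode K b) (rev xs) = tree_sign K b \<odot>\<^bsub>T\<^esub> \<tau> (basis_mirror b) (rev xs)"
      using 13 by (intro decorate_basis_antipode) (simp add: decorated_iff)
    then show ?case
      using dtree_ext_dtree[OF multilinear_antipode module_dtree_module 13] by (simp add: fields)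
  qed
qed

end

section \<open>Multiplicativity of the structure maps\<close>

text \<open>
  A set of leaves of a grafted tree consists of leaves of the left tree, which has \<open>m\<close> leaves, and of
  leaves of the right tree, whose numbers are shifted by \<open>m\<close>.
\<close>

definition join_at :: "nat \<Rightarrow> nat set \<Rightarrow> nat set \<Rightarrow> nat set" where
  "join_at m I I' = I \<union> (\<lambda>i. i + m) ` I'"

lemma join_at_high: "I \<subseteq> {..<m} \<Longrightarrow> {i. i + m \<in> join_at m I I'} = I'"
  by (auto simp: join_at_def)

lemma join_at_low: "I \<subseteq> {..<m} \<Longrightarrow> join_at m I I' \<inter> {..<m} = I"
  by (auto simp: join_at_def)

lemma join_at_complement:
  assumes "I \<subseteq> {..<m}" "I' \<subseteq> {..<n}"
  shows "{..<m + n} - join_at m I I' = join_at m ({..<m} - I) ({..<n} - I')"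
proof (intro equalityI subsetI)
  fix i assume i: "i \<in> {..<m + n} - join_at m I I'"
  show "i \<in> join_at m ({..<m} - I) ({..<n} - I')"
  proof (cases "i < m")
    case False
    then have e: "i = (i - m) + m"
      by simp
    have "i - m \<notin> I'"
      using i e unfolding join_at_def by blast
    then have "i - m \<in> {..<n} - I'"
      using i False by auto
    with e show ?thesis
      unfolding join_at_def by blast
  qed (use i in \<open>auto simp: join_at_def\<close>)
qed (use assms in \<open>auto simp: join_at_def\<close>)

lemma join_at_Pow:
  "(\<lambda>p. join_at m (fst p) (snd p)) ` (Pow {..<m} \<times> Pow {..<n}) = Pow {..<m + n}"
proof (intro equalityI subsetI)
  fix I :: "nat set" assume I: "I \<in> Pow {..<m + n}"
  have "I = join_at m (I \<inter> {..<m}) {i. i + m \<in> I}"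
  proof (intro equalityI subsetI)
    fix i assume i: "i \<in> I"
    show "i \<in> join_at m (I \<inter> {..<m}) {i. i + m \<in> I}"
    proof (cases "i < m")
      case False
      then have "i - m \<in> {i. i + m \<in> I}" "i = (i - m) + m"
        using i by auto
      then show ?thesis
        unfolding join_at_def by blast
    qed (use i in \<open>auto simp: join_at_def\<close>)
  qed (auto simp: join_at_def)
  then show "I \<in> (\<lambda>p. join_at m (fst p) (snd p)) ` (Pow {..<m} \<times> Pow {..<n})"
    using I by (intro image_eqI[of _ _ "(I \<inter> {..<m}, {i. i + m \<in> I})"]) auto
qed (auto simp: join_at_def)

lemma join_at_inj: "inj_on (\<lambda>p. join_at m (fst p) (snd p)) (Pow {..<m} \<times> Pow {..<n})"
proof (rule inj_onI)
  fix p p' assume *: "p \<in> Pow {..<m} \<times> Pow {..<n}" "p' \<in> Pow {..<m} \<times> Pow {..<n}"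
    "join_at m (fst p) (snd p) = join_at m (fst p') (snd p')"
  have "fst p \<subseteq> {..<m}" "fst p' \<subseteq> {..<m}"
    using * by auto
  from join_at_low[OF this(1)] join_at_low[OF this(2)] join_at_high[OF this(1)] join_at_high[OF this(2)]
  show "p = p'"
    using *(3) by (metis prod.expand)
qed

context tree_hopf
begin

abbreviation AA :: "('k, ('v \<times> 'v \<Rightarrow> 'k) set) module" where "AA \<equiv> tensor_module K A A"
abbreviation part :: "wtree option \<Rightarrow> 'g list \<Rightarrow> nat set \<Rightarrow> 'v" where
  "part b xs I \<equiv> \<kappa> (basis_restrict b I) (nths xs I)"

sublocale AA: two_modules K A A ..

sublocale AA: module K AA
  by (rule AA.module_tensor)

lemma mult_linear_left: "y \<in> carrier A \<Longrightarrow> linear_map K A A (\<lambda>x. x \<otimes>\<^bsub>A\<^esub> y)"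
  and mult_linear_right: "x \<in> carrier A \<Longrightarrow> linear_map K A A (\<lambda>y. x \<otimes>\<^bsub>A\<^esub> y)"
  using mult_bilinear by (simp_all add: bilinear_map_def)

lemma mult_closed: "\<lbrakk>x \<in> carrier A; y \<in> carrier A\<rbrakk> \<Longrightarrow> x \<otimes>\<^bsub>A\<^esub> y \<in> carrier A"
  using bilinear_mult_closed[OF mult_bilinear] .

lemma one_closed: "\<one>\<^bsub>A\<^esub> \<in> carrier A"
  by (simp add: one_kappa kappa_closed decorated_None)

lemma part_closed: "(b, xs) \<in> decorated G \<Longrightarrow> part b xs I \<in> carrier A"
  by (simp add: kappa_closed decorated_restrict)

lemma linear_eq_on_kappa:
  assumes "linear_map K A N f" "linear_map K A N g"
    and "\<And>b xs. (b, xs) \<in> decorated G \<Longrightarrow> f (\<kappa> b xs) = g (\<kappa> b xs)" and "x \<in> carrier A"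
  shows "f x = g x"
  by (rule linear_map_eqI[OF assms(1,2) kappa_span _ assms(4)]) (use assms(3) in auto)

text \<open>Because of this, two-sided ideals are automatically stable under the twist.\<close>

lemma twist_eq_one_mult: "x \<in> carrier A \<Longrightarrow> twist A x = \<one>\<^bsub>A\<^esub> \<otimes>\<^bsub>A\<^esub> x"
  by (rule linear_eq_on_kappa[OF twist_linear mult_linear_right[OF one_closed]])
    (simp_all add: twist_kappa one_kappa mult_kappa decorated_None)

lemma antipode_mult:
  assumes "x \<in> carrier A" "y \<in> carrier A"
  shows "antipode A (x \<otimes>\<^bsub>A\<^esub> y) = antipode A y \<otimes>\<^bsub>A\<^esub> antipode A x"
proof (rule bilinear_map_eqI[OF _ _ kappa_span kappa_span _ assms])
  note S = linear_map.map_closed[OF antipode_linear]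
  show "bilinear_map K A A A (\<lambda>x y. antipode A (x \<otimes>\<^bsub>A\<^esub> y))"
    unfolding bilinear_map_def
    by (intro conjI ballI linear_map_comp[OF mult_linear_left antipode_linear]
        linear_map_comp[OF mult_linear_right antipode_linear])
  show "bilinear_map K A A A (\<lambda>x y. antipode A y \<otimes>\<^bsub>A\<^esub> antipode A x)"
    unfolding bilinear_map_def
    by (intro conjI ballI linear_map_comp[OF antipode_linear mult_linear_left]
        linear_map_comp[OF antipode_linear mult_linear_right] S)
  fix x y assume "x \<in> {\<kappa> b xs | b xs. (b, xs) \<in> decorated G}" "y \<in> {\<kappa> b xs | b xs. (b, xs) \<in> decorated G}"
  then obtain b xs c ys where *: "x = \<kappa> b xs" "y = \<kappa> c ys" and d: "(b, xs) \<in> decorated G" "(c, ys) \<in> decorated G"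
    by auto
  have "antipode A (x \<otimes>\<^bsub>A\<^esub> y) = (tree_sign K b \<otimes>\<^bsub>K\<^esub> tree_sign K c) \<odot>\<^bsub>A\<^esub>
      \<kappa> (graft (basis_mirror c) (basis_mirror b)) (rev ys @ rev xs)"
    using d by (simp add: * mult_kappa antipode_kappa decorated_graft R.tree_sign_graft basis_mirror_graft)
  also have "\<dots> = antipode A y \<otimes>\<^bsub>A\<^esub> antipode A x"
    using d by (simp add: * antipode_kappa bilinear_map_smult[OF mult_bilinear] kappa_closed decorated_mirror
        mult_kappa[OF decorated_mirror decorated_mirror] R.m_comm)
  finally show "antipode A (x \<otimes>\<^bsub>A\<^esub> y) = antipode A y \<otimes>\<^bsub>A\<^esub> antipode A x" .
qed

lemma counit_mult_zero:
  assumes b: "(b, xs) \<in> decorated G" and x: "x \<in> carrier A" "counit A x = \<zero>\<^bsub>K\<^esub>"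
  shows "counit A (\<kappa> b xs \<otimes>\<^bsub>A\<^esub> x) = \<zero>\<^bsub>K\<^esub>" "counit A (x \<otimes>\<^bsub>A\<^esub> \<kappa> b xs) = \<zero>\<^bsub>K\<^esub>"
proof -
  let ?e = "if b = None then \<one>\<^bsub>K\<^esub> else \<zero>\<^bsub>K\<^esub>"
  note k = kappa_closed[OF b]
  have e: "linear_map K A (base_module K) (\<lambda>x. ?e \<odot>\<^bsub>base_module K\<^esub> counit A x)"
    by (rule linear_map_smult[OF counit_linear]) simp
  have "counit A (\<kappa> b xs \<otimes>\<^bsub>A\<^esub> x) = ?e \<odot>\<^bsub>base_module K\<^esub> counit A x"
    by (rule linear_eq_on_kappa[OF linear_map_comp[OF mult_linear_right[OF k] counit_linear] e _ x(1)])
      (use b in \<open>auto simp: mult_kappa counit_kappa decorated_graft graft_eq_None_iff base_module_def\<close>)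
  then show "counit A (\<kappa> b xs \<otimes>\<^bsub>A\<^esub> x) = \<zero>\<^bsub>K\<^esub>"
    using x by (simp add: base_module_def)
  have "counit A (x \<otimes>\<^bsub>A\<^esub> \<kappa> b xs) = ?e \<odot>\<^bsub>base_module K\<^esub> counit A x"
    by (rule linear_eq_on_kappa[OF linear_map_comp[OF mult_linear_left[OF k] counit_linear] e _ x(1)])
      (use b in \<open>auto simp: mult_kappa counit_kappa decorated_graft graft_eq_None_iff base_module_def\<close>)
  then show "counit A (x \<otimes>\<^bsub>A\<^esub> \<kappa> b xs) = \<zero>\<^bsub>K\<^esub>"
    using x by (simp add: base_module_def)
qed

lemma part_graft:
  assumes d: "(b, xs) \<in> decorated G" "(c, ys) \<in> decorated G" and I: "I \<subseteq> {..<deg b}"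
  shows "part (graft b c) (xs @ ys) (join_at (deg b) I I') = part b xs I \<otimes>\<^bsub>A\<^esub> part c ys I'"
proof -
  have len: "length xs = deg b"
    using d by (simp add: decorated_iff)
  have "basis_restrict b (join_at (deg b) I I') = basis_restrict b I"
    by (rule basis_restrict_cong) (use I join_at_low[OF I] in auto)
  moreover have "nths xs (join_at (deg b) I I') = nths xs I"
    by (rule nths_cong) (use I join_at_low[OF I] len in auto)
  ultimately show ?thesis
    by (simp add: mult_kappa decorated_restrict[OF d(1)] decorated_restrict[OF d(2)] basis_restrict_graft
        nths_append len join_at_high[OF I])
qed

text \<open>
  A splitting of the leaves of a grafted tree into two sets is a pair of splittings, one for each of
  the two subtrees.
\<close>

lemma comult_mult_kappa:
  assumes b: "(b, xs) \<in> decorated G" and c: "(c, ys) \<in> decorated G"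
  shows "comult A (\<kappa> b xs \<otimes>\<^bsub>A\<^esub> \<kappa> c ys) =
    (\<Oplus>\<^bsub>AA\<^esub>I\<in>Pow {..<deg b}. \<Oplus>\<^bsub>AA\<^esub>I'\<in>Pow {..<deg c}.
      tensor K A A (part b xs I \<otimes>\<^bsub>A\<^esub> part c ys I')
        (part b xs ({..<deg b} - I) \<otimes>\<^bsub>A\<^esub> part c ys ({..<deg c} - I')))"
proof -
  let ?m = "deg b" and ?n = "deg c" and ?g = "graft b c" and ?zs = "xs @ ys"
  let ?P = "Pow {..<?m} \<times> Pow {..<?n}" and ?h = "\<lambda>p. join_at (deg b) (fst p) (snd p)"
  let ?t = "\<lambda>I. tensor K A A (part ?g ?zs I) (part ?g ?zs ({..<?m + ?n} - I))"
  let ?s = "\<lambda>I I'. tensor K A A (part b xs I \<otimes>\<^bsub>A\<^esub> part c ys I')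
        (part b xs ({..<?m} - I) \<otimes>\<^bsub>A\<^esub> part c ys ({..<?n} - I'))"
  have t: "?t I \<in> carrier AA" for I
    by (intro AA.tensor_closed part_closed decorated_graft b c)
  have s: "?s I I' \<in> carrier AA" for I I'
    by (intro AA.tensor_closed mult_closed part_closed b c)
  have "comult A (\<kappa> b xs \<otimes>\<^bsub>A\<^esub> \<kappa> c ys) = finsum AA ?t (Pow {..<?m + ?n})"
    by (simp add: mult_kappa b c comult_kappa decorated_graft)
  also have "\<dots> = finsum AA ?t (?h ` ?P)"
    by (simp only: join_at_Pow)
  also have "\<dots> = (\<Oplus>\<^bsub>AA\<^esub>p\<in>?P. ?t (?h p))"
    by (rule AA.M.finsum_reindex) (use t in blast, rule join_at_inj)
  also have "\<dots> = (\<Oplus>\<^bsub>AA\<^esub>p\<in>?P. ?s (fst p) (snd p))"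
  proof (rule AA.M.finsum_cong')
    fix p assume "p \<in> ?P"
    then have p: "fst p \<subseteq> {..<?m}" "snd p \<subseteq> {..<?n}"
      by auto
    show "?t (?h p) = ?s (fst p) (snd p)"
      unfolding join_at_complement[OF p] by (simp add: part_graft[OF b c] p)
  qed (use s in auto)
  also have "\<dots> = (\<Oplus>\<^bsub>AA\<^esub>I\<in>Pow {..<?m}. \<Oplus>\<^bsub>AA\<^esub>I'\<in>Pow {..<?n}. ?s I I')"
    by (rule AA.finsum_cartesian) (use s in auto)
  finally show ?thesis .
qed

text \<open>
  \<open>\<Delta>(a \<or> x) = \<Delta>(a) \<or> \<Delta>(x)\<close> for a decorated tree \<open>a\<close>, with the product on \<open>A \<otimes> A\<close> replaced by tensor
  products of multiplications by the parts of \<open>a\<close>. Such maps preserve \<open>J \<otimes> A + A \<otimes> J\<close> for an ideal \<open>J\<close>.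
\<close>

lemma comult_left_mult:
  assumes b: "(b, xs) \<in> decorated G" and x: "x \<in> carrier A"
  shows "comult A (\<kappa> b xs \<otimes>\<^bsub>A\<^esub> x) =
    (\<Oplus>\<^bsub>AA\<^esub>I\<in>Pow {..<deg b}.
      tensor_map K A A (\<lambda>z. part b xs I \<otimes>\<^bsub>A\<^esub> z) (\<lambda>z. part b xs ({..<deg b} - I) \<otimes>\<^bsub>A\<^esub> z) (comult A x))"
proof (rule linear_eq_on_kappa[OF _ _ _ x])
  note L = mult_linear_right[OF part_closed[OF b]]
  show "linear_map K A AA (\<lambda>x. comult A (\<kappa> b xs \<otimes>\<^bsub>A\<^esub> x))"
    by (rule linear_map_comp[OF mult_linear_right[OF kappa_closed[OF b]] comult_linear])
  show "linear_map K A AA (\<lambda>x. \<Oplus>\<^bsub>AA\<^esub>I\<in>Pow {..<deg b}.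
      tensor_map K A A (\<lambda>z. part b xs I \<otimes>\<^bsub>A\<^esub> z) (\<lambda>z. part b xs ({..<deg b} - I) \<otimes>\<^bsub>A\<^esub> z) (comult A x))"
    by (intro linear_map_finsum module_axioms AA.module_axioms linear_map_comp[OF comult_linear tensor_map_linear[OF L L]])
      simp
  fix c ys assume c: "(c, ys) \<in> decorated G"
  let ?t = "\<lambda>I'. tensor K A A (part c ys I') (part c ys ({..<deg c} - I'))"
  have t: "?t I' \<in> carrier AA" for I'
    by (intro AA.tensor_closed part_closed c)
  have "tensor_map K A A (\<lambda>z. part b xs I \<otimes>\<^bsub>A\<^esub> z) (\<lambda>z. part b xs J \<otimes>\<^bsub>A\<^esub> z) (comult A (\<kappa> c ys)) =
      (\<Oplus>\<^bsub>AA\<^esub>I'\<in>Pow {..<deg c}. tensor K A A (part b xs I \<otimes>\<^bsub>A\<^esub> part c ys I')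
        (part b xs J \<otimes>\<^bsub>A\<^esub> part c ys ({..<deg c} - I')))" for I J
    unfolding comult_kappa[OF c]
    using t linear_map.map_finsum[OF tensor_map_linear[OF L L], of "Pow {..<deg c}" ?t]
    by (simp add: tensor_map_tensor[OF L L] part_closed[OF c])
  then show "comult A (\<kappa> b xs \<otimes>\<^bsub>A\<^esub> \<kappa> c ys) = (\<Oplus>\<^bsub>AA\<^esub>I\<in>Pow {..<deg b}.
      tensor_map K A A (\<lambda>z. part b xs I \<otimes>\<^bsub>A\<^esub> z) (\<lambda>z. part b xs ({..<deg b} - I) \<otimes>\<^bsub>A\<^esub> z) (comult A (\<kappa> c ys)))"
    by (simp add: comult_mult_kappa b c)
qed

lemma comult_right_mult:
  assumes b: "(b, xs) \<in> decorated G" and x: "x \<in> carrier A"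
  shows "comult A (x \<otimes>\<^bsub>A\<^esub> \<kappa> b xs) =
    (\<Oplus>\<^bsub>AA\<^esub>I\<in>Pow {..<deg b}.
      tensor_map K A A (\<lambda>z. z \<otimes>\<^bsub>A\<^esub> part b xs I) (\<lambda>z. z \<otimes>\<^bsub>A\<^esub> part b xs ({..<deg b} - I)) (comult A x))"
proof (rule linear_eq_on_kappa[OF _ _ _ x])
  note L = mult_linear_left[OF part_closed[OF b]]
  show "linear_map K A AA (\<lambda>x. comult A (x \<otimes>\<^bsub>A\<^esub> \<kappa> b xs))"
    by (rule linear_map_comp[OF mult_linear_left[OF kappa_closed[OF b]] comult_linear])
  show "linear_map K A AA (\<lambda>x. \<Oplus>\<^bsub>AA\<^esub>I\<in>Pow {..<deg b}.
      tensor_map K A A (\<lambda>z. z \<otimes>\<^bsub>A\<^esub> part b xs I) (\<lambda>z. z \<otimes>\<^bsub>A\<^esub> part b xs ({..<deg b} - I)) (comult A x))"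
    by (intro linear_map_finsum module_axioms AA.module_axioms linear_map_comp[OF comult_linear tensor_map_linear[OF L L]])
      simp
  fix c ys assume c: "(c, ys) \<in> decorated G"
  let ?t = "\<lambda>I'. tensor K A A (part c ys I') (part c ys ({..<deg c} - I'))"
  have t: "?t I' \<in> carrier AA" for I'
    by (intro AA.tensor_closed part_closed c)
  have "tensor_map K A A (\<lambda>z. z \<otimes>\<^bsub>A\<^esub> part b xs I) (\<lambda>z. z \<otimes>\<^bsub>A\<^esub> part b xs J) (comult A (\<kappa> c ys)) =
      (\<Oplus>\<^bsub>AA\<^esub>I'\<in>Pow {..<deg c}. tensor K A A (part c ys I' \<otimes>\<^bsub>A\<^esub> part b xs I)
        (part c ys ({..<deg c} - I') \<otimes>\<^bsub>A\<^esub> part b xs J))" for I J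
    unfolding comult_kappa[OF c]
    using t linear_map.map_finsum[OF tensor_map_linear[OF L L], of "Pow {..<deg c}" ?t]
    by (simp add: tensor_map_tensor[OF L L] part_closed[OF c])
  moreover have "tensor K A A (part c ys I' \<otimes>\<^bsub>A\<^esub> part b xs I)
        (part c ys J' \<otimes>\<^bsub>A\<^esub> part b xs J) \<in> carrier AA" for I J I' J'
    by (intro AA.tensor_closed mult_closed part_closed b c)
  ultimately show "comult A (\<kappa> c ys \<otimes>\<^bsub>A\<^esub> \<kappa> b xs) = (\<Oplus>\<^bsub>AA\<^esub>I\<in>Pow {..<deg b}.
      tensor_map K A A (\<lambda>z. z \<otimes>\<^bsub>A\<^esub> part b xs I) (\<lambda>z. z \<otimes>\<^bsub>A\<^esub> part b xs ({..<deg b} - I)) (comult A (\<kappa> c ys)))"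
    unfolding comult_mult_kappa[OF c b] by (simp add: AA.finsum_swap[of "Pow {..<deg c}" "Pow {..<deg b}"])
qed

end

section \<open>Hom-Hopf ideals\<close>

context tree_hopf
begin

text \<open>The subspace \<open>J \<otimes> A + A \<otimes> J\<close> of \<open>A \<otimes> A\<close>, as a single span.\<close>

definition coideal_part :: "'v set \<Rightarrow> ('v \<times> 'v \<Rightarrow> 'k) set set" where
  "coideal_part J = lin_span K AA
     ({tensor K A A j a | j a. j \<in> J \<and> a \<in> carrier A} \<union> {tensor K A A a j | a j. a \<in> carrier A \<and> j \<in> J})"

lemma coideal_gens_closed:
  "J \<subseteq> carrier A \<Longrightarrow> {tensor K A A j a | j a. j \<in> J \<and> a \<in> carrier A} \<subseteq> carrier AA"
  "J \<subseteq> carrier A \<Longrightarrow> {tensor K A A a j | a j. a \<in> carrier A \<and> j \<in> J} \<subseteq> carrier AA"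
  using AA.tensor_closed by blast+

lemma coideal_part_submodule: "J \<subseteq> carrier A \<Longrightarrow> submodule (coideal_part J) K AA"
  unfolding coideal_part_def using coideal_gens_closed by (intro AA.lin_span_submodule) simp

lemma coideal_part_gens:
  assumes "j \<in> J" "a \<in> carrier A"
  shows "tensor K A A j a \<in> coideal_part J" "tensor K A A a j \<in> coideal_part J"
  unfolding coideal_part_def using assms by (auto intro!: subsetD[OF lin_span_superset])

lemma map_coideal_part:
  assumes f: "linear_map K AA N f" and J: "J \<subseteq> carrier A" and H: "submodule H K N"
    and gens: "\<And>j a. \<lbrakk>j \<in> J; a \<in> carrier A\<rbrakk> \<Longrightarrow> f (tensor K A A j a) \<in> H \<and> f (tensor K A A a j) \<in> H"
    and u: "u \<in> coideal_part J"
  shows "f u \<in> H"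
  by (rule linear_map.map_lin_span[OF f _ H _ u[unfolded coideal_part_def]])
    (use coideal_gens_closed[OF J] gens in auto)

lemma hom_hopf_ideal_iff:
  "hom_hopf_ideal K A J \<longleftrightarrow>
     two_sided_ideal K A J \<and> (\<forall>x\<in>J. comult A x \<in> coideal_part J \<and> counit A x = \<zero>\<^bsub>K\<^esub> \<and> antipode A x \<in> J)"
    (is "?L \<longleftrightarrow> ?R")
proof (cases "two_sided_ideal K A J")
  case True
  then have sub: "J \<subseteq> carrier A"
    using submoduleE(1) unfolding two_sided_ideal_def by blast
  have "twist A ` J \<subseteq> J"
    using True sub one_closed twist_eq_one_mult unfolding two_sided_ideal_def by auto
  then show ?thesis
    using True unfolding hom_hopf_ideal_def coideal_part_def AA.lin_span_set_add[OF coideal_gens_closed[OF sub]]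
    by auto
qed (simp add: hom_hopf_ideal_def)

lemma coideal_part_mult:
  assumes J: "two_sided_ideal K A J" and a: "a \<in> carrier A" "a' \<in> carrier A" and u: "u \<in> coideal_part J"
  shows "tensor_map K A A (\<lambda>z. a \<otimes>\<^bsub>A\<^esub> z) (\<lambda>z. a' \<otimes>\<^bsub>A\<^esub> z) u \<in> coideal_part J"
    and "tensor_map K A A (\<lambda>z. z \<otimes>\<^bsub>A\<^esub> a) (\<lambda>z. z \<otimes>\<^bsub>A\<^esub> a') u \<in> coideal_part J"
proof -
  have sub: "J \<subseteq> carrier A"
    using J submoduleE(1) unfolding two_sided_ideal_def by blast
  note N = coideal_part_submodule[OF sub]
  have J': "b \<otimes>\<^bsub>A\<^esub> j \<in> J" "j \<otimes>\<^bsub>A\<^esub> b \<in> J" if "b \<in> carrier A" "j \<in> J" for b j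
    using J that by (auto simp: two_sided_ideal_def)
  have sub': "j \<in> J \<Longrightarrow> j \<in> carrier A" for j
    using sub by auto
  note R = mult_linear_right[OF a(1)] mult_linear_right[OF a(2)]
  note L = mult_linear_left[OF a(1)] mult_linear_left[OF a(2)]
  show "tensor_map K A A (\<lambda>z. a \<otimes>\<^bsub>A\<^esub> z) (\<lambda>z. a' \<otimes>\<^bsub>A\<^esub> z) u \<in> coideal_part J"
    by (rule map_coideal_part[OF tensor_map_linear[OF R] sub N _ u])
      (use a in \<open>simp add: tensor_map_tensor[OF R] sub' coideal_part_gens J' mult_closed\<close>)
  show "tensor_map K A A (\<lambda>z. z \<otimes>\<^bsub>A\<^esub> a) (\<lambda>z. z \<otimes>\<^bsub>A\<^esub> a') u \<in> coideal_part J"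
    by (rule map_coideal_part[OF tensor_map_linear[OF L] sub N _ u])
      (use a in \<open>simp add: tensor_map_tensor[OF L] sub' coideal_part_gens J' mult_closed\<close>)
qed

text \<open>
  The elements with the required comultiplication form a two-sided ideal, by the formulas for
  \<open>\<Delta>(a \<or> x)\<close> and \<open>\<Delta>(x \<or> a)\<close>. So do those with counit \<open>0\<close> and those with antipode in \<open>J\<close>. An ideal that
  contains \<open>X\<close> contains \<open>J\<close>.
\<close>

theorem hom_hopf_ideal_generated:
  assumes X: "X \<subseteq> carrier A" and J_def: "J = generated_ideal K A X"
    and comult: "\<And>x. x \<in> X \<Longrightarrow> comult A x \<in> coideal_part J"
    and counit: "\<And>x. x \<in> X \<Longrightarrow> counit A x = \<zero>\<^bsub>K\<^esub>"
    and antipode: "\<And>x. x \<in> X \<Longrightarrow> antipode A x \<in> J"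
  shows "hom_hopf_ideal K A J"
proof -
  have J: "two_sided_ideal K A J"
    unfolding J_def by (rule two_sided_ideal_generated[OF module_axioms mult_bilinear X])
  then have HJ: "submodule J K A"
    by (simp add: two_sided_ideal_def)
  note sub = submoduleE(1)[OF HJ]
  interpret \<Delta>: linear_map K A AA "comult A"
    by (rule comult_linear)
  interpret \<epsilon>: linear_map K A "base_module K" "counit A"
    by (rule counit_linear)
  interpret S: linear_map K A A "antipode A"
    by (rule antipode_linear)
  define P1 where "P1 = {x \<in> carrier A. comult A x \<in> coideal_part J}"
  define P2 where "P2 = {x \<in> carrier A. counit A x = \<zero>\<^bsub>K\<^esub>}"
  define P3 where "P3 = {x \<in> carrier A. antipode A x \<in> J}"
  note N = coideal_part_submodule[OF sub]
  have "two_sided_ideal K A P1"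
  proof (rule two_sided_ideal_from_span[OF module_axioms mult_bilinear kappa_span])
    show "submodule P1 K A"
      unfolding P1_def by (rule \<Delta>.vimage_submodule[OF N])
    fix a x assume "a \<in> {\<kappa> b xs | b xs. (b, xs) \<in> decorated G}" and x: "x \<in> P1"
    then obtain b xs where a: "a = \<kappa> b xs" and b: "(b, xs) \<in> decorated G"
      by auto
    have x': "x \<in> carrier A" "comult A x \<in> coideal_part J"
      using x by (auto simp: P1_def)
    have fin: "finsum AA f (Pow {..<deg b}) \<in> coideal_part J" if "\<And>I. f I \<in> coideal_part J" for f
    proof -
      have "finsum AA f I \<in> coideal_part J" if "finite I" for I
        using that
      proof (induction I rule: finite_induct)
        case (insert i I)
        have "f i \<in> carrier AA" for i
          using AA.submoduleE(1)[OF N] \<open>\<And>I. f I \<in> coideal_part J\<close> by auto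
        then show ?case
          using insert AA.submoduleE(5)[OF N] \<open>\<And>I. f I \<in> coideal_part J\<close> by (simp add: Pi_iff)
      qed (simp add: AA.submodule_zero[OF N])
      then show ?thesis
        by simp
    qed
    have "comult A (a \<otimes>\<^bsub>A\<^esub> x) \<in> coideal_part J"
      unfolding a comult_left_mult[OF b x'(1)] by (intro fin coideal_part_mult[OF J] part_closed b x')
    moreover have "comult A (x \<otimes>\<^bsub>A\<^esub> a) \<in> coideal_part J"
      unfolding a comult_right_mult[OF b x'(1)] by (intro fin coideal_part_mult[OF J] part_closed b x')
    ultimately show "a \<otimes>\<^bsub>A\<^esub> x \<in> P1 \<and> x \<otimes>\<^bsub>A\<^esub> a \<in> P1"
      using x' kappa_closed[OF b] by (simp add: P1_def a mult_closed)
  qed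
  moreover have "X \<subseteq> P1"
    using X comult by (auto simp: P1_def)
  ultimately have "J \<subseteq> P1"
    unfolding J_def by (rule generated_ideal_least)
  have "two_sided_ideal K A P2"
  proof (rule two_sided_ideal_from_span[OF module_axioms mult_bilinear kappa_span])
    show "submodule P2 K A"
      using \<epsilon>.vimage_submodule[OF \<epsilon>.N.trivial_submodule] by (simp add: P2_def base_module_def)
    fix a x assume "a \<in> {\<kappa> b xs | b xs. (b, xs) \<in> decorated G}" and x: "x \<in> P2"
    then obtain b xs where a: "a = \<kappa> b xs" and b: "(b, xs) \<in> decorated G"
      by auto
    then show "a \<otimes>\<^bsub>A\<^esub> x \<in> P2 \<and> x \<otimes>\<^bsub>A\<^esub> a \<in> P2"
      using x kappa_closed[OF b] by (simp add: P2_def mult_closed counit_mult_zero)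
  qed
  moreover have "X \<subseteq> P2"
    using X counit by (auto simp: P2_def)
  ultimately have "J \<subseteq> P2"
    unfolding J_def by (rule generated_ideal_least)
  have "two_sided_ideal K A P3"
    unfolding two_sided_ideal_def
  proof (intro conjI ballI)
    show "submodule P3 K A"
      unfolding P3_def by (rule S.vimage_submodule[OF HJ])
    fix a x assume "a \<in> carrier A" "x \<in> P3"
    then show "a \<otimes>\<^bsub>A\<^esub> x \<in> P3" "x \<otimes>\<^bsub>A\<^esub> a \<in> P3"
      using J S.map_closed by (auto simp: P3_def mult_closed antipode_mult two_sided_ideal_def)
  qed
  moreover have "X \<subseteq> P3"
    using X antipode by (auto simp: P3_def)
  ultimately have "J \<subseteq> P3"
    unfolding J_def by (rule generated_ideal_least)
  show ?thesis
    unfolding hom_hopf_ideal_iff using J \<open>J \<subseteq> P1\<close> \<open>J \<subseteq> P2\<close> \<open>J \<subseteq> P3\<close> by (auto simp: P1_def P2_def P3_def)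
qed

text \<open>
  The counit vanishes on \<open>I\<close>, as do the other structure maps followed by the quotient map, which is what makes the induced maps
  on cosets linear and computable on representatives. For the comultiplication this is the
  observation that \<open>q \<otimes> q\<close> kills \<open>I \<otimes> A + A \<otimes> I\<close>, where \<open>q\<close> is the quotient map.
\<close>

theorem tree_hopf_quotient:
  assumes I: "hom_hopf_ideal K A I"
  shows "tree_hopf K (quotient_hom_hopf K A I) G (\<lambda>b xs. I +>\<^bsub>A\<^esub> \<kappa> b xs)"
proof -
  let ?Q = "quotient_module A I" and ?q = "\<lambda>x. I +>\<^bsub>A\<^esub> x" and ?B = "quotient_hom_hopf K A I"
  have ideal: "two_sided_ideal K A I"
    and hopf: "\<And>x. x \<in> I \<Longrightarrow> comult A x \<in> coideal_part I \<and> counit A x = \<zero>\<^bsub>K\<^esub> \<and> antipode A x \<in> I"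
    using I unfolding hom_hopf_ideal_iff by auto
  then have W: "submodule I K A"
    by (simp add: two_sided_ideal_def)
  note sub = submoduleE(1)[OF W]
  interpret q: linear_map K A ?Q ?q
    by (rule quotient_map_linear[OF W])
  interpret QQ: two_modules K ?Q ?Q ..
  interpret qq: linear_map K AA "tensor_module K ?Q ?Q" "tensor_map K ?Q ?Q ?q ?q"
    by (rule tensor_map_linear[OF q.linear_map_axioms q.linear_map_axioms])
  note qq_tensor = tensor_map_tensor[OF q.linear_map_axioms q.linear_map_axioms]
  have q_zero: "?q x = \<zero>\<^bsub>?Q\<^esub>" if "x \<in> I" for x
    using that quotient_map_eq_zero_iff[OF W] sub by blast
  note fields = quotient_hom_hopf_def Let_def
  have same: "same_space ?B ?Q"
    by (simp add: same_space_def fields)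
  have TT: "tensor_module K ?B ?B = tensor_module K ?Q ?Q" "tensor K ?B ?B = tensor K ?Q ?Q"
    by (rule same_space_tensor_module[OF same same], rule same_space_tensor[OF same same])
  have refl: "same_space N N" for N :: "('k, 'x, 'y) module_scheme"
    by (simp add: same_space_def)
  note into = same_space_linear_map[OF same refl] and endo = same_space_linear_map[OF same same]
  have car: "carrier ?B = ?q ` carrier A"
    by (simp add: fields quotient_module_carrier)
  have smult: "smult ?B = smult ?Q"
    by (simp add: fields)
  have twist_q: "linear_map K A ?Q (\<lambda>x. ?q (twist A x))"
    by (rule linear_map_comp[OF twist_linear q.linear_map_axioms])
  have twist_null: "?q (twist A x) = \<zero>\<^bsub>?Q\<^esub>" if "x \<in> I" for x
    using that sub ideal one_closed by (intro q_zero) (auto simp: twist_eq_one_mult two_sided_ideal_def)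
  have antipode_q: "linear_map K A ?Q (\<lambda>x. ?q (antipode A x))"
    by (rule linear_map_comp[OF antipode_linear q.linear_map_axioms])
  have antipode_null: "?q (antipode A x) = \<zero>\<^bsub>?Q\<^esub>" if "x \<in> I" for x
    using that hopf by (intro q_zero) simp
  have counit_null: "counit A x = \<zero>\<^bsub>base_module K\<^esub>" if "x \<in> I" for x
    using that hopf by (simp add: base_module_def)
  have comult_q: "linear_map K A (tensor_module K ?Q ?Q) (\<lambda>x. tensor_map K ?Q ?Q ?q ?q (comult A x))"
    by (rule linear_map_comp[OF comult_linear qq.linear_map_axioms])
  have comult_null: "tensor_map K ?Q ?Q ?q ?q (comult A x) = \<zero>\<^bsub>tensor_module K ?Q ?Q\<^esub>" if x: "x \<in> I" for x
  proof -
    have "tensor_map K ?Q ?Q ?q ?q (comult A x) \<in> {\<zero>\<^bsub>tensor_module K ?Q ?Q\<^esub>}"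
    proof (rule map_coideal_part[OF qq.linear_map_axioms sub qq.N.trivial_submodule])
      fix j a assume j: "j \<in> I" and a: "a \<in> carrier A"
      have "j \<in> carrier A"
        using j sub by auto
      then show "tensor_map K ?Q ?Q ?q ?q (tensor K A A j a) \<in> {\<zero>\<^bsub>tensor_module K ?Q ?Q\<^esub>} \<and>
          tensor_map K ?Q ?Q ?q ?q (tensor K A A a j) \<in> {\<zero>\<^bsub>tensor_module K ?Q ?Q\<^esub>}"
        using a q_zero[OF j] q.map_closed[OF a]
          linear_map.map_zero[OF QQ.tensor_linear_left] linear_map.map_zero[OF QQ.tensor_linear_right]
        by (simp add: qq_tensor)
    qed (use hopf x in simp)
    then show ?thesis
      by simp
  qed
  have mult_q: "?q x \<otimes>\<^bsub>?B\<^esub> ?q y = ?q (x \<otimes>\<^bsub>A\<^esub> y)" if "x \<in> carrier A" "y \<in> carrier A" for x y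
    using rcoset_mult_cosets[OF module_axioms mult_bilinear ideal that] by (simp add: fields quotient_module_def)
  have span: "lin_span K ?Q (?q ` {\<kappa> b xs | b xs. (b, xs) \<in> decorated G}) = carrier ?Q"
    by (rule quotient_span[OF W kappa_span])
  have span_eq: "?q ` {\<kappa> b xs | b xs. (b, xs) \<in> decorated G} = {?q (\<kappa> b xs) | b xs. (b, xs) \<in> decorated G}"
    by auto
  have bilinear: "bilinear_map K ?Q ?Q ?Q (mult ?B)"
    unfolding bilinear_map_def
  proof (intro conjI ballI)
    fix C assume "C \<in> carrier ?Q"
    then obtain x where x: "x \<in> carrier A" and C: "C = ?q x"
      by (auto simp: quotient_module_carrier)
    note l = mult_linear_left[OF x] and r = mult_linear_right[OF x]
    show "linear_map K ?Q ?Q (\<lambda>D. D \<otimes>\<^bsub>?B\<^esub> C)"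
      unfolding C using x
      by (intro linear_mapI q.N.module_axioms)
        (auto simp: quotient_module_carrier mult_q coset_add[OF W] coset_smult[OF W] mult_closed
          linear_map.map_add[OF l] linear_map.map_smult[OF l])
    show "linear_map K ?Q ?Q (\<lambda>D. C \<otimes>\<^bsub>?B\<^esub> D)"
      unfolding C using x
      by (intro linear_mapI q.N.module_axioms)
        (auto simp: quotient_module_carrier mult_q coset_add[OF W] coset_smult[OF W] mult_closed
          linear_map.map_add[OF r] linear_map.map_smult[OF r])
  qed
  show ?thesis
  proof (intro tree_hopf.intro tree_hopf_axioms.intro, goal_cases)
    case 1
    show ?case
      using same_space_module[OF same] q.N.module_axioms by blast
  next
    case (2 b xs)
    then show ?case
      using kappa_closed by (auto simp: car)
  next
    case 3
    show ?case
      using span unfolding span_eq same_space_lin_span[OF same] car quotient_module_carrier .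
  next
    case 4
    show ?case
      using same_space_bilinear_map[OF same same same] bilinear by blast
  next
    case (5 b xs c ys)
    then show ?case
      by (simp add: mult_q kappa_closed mult_kappa)
  next
    case 6
    show ?case
      by (simp add: fields quotient_module_def one_kappa)
  next
    case 7
    show ?case
      using linear_map.descend_linear[OF twist_q W twist_null] unfolding endo by (simp add: fields)
  next
    case (8 b xs)
    then show ?case
      using linear_map.descend_coset[OF twist_q W twist_null kappa_closed] by (simp add: fields twist_kappa)
  next
    case 9
    show ?case
      using linear_map.descend_linear[OF comult_q W comult_null] unfolding TT into by (simp add: fields)
  next
    case (10 b xs)
    have "comult ?B (?q (\<kappa> b xs)) = tensor_map K ?Q ?Q ?q ?q (comult A (\<kappa> b xs))"
      using linear_map.descend_coset[OF comult_q W comult_null kappa_closed[OF 10]] by (simp add: fields)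
    also have "\<dots> = (\<Oplus>\<^bsub>tensor_module K ?Q ?Q\<^esub>I'\<in>Pow {..<deg b}. tensor_map K ?Q ?Q ?q ?q
        (tensor K A A (part b xs I') (part b xs ({..<deg b} - I'))))"
      unfolding comult_kappa[OF 10]
      by (rule qq.map_finsum) (simp_all add: AA.tensor_closed part_closed 10)
    finally show ?case
      by (simp add: TT qq_tensor part_closed 10)
  next
    case 11
    show ?case
      using linear_map.descend_linear[OF counit_linear W counit_null] unfolding into by (simp add: fields)
  next
    case (12 b xs)
    then show ?case
      using linear_map.descend_coset[OF counit_linear W counit_null kappa_closed] by (simp add: fields counit_kappa)
  next
    case 13
    show ?case
      using linear_map.descend_linear[OF antipode_q W antipode_null] unfolding endo by (simp add: fields)
  next
    case (14 b xs)
    have "antipode ?B (?q (\<kappa> b xs)) = ?q (antipode A (\<kappa> b xs))"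
      using linear_map.descend_coset[OF antipode_q W antipode_null kappa_closed[OF 14]] by (simp add: fields)
    then show ?case
      by (simp add: antipode_kappa 14 smult q.map_smult kappa_closed decorated_mirror)
  qed
qed

end

section \<open>The free Hom-associative algebra\<close>

context decorated_trees
begin

text \<open>
  All conditions are checked on the differences \<open>b - c\<close> along steps. For the comultiplication,
  restriction turns the step from \<open>b\<close> to \<open>c\<close> into steps between their parts, and
  \<open>u \<otimes> v - u' \<otimes> v' = (u - u') \<otimes> v + u' \<otimes> (v - v')\<close> lies in \<open>I \<otimes> T + T \<otimes> I\<close> as soon as \<open>u - u'\<close> and
  \<open>v - v'\<close> lie in \<open>I\<close>. For the antipode, reflection turns the step around.
\<close>

theorem hom_hopf_ideal_dtree_ideal: "hom_hopf_ideal K H (dtree_ideal K G)"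
proof -
  interpret H: tree_hopf K H G \<tau>
    by (rule tree_hopf_dtree_hopf)
  let ?E = "{\<tau> b xs \<ominus>\<^bsub>H\<^esub> \<tau> c xs | b c xs. assoc_step b c \<and> (b, xs) \<in> decorated G}" and ?I = "dtree_ideal K G"
  have I_eq: "?I = lin_span K H ?E"
    unfolding dtree_ideal_eq same_space_lin_span[OF same_space_dtree_hopf]
      same_space_minus[OF same_space_dtree_hopf] ..
  have dec: "(c, xs) \<in> decorated G" if "assoc_step b c" "(b, xs) \<in> decorated G" for b c xs
    using assoc_step_deg that by (simp add: decorated_iff)
  have E: "?E \<subseteq> carrier H"
    using H.kappa_closed dec by auto
  have gen: "\<tau> b xs \<ominus>\<^bsub>H\<^esub> \<tau> c xs \<in> ?I" if "assoc_step b c" "(b, xs) \<in> decorated G" for b c xs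
    unfolding I_eq by (rule subsetD[OF lin_span_superset]) (use that in blast)
  have HI: "submodule ?I K H"
    unfolding I_eq by (rule H.lin_span_submodule[OF E])
  note sub = H.submoduleE(1)[OF HI]
  have ideal: "two_sided_ideal K H ?I"
    unfolding I_eq
  proof (rule two_sided_ideal_lin_span[OF H.module_axioms H.mult_bilinear H.kappa_span E], fold I_eq)
    fix x e assume "x \<in> {\<tau> b xs | b xs. (b, xs) \<in> decorated G}" "e \<in> ?E"
    then obtain a ys b c xs where *: "x = \<tau> a ys" "(a, ys) \<in> decorated G"
        "e = \<tau> b xs \<ominus>\<^bsub>H\<^esub> \<tau> c xs" "assoc_step b c" "(b, xs) \<in> decorated G"
      by auto
    note c = dec[OF *(4,5)] and k = H.kappa_closed
    have "x \<otimes>\<^bsub>H\<^esub> e = \<tau> (graft a b) (ys @ xs) \<ominus>\<^bsub>H\<^esub> \<tau> (graft a c) (ys @ xs)"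
      using linear_map.map_minus[OF H.mult_linear_right[OF k[OF *(2)]] k[OF *(5)] k[OF c]] *(2,5) c
      by (simp add: *(1,3) H.mult_kappa)
    moreover have "e \<otimes>\<^bsub>H\<^esub> x = \<tau> (graft b a) (xs @ ys) \<ominus>\<^bsub>H\<^esub> \<tau> (graft c a) (xs @ ys)"
      using linear_map.map_minus[OF H.mult_linear_left[OF k[OF *(2)]] k[OF *(5)] k[OF c]] *(2,5) c
      by (simp add: *(1,3) H.mult_kappa)
    ultimately show "x \<otimes>\<^bsub>H\<^esub> e \<in> ?I \<and> e \<otimes>\<^bsub>H\<^esub> x \<in> ?I"
      using *(2,4,5) by (simp add: gen assoc_step.graft_left assoc_step.graft_right decorated_graft)
  qed
  have comult: "comult H e \<in> H.coideal_part ?I" if "e \<in> ?E" for e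
  proof -
    interpret \<Delta>: linear_map K H H.AA "comult H"
      by (rule H.comult_linear)
    obtain b c xs where e: "e = \<tau> b xs \<ominus>\<^bsub>H\<^esub> \<tau> c xs" and step: "assoc_step b c" and b: "(b, xs) \<in> decorated G"
      using \<open>e \<in> ?E\<close> by auto
    note c = dec[OF step b] and N = H.coideal_part_submodule[OF sub] and p = H.part_closed
    have cb: "deg c = deg b"
      using assoc_step_deg[OF step] by simp
    let ?t = "\<lambda>I. tensor K H H (H.part b xs I) (H.part b xs ({..<deg b} - I))"
    let ?s = "\<lambda>I. tensor K H H (H.part c xs I) (H.part c xs ({..<deg b} - I))"
    have diff: "?t I \<ominus>\<^bsub>H.AA\<^esub> ?s I \<in> H.coideal_part ?I" for I
    proof -
      let ?J = "{..<deg b} - I"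
      have part: "H.part b xs I' \<ominus>\<^bsub>H\<^esub> H.part c xs I' \<in> ?I" for I'
        by (rule gen[OF assoc_step_restrict[OF step] decorated_restrict[OF b]])
      have "tensor K H H (H.part b xs I \<ominus>\<^bsub>H\<^esub> H.part c xs I) (H.part b xs ?J) \<oplus>\<^bsub>H.AA\<^esub>
          tensor K H H (H.part c xs I) (H.part b xs ?J \<ominus>\<^bsub>H\<^esub> H.part c xs ?J) \<in> H.coideal_part ?I"
        by (intro H.AA.submoduleE(5)[OF N] H.coideal_part_gens part p b c)
      moreover have "tensor K H H (H.part b xs I \<ominus>\<^bsub>H\<^esub> H.part c xs I) (H.part b xs ?J) \<oplus>\<^bsub>H.AA\<^esub>
          tensor K H H (H.part c xs I) (H.part b xs ?J \<ominus>\<^bsub>H\<^esub> H.part c xs ?J)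
        = (?t I \<ominus>\<^bsub>H.AA\<^esub> tensor K H H (H.part c xs I) (H.part b xs ?J)) \<oplus>\<^bsub>H.AA\<^esub>
          (tensor K H H (H.part c xs I) (H.part b xs ?J) \<ominus>\<^bsub>H.AA\<^esub> ?s I)"
        using p[OF b] p[OF c]
        by (simp add: linear_map.map_minus[OF H.AA.tensor_linear_left] linear_map.map_minus[OF H.AA.tensor_linear_right])
      moreover have "\<dots> = ?t I \<ominus>\<^bsub>H.AA\<^esub> ?s I"
        using p[OF b] p[OF c]
        by (simp add: H.AA.tensor_closed H.AA.M.minus_eq H.AA.M.a_assoc H.AA.M.l_neg H.AA.M.r_neg1)
      ultimately show ?thesis
        by simp
    qed
    have t: "?t I \<in> carrier H.AA" "?s I \<in> carrier H.AA" for I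
      by (intro H.AA.tensor_closed p b c)+
    have "finsum H.AA ?t \<I> \<ominus>\<^bsub>H.AA\<^esub> finsum H.AA ?s \<I> \<in> H.coideal_part ?I" if "finite \<I>" for \<I>
      using that
    proof (induction \<I> rule: finite_induct)
      case empty
      then show ?case
        using H.AA.submodule_zero[OF N] H.AA.minus_self_iff[of "\<zero>\<^bsub>H.AA\<^esub>" "\<zero>\<^bsub>H.AA\<^esub>"] by simp
    next
      case (insert I \<I>)
      have "finsum H.AA ?t (insert I \<I>) \<ominus>\<^bsub>H.AA\<^esub> finsum H.AA ?s (insert I \<I>)
          = (?t I \<ominus>\<^bsub>H.AA\<^esub> ?s I) \<oplus>\<^bsub>H.AA\<^esub> (finsum H.AA ?t \<I> \<ominus>\<^bsub>H.AA\<^esub> finsum H.AA ?s \<I>)"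
        using insert t by (simp add: H.AA.M.finsum_closed H.AA.M.minus_eq H.AA.M.minus_add H.AA.M.a_ac)
      then show ?case
        using insert diff H.AA.submoduleE(5)[OF N] by simp
    qed
    moreover have "comult H e = finsum H.AA ?t (Pow {..<deg b}) \<ominus>\<^bsub>H.AA\<^esub> finsum H.AA ?s (Pow {..<deg b})"
      unfolding e \<Delta>.map_minus[OF H.kappa_closed[OF b] H.kappa_closed[OF c]] H.comult_kappa[OF b]
        H.comult_kappa[OF c] cb ..
    ultimately show ?thesis
      by simp
  qed
  have counit: "counit H e = \<zero>\<^bsub>K\<^esub>" if "e \<in> ?E" for e
  proof -
    interpret \<epsilon>: linear_map K H "base_module K" "counit H"
      by (rule H.counit_linear)
    obtain b c xs where e: "e = \<tau> b xs \<ominus>\<^bsub>H\<^esub> \<tau> c xs" and step: "assoc_step b c" and b: "(b, xs) \<in> decorated G"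
      using \<open>e \<in> ?E\<close> by auto
    note c = dec[OF step b]
    have "b = None \<longleftrightarrow> c = None"
      using assoc_step_deg[OF step] deg_eq_0_iff[of b] deg_eq_0_iff[of c] by simp
    then have "counit H (\<tau> b xs) = counit H (\<tau> c xs)"
      by (simp add: H.counit_kappa b c)
    then have "counit H e = \<zero>\<^bsub>base_module K\<^esub>"
      using \<epsilon>.map_closed[OF H.kappa_closed[OF c]]
      by (simp add: e \<epsilon>.map_minus H.kappa_closed b c \<epsilon>.N.minus_self_iff)
    then show ?thesis
      by (simp add: base_module_def)
  qed
  have antipode: "antipode H e \<in> ?I" if "e \<in> ?E" for e
  proof -
    interpret S: linear_map K H H "antipode H"
      by (rule H.antipode_linear)
    obtain b c xs where e: "e = \<tau> b xs \<ominus>\<^bsub>H\<^esub> \<tau> c xs" and step: "assoc_step b c" and b: "(b, xs) \<in> decorated G"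
      using \<open>e \<in> ?E\<close> by auto
    note c = dec[OF step b]
    let ?u = "\<tau> (basis_mirror c) (rev xs)" and ?w = "\<tau> (basis_mirror b) (rev xs)"
    have uw: "?u \<in> carrier H" "?w \<in> carrier H"
      by (intro H.kappa_closed decorated_mirror b c)+
    have "tree_sign K c = tree_sign K b"
      by (simp add: tree_sign_def assoc_step_deg[OF step])
    then have "antipode H e = (\<ominus>\<^bsub>K\<^esub> tree_sign K b) \<odot>\<^bsub>H\<^esub> (?u \<ominus>\<^bsub>H\<^esub> ?w)"
      using uw by (simp add: e S.map_add S.map_neg H.kappa_closed b c H.antipode_kappa H.smult_l_minus
          H.smult_r_distr H.smult_r_minus H.M.minus_eq H.M.minus_add H.M.a_comm)
    moreover have "?u \<ominus>\<^bsub>H\<^esub> ?w \<in> ?I"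
      by (rule gen[OF assoc_step_mirror[OF step] decorated_mirror[OF c]])
    ultimately show ?thesis
      using H.submoduleE(4)[OF HI] by simp
  qed
  have "comult H x \<in> H.coideal_part ?I \<and> counit H x = \<zero>\<^bsub>K\<^esub> \<and> antipode H x \<in> ?I" if x: "x \<in> ?I" for x
  proof (intro conjI)
    note x = x[unfolded I_eq]
    show "comult H x \<in> H.coideal_part ?I"
      by (rule linear_map.map_lin_span[OF H.comult_linear E H.coideal_part_submodule[OF sub] comult x])
    show "antipode H x \<in> ?I"
      by (rule linear_map.map_lin_span[OF H.antipode_linear E HI antipode x])
    have "counit H x \<in> {\<zero>\<^bsub>base_module K\<^esub>}"
      by (rule linear_map.map_lin_span[OF H.counit_linear E module.trivial_submodule[OF G.R.module_base_module] _ x])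
        (simp add: counit base_module_def)
    then show "counit H x = \<zero>\<^bsub>K\<^esub>"
      by (simp add: base_module_def)
  qed
  then show ?thesis
    unfolding H.hom_hopf_ideal_iff using ideal by blast
qed

corollary tree_hopf_free_hom_assoc: "tree_hopf K (free_hom_assoc K G) G (fha_class K G)"
proof -
  interpret H: tree_hopf K H G \<tau>
    by (rule tree_hopf_dtree_hopf)
  have "(\<lambda>b xs. dtree_ideal K G +>\<^bsub>H\<^esub> \<tau> b xs) = fha_class K G"
    by (intro ext) (simp add: fha_class_def)
  then show ?thesis
    using H.tree_hopf_quotient[OF hom_hopf_ideal_dtree_ideal] by (simp add: free_hom_assoc_def)
qed

end

section \<open>The enveloping ideal\<close>

context tree_hopf
begin

text \<open>The kernel of this linear map consists of the primitive elements.\<close>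

lemma primitive_linear:
  "linear_map K A AA (\<lambda>x. comult A x \<ominus>\<^bsub>AA\<^esub> (tensor K A A \<one>\<^bsub>A\<^esub> x \<oplus>\<^bsub>AA\<^esub> tensor K A A x \<one>\<^bsub>A\<^esub>))"
  by (intro linear_map_minus linear_map_add comult_linear AA.tensor_linear_left AA.tensor_linear_right one_closed)

lemma comult_leaf:
  assumes x: "x \<in> carrier G"
  shows "comult A (\<kappa> (Some (Leaf n)) [x])
    = tensor K A A \<one>\<^bsub>A\<^esub> (\<kappa> (Some (Leaf n)) [x]) \<oplus>\<^bsub>AA\<^esub> tensor K A A (\<kappa> (Some (Leaf n)) [x]) \<one>\<^bsub>A\<^esub>"
proof -
  have d: "(Some (Leaf n), [x]) \<in> decorated G"
    using x by (simp add: decorated_iff)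
  have "Pow {..<deg (Some (Leaf n))} = {{}, {0}}"
    by (auto simp: lessThan_Suc)
  then show ?thesis
    using kappa_closed[OF d] one_closed
    by (simp add: comult_kappa[OF d] AA.tensor_closed lessThan_Suc one_kappa)
qed

text \<open>
  Removing one of the two leaves raises the weight of the other one, which is grafted with \<open>\<one>\<close>. This is
  where the leaves of weight \<open>1\<close> come from.
\<close>

lemma comult_cherry:
  assumes xy: "x \<in> carrier G" "y \<in> carrier G"
  defines "l \<equiv> Some (Leaf 0)"
  shows "comult A (\<kappa> (graft l l) [x, y])
    = (tensor K A A \<one>\<^bsub>A\<^esub> (\<kappa> (graft l l) [x, y]) \<oplus>\<^bsub>AA\<^esub> tensor K A A (\<kappa> (graft l l) [x, y]) \<one>\<^bsub>A\<^esub>) \<oplus>\<^bsub>AA\<^esub>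
      (tensor K A A (\<kappa> (Some (Leaf 1)) [x]) (\<kappa> (Some (Leaf 1)) [y]) \<oplus>\<^bsub>AA\<^esub>
       tensor K A A (\<kappa> (Some (Leaf 1)) [y]) (\<kappa> (Some (Leaf 1)) [x]))"
proof -
  have d: "(graft l l, [x, y]) \<in> decorated G" "(Some (Leaf 1), [x]) \<in> decorated G" "(Some (Leaf 1), [y]) \<in> decorated G"
    using xy by (auto simp: decorated_iff l_def)
  have P: "Pow {..<deg (graft l l)} = {{}, {0, 1}, {0}, {1}}"
    by (auto simp: l_def numeral_2_eq_2 lessThan_Suc)
  have C: "{..<deg (graft l l)} - {} = {0, 1}" "{..<deg (graft l l)} - {0, 1} = {}"
      "{..<deg (graft l l)} - {0} = {1}" "{..<deg (graft l l)} - {1} = {0}"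
    by (auto simp: l_def)
  have parts: "part (graft l l) [x, y] {} = \<one>\<^bsub>A\<^esub>" "part (graft l l) [x, y] {0, 1} = \<kappa> (graft l l) [x, y]"
      "part (graft l l) [x, y] {0} = \<kappa> (Some (Leaf 1)) [x]" "part (graft l l) [x, y] {1} = \<kappa> (Some (Leaf 1)) [y]"
    by (simp_all add: l_def one_kappa nths_Cons)
  note k = kappa_closed[OF d(1)] kappa_closed[OF d(2)] kappa_closed[OF d(3)] one_closed
  let ?t = "\<lambda>I. tensor K A A (part (graft l l) [x, y] I) (part (graft l l) [x, y] ({..<deg (graft l l)} - I))"
  have t: "?t I \<in> carrier AA" for I
    by (intro AA.tensor_closed part_closed d)
  have "comult A (\<kappa> (graft l l) [x, y]) = ?t {} \<oplus>\<^bsub>AA\<^esub> (?t {0, 1} \<oplus>\<^bsub>AA\<^esub> (?t {0} \<oplus>\<^bsub>AA\<^esub> ?t {1}))"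
  proof -
    have "finsum AA f {{}, {0, 1}, {0}, {1}} = f {} \<oplus>\<^bsub>AA\<^esub> (f {0, 1} \<oplus>\<^bsub>AA\<^esub> (f {0} \<oplus>\<^bsub>AA\<^esub> f {1}))"
      if "\<And>I. f I \<in> carrier AA" for f :: "nat set \<Rightarrow> _"
      using that by (simp add: Pi_iff)
    from this[of ?t, OF t] show ?thesis
      unfolding comult_kappa[OF d(1)] P .
  qed
  then show ?thesis
    unfolding C parts using k by (simp add: AA.tensor_closed AA.M.a_assoc)
qed

text \<open>
  In the comultiplication of a tree with two leaves, the part that obstructs primitivity is symmetric in
  \<open>x\<close> and \<open>y\<close>, so it cancels in the commutator and the generators are primitive. Their antipode is their negative, as the antipode changes the
  sign of a leaf and exchanges the two terms of the commutator.
\<close>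

theorem hom_hopf_ideal_enveloping:
  fixes bracket :: "'g \<Rightarrow> 'g \<Rightarrow> 'g" and \<alpha> :: "'g \<Rightarrow> 'g"
  assumes bracket: "\<And>x y. \<lbrakk>x \<in> carrier G; y \<in> carrier G\<rbrakk> \<Longrightarrow> bracket x y \<in> carrier G"
    and \<alpha>: "\<And>x. x \<in> carrier G \<Longrightarrow> \<alpha> x \<in> carrier G"
  defines "l \<equiv> Some (Leaf 0)"
  defines "X \<equiv> {\<kappa> (Some (Leaf n)) [x] \<ominus>\<^bsub>A\<^esub> \<kappa> l [(\<alpha> ^^ n) x] | n x. x \<in> carrier G} \<union>
    {\<kappa> (graft l l) [x, y] \<ominus>\<^bsub>A\<^esub> \<kappa> (graft l l) [y, x] \<ominus>\<^bsub>A\<^esub> \<kappa> l [bracket x y] | x y.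
      x \<in> carrier G \<and> y \<in> carrier G}"
  shows "hom_hopf_ideal K A (generated_ideal K A X)"
proof -
  let ?J = "generated_ideal K A X"
  interpret D: linear_map K A AA
      "\<lambda>x. comult A x \<ominus>\<^bsub>AA\<^esub> (tensor K A A \<one>\<^bsub>A\<^esub> x \<oplus>\<^bsub>AA\<^esub> tensor K A A x \<one>\<^bsub>A\<^esub>)"
    by (rule primitive_linear)
  interpret \<epsilon>: linear_map K A "base_module K" "counit A"
    by (rule counit_linear)
  interpret S: linear_map K A A "antipode A"
    by (rule antipode_linear)
  let ?D = "\<lambda>x. comult A x \<ominus>\<^bsub>AA\<^esub> (tensor K A A \<one>\<^bsub>A\<^esub> x \<oplus>\<^bsub>AA\<^esub> tensor K A A x \<one>\<^bsub>A\<^esub>)"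
  have \<alpha>_pow: "(\<alpha> ^^ n) x \<in> carrier G" if "x \<in> carrier G" for n x
    using that by (induction n) (auto simp: \<alpha>)
  have d1: "(Some (Leaf n), [x]) \<in> decorated G" if "x \<in> carrier G" for n x
    using that by (simp add: decorated_iff)
  have d2: "(graft l l, [x, y]) \<in> decorated G" if "x \<in> carrier G" "y \<in> carrier G" for x y
    using that by (simp add: decorated_iff l_def)
  have k1: "\<kappa> (Some (Leaf n)) [x] \<in> carrier A" if "x \<in> carrier G" for n x
    by (rule kappa_closed[OF d1[OF that]])
  have k2: "\<kappa> (graft l l) [x, y] \<in> carrier A" if "x \<in> carrier G" "y \<in> carrier G" for x y
    by (rule kappa_closed[OF d2[OF that]])
  have \<Delta>_closed: "comult A x \<in> carrier AA" if "x \<in> carrier A" for x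
    using linear_map.map_closed[OF comult_linear that] .
  have t: "tensor K A A \<one>\<^bsub>A\<^esub> x \<oplus>\<^bsub>AA\<^esub> tensor K A A x \<one>\<^bsub>A\<^esub> \<in> carrier AA" if "x \<in> carrier A" for x
    using that one_closed by (simp add: AA.tensor_closed)
  have D1: "?D (\<kappa> (Some (Leaf n)) [x]) = \<zero>\<^bsub>AA\<^esub>" if "x \<in> carrier G" for n x
    using that by (simp add: AA.minus_self_iff \<Delta>_closed t k1 comult_leaf)
  have D2: "?D (\<kappa> (graft l l) [x, y])
      = tensor K A A (\<kappa> (Some (Leaf 1)) [x]) (\<kappa> (Some (Leaf 1)) [y]) \<oplus>\<^bsub>AA\<^esub>
        tensor K A A (\<kappa> (Some (Leaf 1)) [y]) (\<kappa> (Some (Leaf 1)) [x])" (is "_ = ?m x y")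
    if xy: "x \<in> carrier G" "y \<in> carrier G" for x y
  proof -
    have m: "?m x y \<in> carrier AA"
      using xy k1 by (simp add: AA.tensor_closed)
    show ?thesis
      unfolding comult_cherry[OF xy, folded l_def] AA.M.minus_eq
      using m t[OF k2[OF xy]] by (simp add: AA.M.a_ac AA.M.r_neg AA.M.r_neg2)
  qed
  have X: "X \<subseteq> carrier A"
    unfolding X_def l_def using k1 k2[unfolded l_def] \<alpha>_pow bracket by (auto simp del: graft.simps)
  have D_zero: "?D g = \<zero>\<^bsub>AA\<^esub>" if "g \<in> X" for g
    using that unfolding X_def
  proof (elim UnE CollectE exE conjE)
    fix n x assume g: "g = \<kappa> (Some (Leaf n)) [x] \<ominus>\<^bsub>A\<^esub> \<kappa> l [(\<alpha> ^^ n) x]" and x: "x \<in> carrier G"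
    show ?thesis
      unfolding g l_def D.map_minus[OF k1[OF x] k1[OF \<alpha>_pow[OF x]]] D1[OF x] D1[OF \<alpha>_pow[OF x]]
      by (simp add: AA.minus_self_iff)
  next
    fix x y assume g: "g = \<kappa> (graft l l) [x, y] \<ominus>\<^bsub>A\<^esub> \<kappa> (graft l l) [y, x] \<ominus>\<^bsub>A\<^esub> \<kappa> l [bracket x y]"
      and x: "x \<in> carrier G" and y: "y \<in> carrier G"
    have "tensor K A A (\<kappa> (Some (Leaf 1)) [x]) (\<kappa> (Some (Leaf 1)) [y]) \<in> carrier AA"
      "tensor K A A (\<kappa> (Some (Leaf 1)) [y]) (\<kappa> (Some (Leaf 1)) [x]) \<in> carrier AA"
      using x y k1 by (simp_all add: AA.tensor_closed)
    then have "?D (\<kappa> (graft l l) [x, y]) = ?D (\<kappa> (graft l l) [y, x])"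
      unfolding D2[OF x y] D2[OF y x] by (rule AA.M.a_comm)
    moreover have "?D g = ?D (\<kappa> (graft l l) [x, y]) \<ominus>\<^bsub>AA\<^esub> ?D (\<kappa> (graft l l) [y, x]) \<ominus>\<^bsub>AA\<^esub> ?D (\<kappa> l [bracket x y])"
      unfolding g l_def
      by (subst D.map_minus, use x y k1 k2[unfolded l_def] bracket in \<open>simp del: graft.simps\<close>,
          use bracket[OF x y] k1 in blast,
          subst D.map_minus[OF k2[unfolded l_def, OF x y] k2[unfolded l_def, OF y x]], rule refl)
    moreover have "?D (\<kappa> l [bracket x y]) = \<zero>\<^bsub>AA\<^esub>"
      unfolding l_def by (rule D1[OF bracket[OF x y]])
    ultimately show ?thesis
      using D.map_closed[OF k2[OF y x]] by (simp add: AA.minus_self_iff)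
  qed
  have gen_in_J: "x \<in> X \<Longrightarrow> x \<in> ?J" for x
    using generated_ideal_superset[of X K A] by blast
  have J: "two_sided_ideal K A ?J"
    by (rule two_sided_ideal_generated[OF module_axioms mult_bilinear X])
  then have HJ: "submodule ?J K A"
    by (simp add: two_sided_ideal_def)
  show ?thesis
  proof (rule hom_hopf_ideal_generated[OF X refl])
    fix g assume g: "g \<in> X"
    then have gA: "g \<in> carrier A"
      using X by auto
    have "comult A g = tensor K A A \<one>\<^bsub>A\<^esub> g \<oplus>\<^bsub>AA\<^esub> tensor K A A g \<one>\<^bsub>A\<^esub>"
      using D_zero[OF g] by (simp add: AA.minus_self_iff \<Delta>_closed t gA)
    then show "comult A g \<in> coideal_part ?J"
      using coideal_part_gens[OF gen_in_J[OF g] one_closed] AA.submoduleE(5)[OF coideal_part_submodule[OF submoduleE(1)[OF HJ]]]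
      by simp
    have e1: "counit A (\<kappa> (Some (Leaf n)) [x]) = \<zero>\<^bsub>base_module K\<^esub>" if "x \<in> carrier G" for n x
      using counit_kappa[OF d1[OF that]] by (simp add: base_module_def)
    have e2: "counit A (\<kappa> (graft l l) [x, y]) = \<zero>\<^bsub>base_module K\<^esub>" if "x \<in> carrier G" "y \<in> carrier G" for x y
      using counit_kappa[OF d2[OF that]] by (simp add: base_module_def l_def)
    have "counit A g = \<zero>\<^bsub>base_module K\<^esub>"
      using g unfolding X_def
      by (auto simp del: graft.simps simp: l_def \<epsilon>.map_minus k1 k2[unfolded l_def] \<alpha>_pow bracket e1
          e2[unfolded l_def] \<epsilon>.N.minus_self_iff)
    then show "counit A g = \<zero>\<^bsub>K\<^esub>"
      by (simp add: base_module_def)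
    have s1: "antipode A (\<kappa> (Some (Leaf n)) [x]) = \<ominus>\<^bsub>A\<^esub> \<kappa> (Some (Leaf n)) [x]" if "x \<in> carrier G" for n x
      using antipode_kappa[OF d1[OF that]] k1[OF that] by (simp add: tree_sign_def smult_l_minus)
    have s2: "antipode A (\<kappa> (graft l l) [x, y]) = \<kappa> (graft l l) [y, x]" if xy: "x \<in> carrier G" "y \<in> carrier G" for x y
    proof -
      have "tree_sign K (graft l l) = \<one>\<^bsub>K\<^esub>"
        by (simp add: tree_sign_def l_def numeral_2_eq_2 R.l_minus R.r_minus)
      moreover have "basis_mirror (graft l l) = graft l l"
        by (simp add: l_def)
      ultimately show ?thesis
        using antipode_kappa[OF d2[OF xy]] k2[OF xy(2,1)] by simp
    qed
    have "antipode A g = \<ominus>\<^bsub>A\<^esub> g"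
      using g unfolding X_def
    proof (elim UnE CollectE exE conjE)
      fix n x assume g: "g = \<kappa> (Some (Leaf n)) [x] \<ominus>\<^bsub>A\<^esub> \<kappa> l [(\<alpha> ^^ n) x]" and x: "x \<in> carrier G"
      show ?thesis
        unfolding g l_def using k1[OF x] k1[OF \<alpha>_pow[OF x]]
        by (simp add: M.minus_eq M.minus_add S.map_add S.map_neg s1 x \<alpha>_pow)
    next
      fix x y assume g: "g = \<kappa> (graft l l) [x, y] \<ominus>\<^bsub>A\<^esub> \<kappa> (graft l l) [y, x] \<ominus>\<^bsub>A\<^esub> \<kappa> l [bracket x y]"
        and x: "x \<in> carrier G" and y: "y \<in> carrier G"
      have l: "\<kappa> l [bracket x y] \<in> carrier A" "antipode A (\<kappa> l [bracket x y]) = \<ominus>\<^bsub>A\<^esub> \<kappa> l [bracket x y]"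
        unfolding l_def using k1 s1 bracket[OF x y] by blast+
      show ?thesis
        unfolding g using k2[OF x y] k2[OF y x] l
        by (simp add: M.minus_eq M.minus_add M.a_ac S.map_add S.map_neg s2 x y)
    qed
    then show "antipode A g \<in> ?J"
      using submoduleE(3)[OF HJ gen_in_J[OF g]] by simp
  qed
qed

end

theorem proposition4p13:
  fixes K :: "('k, 'r) ring_scheme" and G :: "('k, 'g, 'm) module_scheme"
    and bracket :: "'g \<Rightarrow> 'g \<Rightarrow> 'g" and \<alpha> :: "'g \<Rightarrow> 'g"
  assumes "hom_lie_algebra K G bracket \<alpha>"
  shows "hom_hopf_ideal K (free_hom_assoc K G) (enveloping_ideal K G bracket \<alpha>)"
proof -
  interpret L: hom_lie_algebra K G bracket \<alpha>
    by fact
  interpret decorated_trees K G ..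
  interpret tree_hopf K "free_hom_assoc K G" G "fha_class K G"
    by (rule tree_hopf_free_hom_assoc)
  show ?thesis
    using hom_hopf_ideal_enveloping[of bracket \<alpha>, OF L.bracket_closed L.hom_closed]
    unfolding enveloping_ideal_def Let_def .
qed

end
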